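(* Let $(G,+)$ be a finitely generated abelian group, $G = F \times H$, where $F = \prod_{i=1}^{n} \langle z_i \rangle$ is torsion-free of rank $n$, and $H = \prod_{i=1}^{m} \langle x_i \rangle$ is a finite $2$-group with $|x_1| \ge |x_2| \ge \dots \ge |x_m| > 1$. Let $t_i$ denote the involution in $\langle x_i \rangle$. The possible commutative ring structures $(G,+,\cdot)$ with non-trivial multiplication on $(G,+)$ such that (1) $(G,\circ)$ is a group with $(G,+) \cong (G,\circ)$, where $g \circ h = g + h + gh$, and (2) all automorphisms of $(G,+)$ are also automorphisms of $(G,+,\cdot)$, are exactly those with non-trivial multiplication in the following list of families (the multiplication being determined by the given products of generators, by commutativity and bilinearity). (A) $n = 0$, $m = 1$; $|x_1| > 4$; $x_1^2 \in \{0, t_1\}$. (B) $n = 0$, $m \ge 2$; $|x_1| > |x_2|$; $|x_1| > 4$ if $x_1^2 \ne 0$; $|x_2| > |x_3|$ if $m > 2$ and $x_1x_2 \ne 0$; $x_1^2 \in \{0,t_1\}$; $x_i^2 = 0$ for $i > 1$; $x_1 x_2 \in \{0,t_1\}$; $x_1 x_i = x_2 x_j = x_i x_j = 0$ for $i,j > 2$. (C) $n = 0$, $m \ge 2$; $|x_1| = |x_2| > 4$; $|x_2| > |x_3|$ if $m > 2$; $x_1^2 = t_1$, $x_2^2 = t_2$; $x_1x_2 = t_1 + t_2$; $x_1 x_i = x_2 x_j = x_i x_j = 0$ for $i,j > 2$. (D) $n = 1$, $m \ge 1$; $|x_1| = |x_2| = \dots = |x_k| \ge 4$ for some $k \le m$;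 $|x_k| > |x_{k+1}|$ if $k < m$; $z_1^2 = 0$; $z_1 x_i = t_i$ for $i \le k$; $z_1 x_i = 0$ for $i > k$; $x_i x_j = 0$ for all $i,j$. (E) $n = 1$, $m \ge 1$; $m = 1$, or $m > 1$ and $|x_1| > |x_2|$; $|x_1| \ge 4$ if $z_1x_1 \ne 0$; $z_1^2 \in \{0,t_1\}$; $z_1 x_1 \in \{0,t_1\}$; $z_1 x_i = 0$ for $i > 1$; $x_i x_j = 0$ for all $i,j$. (F) $n = 2$, $m \ge 1$; $|x_1| > |x_2|$ if $m > 1$; $z_1^2 = z_2^2 = 0$; $z_1z_2 \in \{0,t_1\}$; $z_i x_j = 0$ for all $i,j$; $x_i x_j = 0$ for all $i,j$. The groups $(G,+)$ occurring (with some non-trivial multiplication) in the different families are pairwise non-isomorphic, except for (D) and (E), where (E) comprises the case $k = 1$ of (D). For a given group structure occurring with some non-trivial multiplication in the family, each of the families (B) and (E) provides two or four rings, including the ring with trivial multiplication; each of the other families provides two rings, including the ring with trivial multiplication. All of these $G$ can be enlarged to $G \times D$, where $D$ is an abelian group of odd order which lies in the annihilator of the ring.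
   Context: Rings are associative and not required to have a unity. Trivial multiplication means that all products are zero. If $|x_i| = 2^{e_i}$ then $t_i = 2^{e_i - 1}x_i$. Groups are written additively, and products of groups are direct products. *)

theory Defs
  imports
    Complex_Main
    "HOL-Library.FuncSet"
    "HOL-Library.Product_Plus"
    "HOL-Computational_Algebra.Group_Closure"
begin

section \<open>Abelian groups and generators\<close>

text \<open>
  The abelian group \<open>(G,+)\<close> is a type of class \<open>ab_group_add\<close>; a multiplication on it
  is a function \<open>mu\<close>. Generators are indexed from 1, so only the values \<open>z 1, ..., z n\<close> and
  \<open>x 1, ..., x m\<close> matter.
\<close>

abbreviation cyc :: "'a::ab_group_add \<Rightarrow> 'a set" where
  "cyc g \<equiv> group_closure {g}"

text \<open>As usual for \<open>card\<close>, the value is 0 for elements of infinite order.\<close>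

definition elt_order :: "'a::ab_group_add \<Rightarrow> nat" where
  "elt_order g = card (cyc g)"

definition nat_mult :: "nat \<Rightarrow> 'a::ab_group_add \<Rightarrow> 'a" where
  "nat_mult k g = (((+) g) ^^ k) 0"

text \<open>For an element of order \<open>2 ^ e\<close> with \<open>e > 0\<close> this is the multiple by \<open>2 ^ (e - 1)\<close>.\<close>

definition invol :: "'a::ab_group_add \<Rightarrow> 'a" where
  "invol g = nat_mult (elt_order g div 2) g"

definition internal_direct_product :: "'i set \<Rightarrow> ('i \<Rightarrow> 'a::ab_group_add set) \<Rightarrow> bool" where
  "internal_direct_product I C \<longleftrightarrow>
     (\<forall>g. \<exists>!c. c \<in> (\<Pi>\<^sub>E i\<in>I. C i) \<and> g = (\<Sum>i\<in>I. c i))"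

definition decomposition ::
  "nat \<Rightarrow> nat \<Rightarrow> (nat \<Rightarrow> 'a::ab_group_add) \<Rightarrow> (nat \<Rightarrow> 'a) \<Rightarrow> bool" where
  "decomposition n m z x \<longleftrightarrow>
     internal_direct_product ({1..n} <+> {1..m}) (case_sum (\<lambda>i. cyc (z i)) (\<lambda>i. cyc (x i))) \<and>
     (\<forall>i\<in>{1..n}. infinite (cyc (z i))) \<and>
     (\<forall>i\<in>{1..m}. \<exists>e>0. elt_order (x i) = 2 ^ e) \<and>
     (\<forall>i\<in>{1..m}. \<forall>j\<in>{1..m}. i \<le> j \<longrightarrow> elt_order (x j) \<le> elt_order (x i))"

definition group_isom :: "('a::ab_group_add \<Rightarrow> 'b::ab_group_add) \<Rightarrow> bool" where
  "group_isom \<phi> \<longleftrightarrow> additive \<phi> \<and> bij \<phi>"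

section \<open>Multiplications on an abelian group\<close>

text \<open>The class \<open>comm_ring\<close> does not require a unity.\<close>

definition comm_ring_structure :: "('a::ab_group_add \<Rightarrow> 'a \<Rightarrow> 'a) \<Rightarrow> bool" where
  "comm_ring_structure mu \<longleftrightarrow> class.comm_ring (+) 0 (-) uminus mu"

definition trivial_mult :: "'a::ab_group_add \<Rightarrow> 'a \<Rightarrow> 'a" where
  "trivial_mult = (\<lambda>g h. 0)"

definition circ :: "('a::ab_group_add \<Rightarrow> 'a \<Rightarrow> 'a) \<Rightarrow> 'a \<Rightarrow> 'a \<Rightarrow> 'a" where
  "circ mu g h = g + h + mu g h"

definition circ_group_isomorphic :: "('a::ab_group_add \<Rightarrow> 'a \<Rightarrow> 'a) \<Rightarrow> bool" where
  "circ_group_isomorphic mu \<longleftrightarrow>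
     (\<exists>e inv. group (circ mu) e inv) \<and>
     (\<exists>\<phi>::'a \<Rightarrow> 'a. bij \<phi> \<and> (\<forall>g h. \<phi> (g + h) = circ mu (\<phi> g) (\<phi> h)))"

definition ring_isom ::
  "('a::ab_group_add \<Rightarrow> 'a \<Rightarrow> 'a) \<Rightarrow> ('b::ab_group_add \<Rightarrow> 'b \<Rightarrow> 'b) \<Rightarrow> ('a \<Rightarrow> 'b) \<Rightarrow> bool" where
  "ring_isom mu nu \<phi> \<longleftrightarrow> group_isom \<phi> \<and> (\<forall>g h. \<phi> (mu g h) = nu (\<phi> g) (\<phi> h))"

definition automorphisms_lift :: "('a::ab_group_add \<Rightarrow> 'a \<Rightarrow> 'a) \<Rightarrow> bool" where
  "automorphisms_lift mu \<longleftrightarrow> (\<forall>\<alpha>. group_isom \<alpha> \<longrightarrow> ring_isom mu mu \<alpha>)"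

definition good_ring :: "('a::ab_group_add \<Rightarrow> 'a \<Rightarrow> 'a) \<Rightarrow> bool" where
  "good_ring mu \<longleftrightarrow>
     comm_ring_structure mu \<and> mu \<noteq> trivial_mult \<and>
     circ_group_isomorphic mu \<and> automorphisms_lift mu"

text \<open>The ring on \<open>G \<times> D\<close> in which \<open>D\<close> lies in the annihilator.\<close>

definition enlarge ::
  "('a::ab_group_add \<Rightarrow> 'a \<Rightarrow> 'a) \<Rightarrow> 'a \<times> 'd::ab_group_add \<Rightarrow> 'a \<times> 'd \<Rightarrow> 'a \<times> 'd" where
  "enlarge mu p q = (mu (fst p) (fst q), 0)"

section \<open>The families\<close>

text \<open>
  Associativity is deliberately not demanded in the families: a multiplication
  belongs to a family if it is commutative and bilinear and has the given products of generators.
\<close>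

definition comm_bilinear :: "('a::ab_group_add \<Rightarrow> 'a \<Rightarrow> 'a) \<Rightarrow> bool" where
  "comm_bilinear mu \<longleftrightarrow> (\<forall>g h. mu g h = mu h g) \<and> (\<forall>g. additive (mu g))"

definition family_A ::
  "nat \<Rightarrow> nat \<Rightarrow> (nat \<Rightarrow> 'a::ab_group_add) \<Rightarrow> (nat \<Rightarrow> 'a) \<Rightarrow> ('a \<Rightarrow> 'a \<Rightarrow> 'a) \<Rightarrow> bool" where
  "family_A n m z x mu \<longleftrightarrow> comm_bilinear mu \<and>
     n = 0 \<and> m = 1 \<and> elt_order (x 1) > 4 \<and>
     mu (x 1) (x 1) \<in> {0, invol (x 1)}"

definition family_B ::
  "nat \<Rightarrow> nat \<Rightarrow> (nat \<Rightarrow> 'a::ab_group_add) \<Rightarrow> (nat \<Rightarrow> 'a) \<Rightarrow> ('a \<Rightarrow> 'a \<Rightarrow> 'a) \<Rightarrow> bool" where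
  "family_B n m z x mu \<longleftrightarrow> comm_bilinear mu \<and>
     n = 0 \<and> m \<ge> 2 \<and> elt_order (x 1) > elt_order (x 2) \<and>
     (mu (x 1) (x 1) \<noteq> 0 \<longrightarrow> elt_order (x 1) > 4) \<and>
     (m > 2 \<and> mu (x 1) (x 2) \<noteq> 0 \<longrightarrow> elt_order (x 2) > elt_order (x 3)) \<and>
     mu (x 1) (x 1) \<in> {0, invol (x 1)} \<and>
     (\<forall>i\<in>{2..m}. mu (x i) (x i) = 0) \<and>
     mu (x 1) (x 2) \<in> {0, invol (x 1)} \<and>
     (\<forall>i\<in>{3..m}. \<forall>j\<in>{3..m}.
        mu (x 1) (x i) = 0 \<and> mu (x 2) (x j) = 0 \<and> mu (x i) (x j) = 0)"

definition family_C ::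
  "nat \<Rightarrow> nat \<Rightarrow> (nat \<Rightarrow> 'a::ab_group_add) \<Rightarrow> (nat \<Rightarrow> 'a) \<Rightarrow> ('a \<Rightarrow> 'a \<Rightarrow> 'a) \<Rightarrow> bool" where
  "family_C n m z x mu \<longleftrightarrow> comm_bilinear mu \<and>
     n = 0 \<and> m \<ge> 2 \<and> elt_order (x 1) = elt_order (x 2) \<and> elt_order (x 2) > 4 \<and>
     (m > 2 \<longrightarrow> elt_order (x 2) > elt_order (x 3)) \<and>
     mu (x 1) (x 1) = invol (x 1) \<and> mu (x 2) (x 2) = invol (x 2) \<and>
     mu (x 1) (x 2) = invol (x 1) + invol (x 2) \<and>
     (\<forall>i\<in>{3..m}. \<forall>j\<in>{3..m}.
        mu (x 1) (x i) = 0 \<and> mu (x 2) (x j) = 0 \<and> mu (x i) (x j) = 0)"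

definition family_D_with ::
  "nat \<Rightarrow> nat \<Rightarrow> nat \<Rightarrow> (nat \<Rightarrow> 'a::ab_group_add) \<Rightarrow> (nat \<Rightarrow> 'a) \<Rightarrow> ('a \<Rightarrow> 'a \<Rightarrow> 'a) \<Rightarrow> bool" where
  "family_D_with k n m z x mu \<longleftrightarrow> comm_bilinear mu \<and>
     n = 1 \<and> m \<ge> 1 \<and> 1 \<le> k \<and> k \<le> m \<and>
     (\<forall>i\<in>{1..k}. elt_order (x i) = elt_order (x 1)) \<and> elt_order (x 1) \<ge> 4 \<and>
     (k < m \<longrightarrow> elt_order (x k) > elt_order (x (k + 1))) \<and>
     mu (z 1) (z 1) = 0 \<and>
     (\<forall>i\<in>{1..k}. mu (z 1) (x i) = invol (x i)) \<and>
     (\<forall>i\<in>{k<..m}. mu (z 1) (x i) = 0) \<and>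
     (\<forall>i\<in>{1..m}. \<forall>j\<in>{1..m}. mu (x i) (x j) = 0)"

definition family_D ::
  "nat \<Rightarrow> nat \<Rightarrow> (nat \<Rightarrow> 'a::ab_group_add) \<Rightarrow> (nat \<Rightarrow> 'a) \<Rightarrow> ('a \<Rightarrow> 'a \<Rightarrow> 'a) \<Rightarrow> bool" where
  "family_D n m z x mu \<longleftrightarrow> (\<exists>k. family_D_with k n m z x mu)"

definition family_E ::
  "nat \<Rightarrow> nat \<Rightarrow> (nat \<Rightarrow> 'a::ab_group_add) \<Rightarrow> (nat \<Rightarrow> 'a) \<Rightarrow> ('a \<Rightarrow> 'a \<Rightarrow> 'a) \<Rightarrow> bool" where
  "family_E n m z x mu \<longleftrightarrow> comm_bilinear mu \<and>
     n = 1 \<and> m \<ge> 1 \<and> (m = 1 \<or> m > 1 \<and> elt_order (x 1) > elt_order (x 2)) \<and>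
     (mu (z 1) (x 1) \<noteq> 0 \<longrightarrow> elt_order (x 1) \<ge> 4) \<and>
     mu (z 1) (z 1) \<in> {0, invol (x 1)} \<and>
     mu (z 1) (x 1) \<in> {0, invol (x 1)} \<and>
     (\<forall>i\<in>{2..m}. mu (z 1) (x i) = 0) \<and>
     (\<forall>i\<in>{1..m}. \<forall>j\<in>{1..m}. mu (x i) (x j) = 0)"

definition family_F ::
  "nat \<Rightarrow> nat \<Rightarrow> (nat \<Rightarrow> 'a::ab_group_add) \<Rightarrow> (nat \<Rightarrow> 'a) \<Rightarrow> ('a \<Rightarrow> 'a \<Rightarrow> 'a) \<Rightarrow> bool" where
  "family_F n m z x mu \<longleftrightarrow> comm_bilinear mu \<and>
     n = 2 \<and> m \<ge> 1 \<and> (m > 1 \<longrightarrow> elt_order (x 1) > elt_order (x 2)) \<and>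
     mu (z 1) (z 1) = 0 \<and> mu (z 2) (z 2) = 0 \<and>
     mu (z 1) (z 2) \<in> {0, invol (x 1)} \<and>
     (\<forall>i\<in>{1..2}. \<forall>j\<in>{1..m}. mu (z i) (x j) = 0) \<and>
     (\<forall>i\<in>{1..m}. \<forall>j\<in>{1..m}. mu (x i) (x j) = 0)"

datatype family = Fam_A | Fam_B | Fam_C | Fam_D | Fam_E | Fam_F

fun in_family ::
  "family \<Rightarrow> nat \<Rightarrow> nat \<Rightarrow> (nat \<Rightarrow> 'a::ab_group_add) \<Rightarrow> (nat \<Rightarrow> 'a) \<Rightarrow> ('a \<Rightarrow> 'a \<Rightarrow> 'a) \<Rightarrow> bool" where
  "in_family Fam_A = family_A"
| "in_family Fam_B = family_B"
| "in_family Fam_C = family_C"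
| "in_family Fam_D = family_D"
| "in_family Fam_E = family_E"
| "in_family Fam_F = family_F"

definition occurs_in ::
  "family \<Rightarrow> nat \<Rightarrow> nat \<Rightarrow> (nat \<Rightarrow> 'a::ab_group_add) \<Rightarrow> (nat \<Rightarrow> 'a) \<Rightarrow> bool" where
  "occurs_in X n m z x \<longleftrightarrow> (\<exists>mu. mu \<noteq> trivial_mult \<and> in_family X n m z x mu)"

text \<open>
  The products listed for (C) and (D) do not allow the trivial multiplication, but it
  is counted among the rings provided by every family; hence the \<open>insert\<close>.
\<close>

definition family_rings ::
  "family \<Rightarrow> nat \<Rightarrow> nat \<Rightarrow> (nat \<Rightarrow> 'a::ab_group_add) \<Rightarrow> (nat \<Rightarrow> 'a) \<Rightarrow> ('a \<Rightarrow> 'a \<Rightarrow> 'a) set" where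
  "family_rings X n m z x = insert trivial_mult {mu. in_family X n m z x mu}"

end

theory Submission
  imports Defs
begin

text \<open>
  The map \<open>g \<mapsto> - g\<close> is an automorphism of \<open>(G,+)\<close>, and if it respects the multiplication,
  then all products have order at most two (\<open>invariant_form_double\<close>). So the multiplication is a
  symmetric bilinear map on \<open>G / 2 G\<close> with values in the span of the involutions \<open>t\<^sub>i\<close>, and
  condition (2) says that it is equivariant under all automorphisms.

  To exploit this it suffices to consider transvections, which add a multiple of one generator to
  another. A transvection that fixes all involutions forces products to vanish
  (\<open>invariant_form_small_gen\<close>); one that acts trivially on the factors restricts the involutions
  that can occur as values (\<open>invariant_form_avoids_small\<close>, \<open>invariant_form_avoids_other\<close>); and one
  between generators of equal order relates their products (\<open>invariant_form_equal_orders\<close>). Together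
  these relations leave exactly the listed products, except for the lower bounds on the orders. The
  bounds come from condition (1): for too small orders either cancellation fails in the circle
  group, or the circle group has exponent two although \<open>(G,+)\<close> does not (\<open>square_order_gt_4\<close>,
  \<open>free_action_order_ge_4\<close>).

  Conversely, each listed multiplication is a sum of simple forms that have a quadratic refinement
  \<open>q\<close>, like \<open>(a choose 2) t\<close> for the square and \<open>a b t\<close> for the mixed product of coordinates
  \<open>a\<close> and \<open>b\<close>. Then \<open>g \<mapsto> g + q g\<close> is an isomorphism from \<open>(G,+)\<close> to the circle group
  (\<open>refinable_circ_isomorphic\<close>). The binomial coefficient must be well defined and vanish on the
  values, which is where the bound \<open>|x\<^sub>1| > 4\<close> enters again. Invariance is shown by describing the
  forms without coordinates: through subgroups \<open>{2 u + v | N v = 0}\<close>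
  (\<open>even_coordinates_invariant\<close>), through multiplication by half of the largest order
  (\<open>form_C_invariant\<close>), and through the action on the torsion-free quotient (\<open>form_D_invariant\<close>).

  Since every multiplication in a family is invariant, isomorphic ones on the same group are equal,
  and counting rings amounts to counting admissible parameters. The groups of different families are
  told apart by the rank and by the existence of unique or of characteristic involutions
  (\<open>occurs_in_kind\<close>). An automorphism of \<open>G \<times> D\<close> with \<open>D\<close> of odd order preserves \<open>D\<close>, the odd
  torsion, and so induces an automorphism of \<open>G\<close> (\<open>enlarge_automorphism\<close>), which transfers the
  result to the enlarged rings.
\<close>

section \<open>Integer multiples and orders of elements\<close>

text \<open>
  Every abelian group is a module over the integers. Making this structure explicit lets the
  general theory of modules provide the computation rules for multiples.
\<close>

definition zsmul :: "int \<Rightarrow> 'a::ab_group_add \<Rightarrow> 'a" (infixr "\<odot>" 75) where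
  "k \<odot> g = (if 0 \<le> k then nat_mult (nat k) g else - nat_mult (nat (- k)) g)"

lemma nat_mult_0 [simp]: "nat_mult 0 g = 0"
  and nat_mult_Suc [simp]: "nat_mult (Suc k) g = g + nat_mult k g"
  by (simp_all add: nat_mult_def)

lemma zsmul_add_one: "(k + 1) \<odot> g = k \<odot> g + g"
proof (cases "0 \<le> k")
  case True
  then have "nat (k + 1) = Suc (nat k)" by simp
  with True show ?thesis by (simp add: zsmul_def add.commute)
next
  case False
  then have "nat (- k) = Suc (nat (- k - 1))" by simp
  with False show ?thesis by (auto simp add: zsmul_def)
qed

lemma zsmul_one [simp]: "1 \<odot> g = g"
  using zsmul_add_one[of 0 g] by (simp add: zsmul_def)

lemma zsmul_distrib_left: "(a + b) \<odot> g = a \<odot> g + b \<odot> g"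
proof (induction b rule: int_induct[of _ 0])
  case base
  show ?case by (simp add: zsmul_def)
next
  case (step1 b)
  then show ?case using zsmul_add_one[of "a + b" g] zsmul_add_one[of b g]
    by (simp add: add.assoc)
next
  case (step2 b)
  then show ?case using zsmul_add_one[of "a + (b - 1)" g] zsmul_add_one[of "b - 1" g]
    by (simp add: add_diff_eq flip: add.assoc)
qed

lemma zsmul_distrib_right: "a \<odot> (g + h) = a \<odot> g + a \<odot> h"
proof (induction a rule: int_induct[of _ 0])
  case base
  show ?case by (simp add: zsmul_def)
next
  case (step1 b)
  then show ?case unfolding zsmul_add_one by (simp add: add_ac)
next
  case (step2 b)
  then show ?case using zsmul_add_one[of "b - 1" g] zsmul_add_one[of "b - 1" h] zsmul_add_one[of "b - 1" "g + h"]
    by (simp add: algebra_simps)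
qed

lemma zsmul_assoc: "a \<odot> (b \<odot> g) = (a * b) \<odot> g"
proof (induction a rule: int_induct[of _ 0])
  case base
  show ?case by (simp add: zsmul_def)
next
  case (step1 a)
  then show ?case by (simp add: zsmul_add_one zsmul_distrib_left algebra_simps)
next
  case (step2 a)
  then show ?case
    using zsmul_add_one[of "a - 1" "b \<odot> g"] zsmul_distrib_left[of "(a - 1) * b" b g]
    by (simp add: algebra_simps)
qed

interpretation zmod: module zsmul
  by unfold_locales (simp_all add: zsmul_distrib_left zsmul_distrib_right zsmul_assoc)

lemma nat_mult_eq_zsmul: "nat_mult k g = int k \<odot> g"
  by (simp add: zsmul_def)

lemma zsmul_two: "2 \<odot> g = g + g"
  using zsmul_distrib_left[of 1 1 g] by simp

lemma additive_zsmul: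
  assumes "additive f"
  shows "f (k \<odot> g) = k \<odot> f g"
proof (induction k rule: int_induct[of _ 0])
  case base
  show ?case by (simp add: additive.zero[OF assms])
next
  case (step1 k)
  then show ?case by (simp add: zsmul_add_one additive.add[OF assms])
next
  case (step2 k)
  then show ?case by (simp add: zmod.scale_left_diff_distrib additive.diff[OF assms])
qed

lemma additive_zsmul_right: "additive (\<lambda>g. k \<odot> g)"
  by unfold_locales (rule zsmul_distrib_right)

lemma cyc_eq: "cyc g = range (\<lambda>k. k \<odot> g)"
proof (intro equalityI subsetI)
  fix h assume "h \<in> cyc g"
  then show "h \<in> range (\<lambda>k. k \<odot> g)"
  proof induction
    case (base s)
    then have "s = 0 \<odot> g \<or> s = 1 \<odot> g" by auto
    then show ?case by blast
  next
    case (diff s t)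
    then obtain a b where "s = a \<odot> g" "t = b \<odot> g" by blast
    then have "s - t = (a - b) \<odot> g" by (simp add: zmod.scale_left_diff_distrib)
    then show ?case by blast
  qed
next
  fix h assume "h \<in> range (\<lambda>k. k \<odot> g)"
  then obtain k where h: "h = k \<odot> g" by blast
  have g: "g \<in> cyc g" by (simp add: group_closure.base)
  show "h \<in> cyc g" unfolding h
  proof (induction k rule: int_induct[of _ 0])
    case base
    show ?case by simp
  next
    case (step1 k)
    then show ?case by (simp add: zsmul_add_one group_closure_add g)
  next
    case (step2 k)
    then show ?case by (simp add: zmod.scale_left_diff_distrib group_closure.diff g)
  qed
qed

text \<open>
  An element of infinite order has order \<open>0\<close>, and \<open>0 dvd k\<close> means \<open>k = 0\<close>. So one
  divisibility condition covers finite and infinite order, and the later arguments need not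
  separate the generators of the torsion-free part from those of the finite part.
\<close>

lemma zsmul_eq_0_iff: "k \<odot> g = 0 \<longleftrightarrow> int (elt_order g) dvd k"
proof (cases "\<exists>k>0. k \<odot> g = 0")
  case False
  have nz: "k = 0" if "k \<odot> g = 0" for k
  proof (rule ccontr)
    assume "k \<noteq> 0"
    then have "\<bar>k\<bar> > 0" "\<bar>k\<bar> \<odot> g = 0" using that by (auto simp: abs_if)
    with False show False by blast
  qed
  have "inj (\<lambda>k. k \<odot> g)"
  proof (rule injI)
    fix a b assume "a \<odot> g = b \<odot> g"
    then have "(a - b) \<odot> g = 0" by (simp add: zmod.scale_left_diff_distrib)
    then show "a = b" using nz by fastforce
  qed
  then have "infinite (cyc g)"
    by (simp add: cyc_eq finite_image_iff)
  then have "elt_order g = 0" by (simp add: elt_order_def)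
  with nz show ?thesis by auto
next
  case True
  \<comment> \<open>The least positive annihilating multiple; multiples of \<open>g\<close> are then determined modulo \<open>N\<close>.\<close>
  define N where "N = (LEAST N::nat. N > 0 \<and> int N \<odot> g = 0)"
  have ex: "\<exists>N::nat. N > 0 \<and> int N \<odot> g = 0"
  proof -
    obtain k where "k > 0" "k \<odot> g = 0" using True by blast
    then have "nat k > 0 \<and> int (nat k) \<odot> g = 0" by simp
    then show ?thesis by blast
  qed
  have N: "N > 0" "int N \<odot> g = 0"
    using LeastI_ex[OF ex] unfolding N_def by auto
  have small: False if "a < N" "a > 0" "int a \<odot> g = 0" for a
    using not_less_Least[of a "\<lambda>N. N > 0 \<and> int N \<odot> g = 0"] that unfolding N_def by blast
  have red: "k \<odot> g = (k mod int N) \<odot> g" for k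
  proof -
    have "k \<odot> g = (k div int N * int N + k mod int N) \<odot> g" by simp
    also have "\<dots> = (k div int N) \<odot> (int N \<odot> g) + (k mod int N) \<odot> g"
      by (simp only: zsmul_distrib_left zmod.scale_scale)
    finally show ?thesis by (simp add: N)
  qed
  have iff: "k \<odot> g = 0 \<longleftrightarrow> int N dvd k" for k
  proof
    assume "k \<odot> g = 0"
    then have *: "(k mod int N) \<odot> g = 0" using red by simp
    have "k mod int N = 0"
    proof (rule ccontr)
      assume "k mod int N \<noteq> 0"
      moreover have "k mod int N \<ge> 0" "k mod int N < int N" using N by auto
      ultimately show False using small[of "nat (k mod int N)"] * by (simp add: nat_less_iff)
    qed
    then show "int N dvd k" by auto
  next
    assume "int N dvd k"
    then show "k \<odot> g = 0" using red[of k] by auto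
  qed
  have "cyc g = (\<lambda>a. int a \<odot> g) ` {..<N}"
  proof
    show "cyc g \<subseteq> (\<lambda>a. int a \<odot> g) ` {..<N}"
    proof
      fix h assume "h \<in> cyc g"
      then obtain k where "h = k \<odot> g" by (auto simp: cyc_eq)
      then have "h = int (nat (k mod int N)) \<odot> g" using red[of k] N by simp
      moreover have "nat (k mod int N) < N" using N by (simp add: nat_less_iff)
      ultimately show "h \<in> (\<lambda>a. int a \<odot> g) ` {..<N}" by blast
    qed
  qed (auto simp: cyc_eq)
  moreover have "inj_on (\<lambda>a. int a \<odot> g) {..<N}"
  proof (rule inj_onI)
    fix a b assume ab: "a \<in> {..<N}" "b \<in> {..<N}" "int a \<odot> g = int b \<odot> g"
    then have "(int a - int b) \<odot> g = 0" by (simp add: zmod.scale_left_diff_distrib)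
    then have "int N dvd int a - int b" by (simp add: iff)
    then have "int a mod int N = int b mod int N" by (simp add: mod_eq_dvd_iff)
    with ab show "a = b" by simp
  qed
  ultimately have "elt_order g = N" by (simp add: elt_order_def card_image)
  then show ?thesis using iff by simp
qed

lemma elt_order_eq_0_iff: "elt_order g = 0 \<longleftrightarrow> infinite (cyc g)"
proof -
  have "cyc g \<noteq> {}" using zero_in_group_closure[of "{g}"] by blast
  then show ?thesis by (simp add: elt_order_def card_eq_0_iff)
qed

lemma invol_eq: "invol g = int (elt_order g div 2) \<odot> g"
  by (simp add: invol_def nat_mult_eq_zsmul)

section \<open>Coordinates in a direct sum of cyclic groups\<close>

text \<open>
  A coordinate that is known modulo \<open>c\<close> may be multiplied by \<open>a\<close> and then read modulo any
  divisor of \<open>c * a\<close>.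
\<close>

lemma dvd_mult_trans: "c dvd x \<Longrightarrow> p dvd c * a \<Longrightarrow> p dvd x * a" for a :: int
  by (meson dvd_trans mult_dvd_mono dvd_refl)

text \<open>
  A direct sum of cyclic groups of infinite or \<open>2\<close>-power order, over any finite index set.
  The coordinates \<open>coord g\<close> below are a chosen integer representation; only their residues
  modulo the orders of the generators are determined by \<open>g\<close>.
\<close>

locale generating_system =
  fixes I :: "'i set" and gen :: "'i \<Rightarrow> 'a::ab_group_add"
  assumes finite_I: "finite I"
    and spanning: "\<exists>c. g = (\<Sum>i\<in>I. c i \<odot> gen i)"
    and independent: "(\<Sum>i\<in>I. c i \<odot> gen i) = 0 \<Longrightarrow> i \<in> I \<Longrightarrow> c i \<odot> gen i = 0"
    and order_cases: "i \<in> I \<Longrightarrow> elt_order (gen i) = 0 \<or> (\<exists>e>0. elt_order (gen i) = 2 ^ e)"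
begin

definition ord :: "'i \<Rightarrow> int" where
  "ord i = int (elt_order (gen i))"

definition coord :: "'a \<Rightarrow> 'i \<Rightarrow> int" where
  "coord g = (SOME c. g = (\<Sum>i\<in>I. c i \<odot> gen i))"

lemma zsmul_gen_eq_0_iff: "k \<odot> gen i = 0 \<longleftrightarrow> ord i dvd k"
  by (simp add: zsmul_eq_0_iff ord_def)

lemma zsmul_gen_eq_iff: "k \<odot> gen i = l \<odot> gen i \<longleftrightarrow> ord i dvd k - l"
  using zsmul_gen_eq_0_iff[of "k - l" i] by (simp add: zmod.scale_left_diff_distrib)

lemma ord_nonneg [simp]: "0 \<le> ord i"
  by (simp add: ord_def)

lemma even_ord: "i \<in> I \<Longrightarrow> even (ord i)"
  using order_cases[of i] by (auto simp: ord_def)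

lemma coord_expansion: "(\<Sum>i\<in>I. coord g i \<odot> gen i) = g"
  unfolding coord_def by (rule someI_ex[OF spanning, symmetric])

lemma coord_cong:
  assumes "i \<in> I" "g = (\<Sum>i\<in>I. c i \<odot> gen i)"
  shows "ord i dvd coord g i - c i"
proof -
  have "(\<Sum>i\<in>I. (coord g i - c i) \<odot> gen i) = 0"
    using assms(2) coord_expansion[of g] by (simp add: zmod.scale_left_diff_distrib sum_subtractf)
  from independent[OF this assms(1)] show ?thesis by (simp add: zsmul_gen_eq_0_iff)
qed

lemma coord_add: "i \<in> I \<Longrightarrow> ord i dvd coord (g + h) i - (coord g i + coord h i)"
  by (rule coord_cong) (simp_all add: zsmul_distrib_left sum.distrib coord_expansion)

lemma coord_zsmul: "i \<in> I \<Longrightarrow> ord i dvd coord (k \<odot> g) i - k * coord g i"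
  by (rule coord_cong) (simp_all add: coord_expansion flip: zmod.scale_scale zmod.scale_sum_right)

lemma coord_gen:
  assumes "i \<in> I" "j \<in> I"
  shows "ord i dvd coord (gen j) i - (if i = j then 1 else 0)"
proof (rule coord_cong[OF assms(1)])
  have "(\<Sum>i\<in>I. (if i = j then 1 else 0) \<odot> gen i) = (\<Sum>i\<in>I. if i = j then gen i else 0)"
    by (rule sum.cong) auto
  then show "gen j = (\<Sum>i\<in>I. (if i = j then 1 else 0) \<odot> gen i)"
    using finite_I assms by simp
qed

lemma coord_gen_zsmul:
  assumes "i \<in> I" "j \<in> I"
  shows "ord i dvd coord (k \<odot> gen j) i - (if i = j then k else 0)"
proof -
  have "coord (k \<odot> gen j) i - (if i = j then k else 0) =
    (coord (k \<odot> gen j) i - k * coord (gen j) i) + k * (coord (gen j) i - (if i = j then 1 else 0))"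
    by (simp add: algebra_simps)
  then show ?thesis using coord_zsmul[OF assms(1)] coord_gen[OF assms] by (simp only: dvd_add dvd_mult)
qed

lemma eq_0_iff_coord: "g = 0 \<longleftrightarrow> (\<forall>i\<in>I. ord i dvd coord g i)"
proof
  assume "g = 0"
  then show "\<forall>i\<in>I. ord i dvd coord g i" using coord_cong[of _ g "\<lambda>_. 0"] by simp
next
  assume "\<forall>i\<in>I. ord i dvd coord g i"
  then have "(\<Sum>i\<in>I. coord g i \<odot> gen i) = 0"
    by (intro sum.neutral) (simp add: zsmul_gen_eq_0_iff)
  then show "g = 0" by (simp add: coord_expansion)
qed

lemma zsmul_eq_0_iff_coord: "k \<odot> g = 0 \<longleftrightarrow> (\<forall>i\<in>I. ord i dvd k * coord g i)"
proof -
  have "ord i dvd coord (k \<odot> g) i \<longleftrightarrow> ord i dvd k * coord g i" if "i \<in> I" for i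
    using coord_zsmul[OF that, of k g] by (metis diff_add_cancel dvd_add_right_iff)
  then show ?thesis by (simp add: eq_0_iff_coord)
qed

lemma additive_eqI:
  assumes "additive f" "additive f'" "\<And>i. i \<in> I \<Longrightarrow> f (gen i) = f' (gen i)"
  shows "f = f'"
proof
  fix g
  have "f (\<Sum>i\<in>I. coord g i \<odot> gen i) = f' (\<Sum>i\<in>I. coord g i \<odot> gen i)"
    using assms(3) by (simp add: additive.sum[OF assms(1)] additive.sum[OF assms(2)]
        additive_zsmul[OF assms(1)] additive_zsmul[OF assms(2)])
  then show "f g = f' g" by (simp add: coord_expansion)
qed

lemma comm_bilinear_eqI:
  assumes "comm_bilinear mu" "comm_bilinear nu"
    and "\<And>i j. i \<in> I \<Longrightarrow> j \<in> I \<Longrightarrow> mu (gen i) (gen j) = nu (gen i) (gen j)"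
  shows "mu = nu"
proof -
  have 1: "mu (gen i) = nu (gen i)" if "i \<in> I" for i
    using assms that by (intro additive_eqI) (auto simp: comm_bilinear_def)
  have "mu g = nu g" for g
  proof (rule additive_eqI)
    fix i assume "i \<in> I"
    then show "mu g (gen i) = nu g (gen i)" using 1 assms(1,2) unfolding comm_bilinear_def by metis
  qed (use assms in \<open>auto simp: comm_bilinear_def\<close>)
  then show ?thesis by blast
qed

subsection \<open>Transvections\<close>

text \<open>
  The automorphism that adds \<open>a\<close> times generator \<open>j\<close> to generator \<open>i\<close> and fixes the other
  generators. Written in coordinates it needs no extension argument: the map is well defined
  exactly when the relation of \<open>gen i\<close> is respected, that is, when \<open>ord j dvd ord i * a\<close>.
\<close>

definition transvection :: "'i \<Rightarrow> 'i \<Rightarrow> int \<Rightarrow> 'a \<Rightarrow> 'a" where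
  "transvection i j a g = g + (coord g i * a) \<odot> gen j"

lemma additive_transvection:
  assumes "i \<in> I" "ord j dvd ord i * a"
  shows "additive (transvection i j a)"
proof
  fix g h
  have "ord j dvd (coord (g + h) i - (coord g i + coord h i)) * a"
    using coord_add[OF assms(1), of g h] assms(2) by (rule dvd_mult_trans)
  then have "(coord (g + h) i * a) \<odot> gen j = (coord g i * a + coord h i * a) \<odot> gen j"
    unfolding zsmul_gen_eq_iff by (simp add: algebra_simps)
  then show "transvection i j a (g + h) = transvection i j a g + transvection i j a h"
    by (simp add: transvection_def zsmul_distrib_left add_ac)
qed

lemma group_isom_transvection:
  assumes "i \<in> I" "j \<in> I" "i \<noteq> j" "ord j dvd ord i * a"
  shows "group_isom (transvection i j a)"
proof -
  \<comment> \<open>Since \<open>j\<close> differs from \<open>i\<close>, adding multiples of \<open>gen j\<close> does not change the coordinate \<open>i\<close> that controls the map.\<close>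
  have inverse: "transvection i j (- b) (transvection i j b g) = g" if b: "ord j dvd ord i * b" for b g
  proof -
    have "coord (transvection i j b g) i - coord g i =
      (coord (g + (coord g i * b) \<odot> gen j) i - (coord g i + coord ((coord g i * b) \<odot> gen j) i))
      + (coord ((coord g i * b) \<odot> gen j) i - 0)"
      by (simp add: transvection_def)
    moreover have "ord i dvd coord ((coord g i * b) \<odot> gen j) i - 0"
      using coord_gen_zsmul[OF assms(1,2), of "coord g i * b"] assms(3) by simp
    ultimately have "ord i dvd coord (transvection i j b g) i - coord g i"
      by (simp only: dvd_add coord_add assms(1))
    then have "ord j dvd (coord (transvection i j b g) i - coord g i) * b"
      using b by (rule dvd_mult_trans)
    then have "(coord (transvection i j b g) i * b) \<odot> gen j = (coord g i * b) \<odot> gen j"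
      by (simp add: zsmul_gen_eq_iff algebra_simps)
    then have "transvection i j (- b) (transvection i j b g) = transvection i j b g - (coord g i * b) \<odot> gen j"
      by (subst transvection_def) simp
    then show ?thesis by (simp add: transvection_def)
  qed
  have "bij (transvection i j a)"
  proof (rule o_bij)
    show "transvection i j (- a) \<circ> transvection i j a = id"
      using inverse[OF assms(4)] by auto
    show "transvection i j a \<circ> transvection i j (- a) = id"
      using inverse[of "- a"] assms(4) by auto
  qed
  with additive_transvection[OF assms(1,4)] show ?thesis by (simp add: group_isom_def)
qed

lemma transvection_gen_same:
  assumes "i \<in> I" "ord j dvd ord i * a"
  shows "transvection i j a (gen i) = gen i + a \<odot> gen j"
proof -
  have "ord j dvd (coord (gen i) i - 1) * a"
    using coord_gen[OF assms(1,1)] assms(2) by (auto intro: dvd_mult_trans)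
  then have "(coord (gen i) i * a) \<odot> gen j = a \<odot> gen j"
    by (simp add: zsmul_gen_eq_iff algebra_simps)
  then show ?thesis by (simp add: transvection_def)
qed

lemma transvection_gen_other:
  assumes "i \<in> I" "l \<in> I" "i \<noteq> l" "ord j dvd ord i * a"
  shows "transvection i j a (gen l) = gen l"
proof -
  have "ord j dvd coord (gen l) i * a"
    using coord_gen[OF assms(1,2)] assms(3,4) by (auto intro: dvd_mult_trans)
  then show ?thesis by (simp add: transvection_def zsmul_gen_eq_0_iff)
qed

subsection \<open>Involutions\<close>

text \<open>
  For an element \<open>w\<close> with \<open>w + w = 0\<close> this says that the involution of the \<open>i\<close>-th cyclic
  factor occurs in \<open>w\<close>: such \<open>w\<close> is the sum of the involutions of the factors that it
  involves (\<open>double_eq_0_expansion\<close>).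
\<close>

definition involves :: "'i \<Rightarrow> 'a \<Rightarrow> bool" where
  "involves i w \<longleftrightarrow> \<not> ord i dvd coord w i"

lemma invol_gen: "invol (gen i) = (ord i div 2) \<odot> gen i"
  by (simp add: invol_eq ord_def zdiv_int)

lemma invol_gen_double: "i \<in> I \<Longrightarrow> invol (gen i) + invol (gen i) = 0"
  using even_ord[of i] by (simp add: invol_gen zsmul_gen_eq_0_iff flip: zsmul_two)

lemma invol_gen_eq_0_iff: "i \<in> I \<Longrightarrow> invol (gen i) = 0 \<longleftrightarrow> ord i = 0"
  using even_ord[of i] zdvd_not_zless[of "ord i div 2" "ord i"]
  by (auto simp: invol_gen zsmul_gen_eq_0_iff elim!: evenE)

lemma double_eq_0_imp_coord:
  assumes "i \<in> I" "w + w = 0"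
  shows "ord i div 2 dvd coord w i"
proof -
  have "ord i dvd 2 * coord w i" using assms zsmul_eq_0_iff_coord[of 2 w] by (simp add: zsmul_two)
  with even_ord[OF assms(1)] show ?thesis by (auto elim!: evenE)
qed

text \<open>
  For \<open>w\<close> of order at most two, the \<open>i\<close>-th coordinate is a multiple of half the order, and only
  the parity of the cofactor matters. The generator \<open>j\<close> of the same order is allowed here
  because a transvection turns an occurrence of \<open>gen i\<close> into one of \<open>gen j\<close>.
\<close>

lemma involves_zsmul_gen:
  assumes "i \<in> I" "w + w = 0" "ord j = ord i"
  shows "coord w i \<odot> gen j = (if involves i w then invol (gen j) else 0)"
proof -
  obtain q where q: "coord w i = ord i div 2 * q" using double_eq_0_imp_coord[OF assms(1,2)] by blast
  obtain r where r: "ord i = 2 * r" using even_ord[OF assms(1)] by blast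
  show ?thesis
  proof (cases "even q")
    case True
    then have "ord i dvd coord w i" using q r by auto
    then show ?thesis using assms(3) by (simp add: involves_def zsmul_gen_eq_0_iff)
  next
    case False
    then obtain p where p: "q = 2 * p + 1" by (auto elim: oddE)
    have 1: "coord w i = r + ord i * p" using q r p by (simp add: algebra_simps)
    then have "coord w i \<odot> gen j = r \<odot> gen j" using assms(3) by (simp add: zsmul_gen_eq_iff)
    then have 2: "coord w i \<odot> gen j = invol (gen j)" using r assms(3) by (simp add: invol_gen)
    show ?thesis
    proof (cases "involves i w")
      case False
      then have "coord w i \<odot> gen j = 0" using assms(3) by (simp add: involves_def zsmul_gen_eq_0_iff)
      with False show ?thesis by simp
    qed (simp add: 2)
  qed
qed

lemma double_eq_0_expansion:
  assumes "w + w = 0"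
  shows "w = (\<Sum>i\<in>I. if involves i w then invol (gen i) else 0)"
proof -
  have "(\<Sum>i\<in>I. coord w i \<odot> gen i) = (\<Sum>i\<in>I. if involves i w then invol (gen i) else 0)"
    by (rule sum.cong) (simp_all add: involves_zsmul_gen assms)
  then show ?thesis by (simp add: coord_expansion)
qed

lemma involves_ord_0: "w + w = 0 \<Longrightarrow> i \<in> I \<Longrightarrow> ord i = 0 \<Longrightarrow> \<not> involves i w"
  using double_eq_0_imp_coord[of i w] by (simp add: involves_def)

lemma eq_0_iff_involves: "w = 0 \<longleftrightarrow> (\<forall>i\<in>I. \<not> involves i w)"
  by (simp add: eq_0_iff_coord involves_def)

lemma involves_invol_gen:
  assumes "i \<in> I" "j \<in> I"
  shows "involves i (invol (gen j)) \<longleftrightarrow> i = j \<and> ord i \<noteq> 0"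
proof -
  have *: "ord i dvd coord (invol (gen j)) i - (if i = j then ord i div 2 else 0)"
    using coord_gen_zsmul[OF assms, of "ord j div 2"] by (cases "i = j") (auto simp: invol_gen)
  have "ord i dvd coord (invol (gen j)) i \<longleftrightarrow> ord i dvd (if i = j then ord i div 2 else 0)"
    using * by (metis diff_add_cancel dvd_add_right_iff)
  moreover have "ord i dvd ord i div 2 \<longleftrightarrow> ord i = 0"
    using invol_gen_eq_0_iff[OF assms(1)] by (simp add: invol_gen zsmul_gen_eq_0_iff)
  ultimately show ?thesis by (auto simp: involves_def)
qed

text \<open>
  All orders are \<open>0\<close> or powers of two, so there is no odd torsion.
\<close>

lemma odd_zsmul_eq_0:
  fixes g :: 'a
  assumes "odd N" "N \<odot> g = 0"
  shows "g = 0"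
proof -
  have "ord i dvd coord g i" if i: "i \<in> I" for i
  proof -
    have *: "ord i dvd N * coord g i" using assms(2) i by (simp add: zsmul_eq_0_iff_coord)
    have "N \<noteq> 0" using assms(1) by auto
    consider "ord i = 0" | e where "ord i = 2 ^ e" using order_cases[OF i] by (auto simp: ord_def)
    then show ?thesis
    proof cases
      case 1
      with * \<open>N \<noteq> 0\<close> show ?thesis by simp
    next
      case 2
      have "coprime (ord i) N" using assms(1) 2 by simp
      with * show ?thesis using coprime_dvd_mult_right_iff by blast
    qed
  qed
  then show ?thesis by (simp add: eq_0_iff_coord)
qed

end

section \<open>Multiplications that are invariant under all automorphisms\<close>

text \<open>
  Condition (2) for a commutative bilinear multiplication. It determines the possible products up to
  the bounds on the orders, and it is inherited by sums of forms.
\<close>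

definition invariant_form :: "('a::ab_group_add \<Rightarrow> 'a \<Rightarrow> 'a) \<Rightarrow> bool" where
  "invariant_form mu \<longleftrightarrow> comm_bilinear mu \<and>
     (\<forall>\<alpha>. group_isom \<alpha> \<longrightarrow> (\<forall>g h. \<alpha> (mu g h) = mu (\<alpha> g) (\<alpha> h)))"

lemma comm_bilinear_commute: "comm_bilinear mu \<Longrightarrow> mu g h = mu h g"
  by (simp add: comm_bilinear_def)

lemma comm_bilinear_additive: "comm_bilinear mu \<Longrightarrow> additive (mu g)"
  by (simp add: comm_bilinear_def)

lemma comm_bilinear_simps:
  assumes "comm_bilinear mu"
  shows "mu g (h + h') = mu g h + mu g h'" "mu (g + g') h = mu g h + mu g' h"
    "mu g 0 = 0" "mu 0 h = 0" "mu g (- h) = - mu g h" "mu (- g) h = - mu g h"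
    "mu g (k \<odot> h) = k \<odot> mu g h" "mu (k \<odot> g) h = k \<odot> mu g h"
    "mu g (h - h') = mu g h - mu g h'" "mu (g - g') h = mu g h - mu g' h"
proof -
  note add = comm_bilinear_additive[OF assms]
  note commute = comm_bilinear_commute[OF assms]
  note R = additive.add[OF add] additive.zero[OF add] additive.minus[OF add]
    additive_zsmul[OF add] additive.diff[OF add]
  show "mu g (h + h') = mu g h + mu g h'" "mu g 0 = 0" "mu g (- h) = - mu g h"
    "mu g (k \<odot> h) = k \<odot> mu g h" "mu g (h - h') = mu g h - mu g h'" by (rule R)+
  show "mu (g + g') h = mu g h + mu g' h" "mu 0 h = 0" "mu (- g) h = - mu g h"
    "mu (k \<odot> g) h = k \<odot> mu g h" "mu (g - g') h = mu g h - mu g' h"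
    using R by (simp_all add: commute[of _ h])
qed

lemma comm_ring_structure_iff:
  "comm_ring_structure mu \<longleftrightarrow> comm_bilinear mu \<and> (\<forall>a b c. mu (mu a b) c = mu a (mu b c))"
proof
  assume "comm_ring_structure mu"
  then interpret R: comm_ring "(+)" 0 "(-)" uminus mu
    by (simp add: comm_ring_structure_def)
  show "comm_bilinear mu \<and> (\<forall>a b c. mu (mu a b) c = mu a (mu b c))"
    by (simp add: comm_bilinear_def additive_def R.distrib_left R.mult.assoc) (simp add: R.mult.commute)
next
  assume "comm_bilinear mu \<and> (\<forall>a b c. mu (mu a b) c = mu a (mu b c))"
  then show "comm_ring_structure mu"
    unfolding comm_ring_structure_def
    by unfold_locales (auto simp: comm_bilinear_simps dest: comm_bilinear_commute)
qed

lemma automorphisms_lift_iff: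
  "automorphisms_lift mu \<longleftrightarrow> (\<forall>\<alpha>. group_isom \<alpha> \<longrightarrow> (\<forall>g h. \<alpha> (mu g h) = mu (\<alpha> g) (\<alpha> h)))"
  by (auto simp: automorphisms_lift_def ring_isom_def)

lemma good_ring_invariant_form: "good_ring mu \<Longrightarrow> invariant_form mu"
  by (simp add: good_ring_def invariant_form_def comm_ring_structure_iff automorphisms_lift_iff)

text \<open>
  The neutral element of the circle group is \<open>0\<close>, so a second right unit of some \<open>g\<close> contradicts
  cancellation. This rules out generators of order two: there \<open>x = invol x\<close>, and a product
  \<open>g x = invol x\<close> gives \<open>circ g x = g + 2 x = g\<close>.
\<close>

lemma circ_group_unit:
  assumes "circ_group_isomorphic mu" "comm_bilinear mu" "circ mu g h = g"
  shows "h = 0"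
proof -
  obtain e inv where "group (circ mu) e inv" using assms(1) by (auto simp: circ_group_isomorphic_def)
  then interpret G: group "circ mu" e inv .
  have "circ mu g h = circ mu g 0" using assms(2,3) by (simp add: circ_def comm_bilinear_simps)
  then show ?thesis using G.left_cancel by blast
qed

text \<open>
  An isomorphism between \<open>(G,+)\<close> and the circle group preserves exponents. It is used to exclude
  generators of order four with \<open>x x = invol x = 2 x\<close>, for which all circle squares vanish.
\<close>

lemma circ_exponent_two:
  fixes mu :: "'a::ab_group_add \<Rightarrow> 'a \<Rightarrow> 'a" and g :: 'a
  assumes "circ_group_isomorphic mu" "comm_bilinear mu" "\<And>g. circ mu g g = 0"
  shows "g + g = 0"
proof -
  obtain \<phi> :: "'a \<Rightarrow> 'a" where \<phi>: "bij \<phi>" "\<And>g h. \<phi> (g + h) = circ mu (\<phi> g) (\<phi> h)"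
    using assms(1) unfolding circ_group_isomorphic_def by blast
  have "\<phi> 0 = circ mu (\<phi> 0) (\<phi> 0)" using \<phi>(2)[of 0 0] by simp
  then have "\<phi> 0 = 0" by (simp add: assms(3))
  moreover have "\<phi> (g + g) = 0" using \<phi>(2) assms(3) by simp
  ultimately have "\<phi> (g + g) = \<phi> 0" by simp
  then show ?thesis using \<phi>(1) by (simp add: bij_def inj_eq)
qed

text \<open>
  The automorphism \<open>g \<mapsto> - g\<close> fixes every product because the signs cancel, and it maps
  every product to its negative. So all products have order at most two, and a product depends
  on its factors only modulo \<open>2 G\<close>.
\<close>

lemma invariant_form_double:
  assumes "invariant_form mu"
  shows "mu g h + mu g h = 0"
proof -
  have "group_isom (uminus :: 'a \<Rightarrow> 'a::ab_group_add)"
    by (auto simp: group_isom_def additive_def intro!: o_bij[of uminus])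
  then have "- mu g h = mu (- g) (- h)" using assms by (simp add: invariant_form_def)
  also have "\<dots> = mu g h" using assms by (simp add: invariant_form_def comm_bilinear_simps)
  finally show ?thesis by (metis add.right_inverse)
qed

lemma double_zsmul:
  fixes t :: "'a::ab_group_add"
  assumes "t + t = 0"
  shows "k \<odot> t = (if even k then 0 else t)"
proof -
  have *: "(2 * l) \<odot> t = 0" for l
  proof -
    have "(2 * l) \<odot> t = l \<odot> (2 \<odot> t)" by (simp add: mult.commute)
    then show ?thesis by (simp add: zsmul_two assms)
  qed
  show ?thesis
  proof (cases "even k")
    case False
    then obtain l where "k = 2 * l + 1" by (auto elim: oddE)
    then show ?thesis by (simp add: zsmul_distrib_left *)
  qed (auto simp: *)
qed

context generating_system
begin

text \<open>
  The source of all relations between products: a transvection can be evaluated on the product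
  \<open>mu g h\<close> and on both factors.
\<close>

lemma invariant_form_transvection:
  assumes "invariant_form mu" "i \<in> I" "j \<in> I" "i \<noteq> j" "ord j dvd ord i * a"
  shows "mu (transvection i j a g) (transvection i j a h) = mu g h + (coord (mu g h) i * a) \<odot> gen j"
  using group_isom_transvection[OF assms(2-5)] assms(1)
  by (metis invariant_form_def transvection_def)

lemma not_involves_if_transvection_fixes:
  assumes "i \<in> I" "ord j = ord i * a" "a \<noteq> 0" "(coord w i * a) \<odot> gen j = 0"
  shows "\<not> involves i w"
  using assms by (simp add: involves_def zsmul_gen_eq_0_iff)

text \<open>
  Adding a generator of smaller order to \<open>gen i\<close> leaves all involutions fixed. Invariance of
  \<open>mu (gen i) (gen l)\<close> then says that the product with the added generator is zero. Since
  \<open>ord i div 2\<close> is \<open>0\<close> for infinite order, every generator counts as smaller than a free one.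
\<close>

lemma invariant_form_small_gen:
  assumes inv: "invariant_form mu" and ijl: "i \<in> I" "j \<in> I" "l \<in> I" "i \<noteq> j" "i \<noteq> l"
    and small: "ord j dvd ord i div 2"
  shows "mu (gen j) (gen l) = 0"
proof -
  have "ord j dvd ord i * 1" using small even_ord[OF ijl(1)] by (auto elim!: evenE)
  note tr = transvection_gen_same[OF ijl(1) this] transvection_gen_other[OF ijl(1) ijl(3) ijl(5) this]
    invariant_form_transvection[OF inv ijl(1,2,4) this, of "gen i" "gen l"]
  have "ord j dvd coord (mu (gen i) (gen l)) i"
    using small double_eq_0_imp_coord[OF ijl(1) invariant_form_double[OF inv]] dvd_trans by blast
  then have "mu (gen i + gen j) (gen l) = mu (gen i) (gen l)"
    using tr by (simp add: zsmul_gen_eq_0_iff)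
  then show ?thesis using inv by (simp add: invariant_form_def comm_bilinear_simps)
qed

text \<open>
  Adding an even multiple of a generator of larger order does not change any product, but it moves
  the involution of the \<open>i\<close>-th factor. So that involution cannot occur in a product.
\<close>

lemma invariant_form_avoids_small:
  assumes inv: "invariant_form mu" and ij: "i \<in> I" "j \<in> I" "i \<noteq> j"
    and big: "ord j = ord i * a" "even a" "a \<noteq> 0"
  shows "\<not> involves i (mu g h)"
proof -
  have bil: "comm_bilinear mu" using inv by (simp add: invariant_form_def)
  have ev: "k \<odot> mu g' h' = 0" if "even k" for k g' h'
    using double_zsmul[OF invariant_form_double[OF inv]] that by simp
  have "mu (transvection i j a g) (transvection i j a h) = mu g h"
    using big(2) by (simp add: transvection_def comm_bilinear_simps[OF bil] ev)
  then have "(coord (mu g h) i * a) \<odot> gen j = 0"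
    using invariant_form_transvection[OF inv ij, of a g h] big by simp
  then show ?thesis using not_involves_if_transvection_fixes big ij by blast
qed

text \<open>
  The same conclusion if \<open>a\<close> may be odd, as for generators of equal order: the two factors of the
  product have to be different from \<open>gen i\<close>, so that the transvection fixes them.
\<close>

lemma invariant_form_avoids_other:
  assumes inv: "invariant_form mu" and ij: "i \<in> I" "j \<in> I" "i \<noteq> j"
    and l: "l \<in> I" "l' \<in> I" "i \<noteq> l" "i \<noteq> l'"
    and big: "ord j = ord i * a" "a \<noteq> 0"
  shows "\<not> involves i (mu (gen l) (gen l'))"
proof -
  have d: "ord j dvd ord i * a" using big by simp
  have "(coord (mu (gen l) (gen l')) i * a) \<odot> gen j = 0"
    using invariant_form_transvection[OF inv ij d, of "gen l" "gen l'"]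
      transvection_gen_other[OF ij(1) _ _ d] l by simp
  then show ?thesis using not_involves_if_transvection_fixes big ij by blast
qed

text \<open>
  If \<open>gen i\<close> and \<open>gen j\<close> have the same order, adding \<open>gen j\<close> to \<open>gen i\<close> changes the product of
  \<open>gen i\<close> with a fixed generator by the involution of \<open>gen j\<close>, if the involution of \<open>gen i\<close>
  occurs in it. Bilinearity identifies this change as a product with \<open>gen j\<close>.
\<close>

lemma invariant_form_equal_orders:
  assumes inv: "invariant_form mu" and ij: "i \<in> I" "j \<in> I" "i \<noteq> j" "ord j = ord i"
    and l: "l \<in> I" "i \<noteq> l"
  shows "mu (gen j) (gen l) = (if involves i (mu (gen i) (gen l)) then invol (gen j) else 0)"
proof -
  have d: "ord j dvd ord i * 1" using ij by simp
  have "mu (gen i + gen j) (gen l) = mu (gen i) (gen l) + coord (mu (gen i) (gen l)) i \<odot> gen j"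
    using invariant_form_transvection[OF inv ij(1-3) d, of "gen i" "gen l"]
      transvection_gen_other[OF ij(1) l d] transvection_gen_same[OF ij(1) d] by simp
  then have "mu (gen j) (gen l) = coord (mu (gen i) (gen l)) i \<odot> gen j"
    using inv by (simp add: invariant_form_def comm_bilinear_simps)
  then show ?thesis using involves_zsmul_gen[OF ij(1) invariant_form_double[OF inv] ij(4)] by simp
qed

text \<open>
  In the square of \<open>gen i + gen j\<close> the two mixed terms cancel.
\<close>

lemma invariant_form_equal_orders_square:
  assumes inv: "invariant_form mu" and ij: "i \<in> I" "j \<in> I" "i \<noteq> j" "ord j = ord i"
  shows "mu (gen j) (gen j) = (if involves i (mu (gen i) (gen i)) then invol (gen j) else 0)"
proof -
  have d: "ord j dvd ord i * 1" using ij by simp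
  have bil: "comm_bilinear mu" using inv by (simp add: invariant_form_def)
  have "mu (gen i + gen j) (gen i + gen j) = mu (gen i) (gen i) + coord (mu (gen i) (gen i)) i \<odot> gen j"
    using invariant_form_transvection[OF inv ij(1-3) d, of "gen i" "gen i"]
      transvection_gen_same[OF ij(1) d] by simp
  moreover have "mu (gen i + gen j) (gen i + gen j) =
    mu (gen i) (gen i) + (mu (gen i) (gen j) + mu (gen i) (gen j)) + mu (gen j) (gen j)"
    using comm_bilinear_commute[OF bil, of "gen i" "gen j"] by (simp add: comm_bilinear_simps[OF bil] add_ac)
  ultimately have "mu (gen j) (gen j) = coord (mu (gen i) (gen i)) i \<odot> gen j"
    using invariant_form_double[OF inv] by simp
  then show ?thesis using involves_zsmul_gen[OF ij(1) invariant_form_double[OF inv] ij(4)] by simp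
qed

end

section \<open>The decomposition into a free part and a 2-group\<close>

lemma Inl_in_Plus_iff [simp]: "Inl i \<in> A <+> B \<longleftrightarrow> i \<in> A"
  and Inr_in_Plus_iff [simp]: "Inr j \<in> A <+> B \<longleftrightarrow> j \<in> B"
  by auto

text \<open>
  The group \<open>G\<close> with its decomposition, as an instance of a generating system: \<open>Inl i\<close> is the
  index of \<open>z i\<close>, and \<open>Inr i\<close> that of \<open>x i\<close>.
\<close>

locale decomposed_group =
  fixes n m :: nat and z x :: "nat \<Rightarrow> 'a::ab_group_add"
  assumes decomposition: "decomposition n m z x"
begin

lemma generating_system: "generating_system ({1..n} <+> {1..m}) (case_sum z x)"
proof
  let ?I = "{1..n} <+> {1..m}" and ?g = "case_sum z x"
  have C: "(case_sum (\<lambda>i. cyc (z i)) (\<lambda>i. cyc (x i))) i = cyc (?g i)" for i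
    by (cases i) auto
  have idp: "\<exists>!c. c \<in> (\<Pi>\<^sub>E i\<in>?I. cyc (?g i)) \<and> g = (\<Sum>i\<in>?I. c i)" for g
    using decomposition unfolding decomposition_def internal_direct_product_def C by blast
  show "finite ?I" by simp
  show "\<exists>c. g = (\<Sum>i\<in>?I. c i \<odot> ?g i)" for g
  proof -
    obtain c where c: "c \<in> (\<Pi>\<^sub>E i\<in>?I. cyc (?g i))" "g = (\<Sum>i\<in>?I. c i)"
      using idp[of g] by blast
    have "\<forall>i\<in>?I. \<exists>k. c i = k \<odot> ?g i" using PiE_mem[OF c(1)] unfolding cyc_eq by blast
    then obtain d where d: "\<And>i. i \<in> ?I \<Longrightarrow> c i = d i \<odot> ?g i" by (metis (no_types))
    then have "g = (\<Sum>i\<in>?I. d i \<odot> ?g i)" using c(2) by (simp only: d cong: sum.cong)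
    then show ?thesis by blast
  qed
  show "c i \<odot> ?g i = 0" if "(\<Sum>i\<in>?I. c i \<odot> ?g i) = 0" "i \<in> ?I" for c i
  proof -
    let ?c = "restrict (\<lambda>i. c i \<odot> ?g i) ?I" and ?d = "restrict (\<lambda>i. 0) ?I"
    have "?c \<in> (\<Pi>\<^sub>E i\<in>?I. cyc (?g i))" "?d \<in> (\<Pi>\<^sub>E i\<in>?I. cyc (?g i))"
      by (auto simp: cyc_eq intro: range_eqI[of _ _ 0])
    moreover have "0 = (\<Sum>i\<in>?I. ?c i)" using that(1) by (simp cong: sum.cong)
    moreover have "0 = (\<Sum>i\<in>?I. ?d i)" by (simp cong: sum.cong)
    ultimately have "?c = ?d" using idp[of 0] by blast
    then have "?c i = ?d i" by (rule fun_cong)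
    with that(2) show ?thesis by simp
  qed
  show "elt_order (?g i) = 0 \<or> (\<exists>e>0. elt_order (?g i) = 2 ^ e)" if "i \<in> ?I" for i
    using that decomposition by (cases i) (auto simp: decomposition_def elt_order_eq_0_iff)
qed

sublocale generating_system "{1..n} <+> {1..m}" "case_sum z x"
  by (rule generating_system)

lemma ord_z: "i \<in> {1..n} \<Longrightarrow> elt_order (z i) = 0" "i \<in> {1..n} \<Longrightarrow> ord (Inl i) = 0"
  using decomposition by (simp_all add: decomposition_def elt_order_eq_0_iff ord_def)

lemma ord_x: "ord (Inr i) = int (elt_order (x i))"
  by (simp add: ord_def)

lemma ord_x_power: "i \<in> {1..m} \<Longrightarrow> \<exists>e>0. elt_order (x i) = 2 ^ e"
  using decomposition by (simp add: decomposition_def)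

lemma ord_x_ge_2: "i \<in> {1..m} \<Longrightarrow> elt_order (x i) \<ge> 2"
  using ord_x_power[of i] power_increasing[of 1 _ "2::nat"] by fastforce

lemma ord_x_antimono: "\<lbrakk>1 \<le> i; i \<le> j; j \<le> m\<rbrakk> \<Longrightarrow> elt_order (x j) \<le> elt_order (x i)"
  using decomposition by (simp add: decomposition_def)

lemma ord_x_factor:
  assumes "i \<in> {1..m}" "j \<in> {1..m}" "elt_order (x i) \<le> elt_order (x j)"
  obtains a where "ord (Inr j) = ord (Inr i) * a" "a \<noteq> 0" "elt_order (x i) < elt_order (x j) \<Longrightarrow> even a"
proof -
  obtain d e where de: "elt_order (x i) = 2 ^ d" "elt_order (x j) = 2 ^ e"
    using assms ord_x_power by blast
  with assms(3) have "d \<le> e" by simp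
  then have "ord (Inr j) = ord (Inr i) * 2 ^ (e - d)"
    by (simp add: ord_x de flip: power_add)
  moreover have "even (2 ^ (e - d) :: int)" if "elt_order (x i) < elt_order (x j)"
    using that de by simp
  ultimately show ?thesis using that[of "2 ^ (e - d)"] by simp
qed

lemma ord_x_less_dvd:
  assumes "i \<in> {1..m}" "j \<in> {1..m}" "elt_order (x j) < elt_order (x i)"
  shows "ord (Inr j) dvd ord (Inr i) div 2"
proof -
  obtain a where "ord (Inr i) = ord (Inr j) * a" "even a"
    using ord_x_factor[of j i] assms by (metis less_imp_le)
  then show ?thesis by auto
qed

text \<open>
  The largest cyclic factor of the \<open>2\<close>-part exists and is unique. This is the condition under
  which the involution of \<open>x 1\<close> is fixed by all automorphisms, and it separates the cases of the
  classification.
\<close>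

definition single_top :: bool where
  "single_top \<longleftrightarrow> m = 1 \<or> m \<ge> 2 \<and> elt_order (x 2) < elt_order (x 1)"

lemma single_top_less: "\<lbrakk>single_top; i \<in> {2..m}\<rbrakk> \<Longrightarrow> elt_order (x i) < elt_order (x 1)"
  using ord_x_antimono[of 2 i] by (auto simp: single_top_def)

lemma single_top_ge_1: "single_top \<Longrightarrow> m \<ge> 1"
  by (auto simp: single_top_def)

lemma in_top:
  assumes "w + w = 0" "\<And>i. i \<in> {2..m} \<Longrightarrow> \<not> involves (Inr i) w"
  shows "w \<in> {0, invol (x 1)}"
proof (cases "m \<ge> 1")
  case False
  have "\<not> involves i w" if i: "i \<in> {1..n} <+> {1..m}" for i
  proof -
    obtain k where "i = Inl k" "k \<in> {1..n}" using False i by (cases i) auto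
    then show ?thesis using involves_ord_0[OF assms(1) i] ord_z(2) by simp
  qed
  then show ?thesis using eq_0_iff_involves by blast
next
  case True
  let ?f = "\<lambda>i. if involves i w then invol (case_sum z x i) else 0"
  have "w = sum ?f ({1..n} <+> {1..m})" by (rule double_eq_0_expansion[OF assms(1)])
  also have "\<dots> = sum ?f {Inr 1}"
  proof (rule sum.mono_neutral_right)
    show "\<forall>i\<in>({1..n} <+> {1..m}) - {Inr 1}. ?f i = 0"
    proof
      fix i assume "i \<in> ({1..n} <+> {1..m}) - {Inr 1}"
      then consider k where "i = Inl k" "k \<in> {1..n}" | k where "i = Inr k" "k \<in> {2..m}" by force
      then have "\<not> involves i w"
        using involves_ord_0[OF assms(1), of i] ord_z(2) assms(2) by cases auto
      then show "?f i = 0" by simp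
    qed
  qed (use True in auto)
  finally show ?thesis by (auto split: if_splits)
qed

text \<open>
  Every smaller factor can be moved by adding an even multiple of \<open>x 1\<close>, so only the involution
  of \<open>x 1\<close> remains as a value.
\<close>

lemma single_top_value:
  assumes "invariant_form mu" single_top
  shows "mu g h \<in> {0, invol (x 1)}"
proof (rule in_top)
  fix i assume i: "i \<in> {2..m}"
  then have less: "elt_order (x i) < elt_order (x 1)" using single_top_less assms(2) by blast
  obtain a where "ord (Inr 1) = ord (Inr i) * a" "a \<noteq> 0" "even a"
    using ord_x_factor[of i 1] i less by auto
  then show "\<not> involves (Inr i) (mu g h)"
    using invariant_form_avoids_small[OF assms(1), of "Inr i" "Inr 1"] i by force
qed (rule invariant_form_double[OF assms(1)])

text \<open>
  If the largest order occurs twice, every \<open>x k\<close> has a different generator of at least the same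
  order. This is what makes the involution of \<open>x k\<close> movable.
\<close>

lemma not_single_top_partner:
  assumes "\<not> single_top" and k: "k \<in> {1..m}"
  obtains j a where "j \<in> {1..m}" "j \<noteq> k" "ord (Inr j) = ord (Inr k) * a" "a \<noteq> 0"
proof -
  have m: "m \<ge> 2" "elt_order (x 2) = elt_order (x 1)"
    using assms ord_x_antimono[of 1 2] by (auto simp: single_top_def)
  have "\<exists>j\<in>{1..m}. j \<noteq> k \<and> elt_order (x k) \<le> elt_order (x j)"
  proof (cases "k = 1")
    case True
    then show ?thesis using m by (intro bexI[of _ 2]) auto
  next
    case False
    then show ?thesis using m k ord_x_antimono[of 1 k] by (intro bexI[of _ 1]) auto
  qed
  then obtain j where j: "j \<in> {1..m}" "j \<noteq> k" "elt_order (x k) \<le> elt_order (x j)" by blast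
  obtain a where "ord (Inr j) = ord (Inr k) * a" "a \<noteq> 0" using ord_x_factor[OF k j(1,3)] .
  with j that show ?thesis by blast
qed

lemma not_single_top_value:
  assumes "invariant_form mu" "\<not> single_top" "i \<in> {1..n}" "j \<in> {1..n}"
  shows "mu (z i) (z j) = 0"
proof -
  have "\<not> involves l (mu (z i) (z j))" if l: "l \<in> {1..n} <+> {1..m}" for l
  proof (cases l)
    case (Inl k)
    then show ?thesis
      using involves_ord_0[OF invariant_form_double[OF assms(1)], of l] l ord_z(2) by auto
  next
    case (Inr k)
    with l have k: "k \<in> {1..m}" by auto
    obtain j' a where j': "j' \<in> {1..m}" "j' \<noteq> k" and "ord (Inr j') = ord (Inr k) * a" "a \<noteq> 0"
      using not_single_top_partner[OF assms(2) k] .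
    then show ?thesis
      using invariant_form_avoids_other[OF assms(1), of "Inr k" "Inr j'" "Inl i" "Inl j" a]
        k j' assms(3,4) Inr by auto
  qed
  then show ?thesis using eq_0_iff_involves by blast
qed

text \<open>
  Any element may be added to the free generator \<open>z i\<close>, so \<open>z i\<close> forces all products that do not
  contain it to vanish. Three free generators therefore leave no product, and two of them leave
  only \<open>z 1 z 2\<close>.
\<close>

lemma free_gen_kills:
  assumes "invariant_form mu" "i \<in> {1..n}" "j \<in> {1..n} <+> {1..m}" "l \<in> {1..n} <+> {1..m}"
    "j \<noteq> Inl i" "l \<noteq> Inl i"
  shows "mu (case_sum z x j) (case_sum z x l) = 0"
proof -
  have "ord j dvd ord (Inl i) div 2" using ord_z(2)[OF assms(2)] by simp
  then show ?thesis
    using invariant_form_small_gen[OF assms(1) _ assms(3,4), of "Inl i"] assms(2,5,6) by auto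
qed

end

context decomposed_group
begin

section \<open>Good rings belong to the families\<close>

text \<open>
  The lower bounds on \<open>elt_order (x 1)\<close> in the families are obtained by excluding the values
  \<open>2\<close> and \<open>4\<close>.
\<close>

lemma ord_x_small_cases:
  assumes "i \<in> {1..m}"
  shows "elt_order (x i) = 2 \<or> elt_order (x i) = 4 \<or> elt_order (x i) \<ge> 8"
proof -
  obtain e where e: "e > 0" "elt_order (x i) = 2 ^ e" using ord_x_power assms by blast
  consider "e = 1" | "e = 2" | "e \<ge> 3" using e(1) by linarith
  then show ?thesis
  proof cases
    case 3
    then have "2 ^ 3 \<le> (2::nat) ^ e" by (intro power_increasing) auto
    then show ?thesis using e by simp
  qed (use e in auto)
qed

lemma trivial_multI:
  assumes "comm_bilinear mu"
    and "\<And>i j. \<lbrakk>i \<in> {1..n} <+> {1..m}; j \<in> {1..n} <+> {1..m}\<rbrakk> \<Longrightarrow> mu (case_sum z x i) (case_sum z x j) = 0"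
  shows "mu = trivial_mult"
proof (rule comm_bilinear_eqI[OF assms(1)])
  show "comm_bilinear trivial_mult" by (simp add: comm_bilinear_def trivial_mult_def additive_def)
qed (simp add: assms(2), simp add: trivial_mult_def)

lemma trivial_mult_by_gens:
  assumes "comm_bilinear mu"
    and "\<And>i j. \<lbrakk>i \<in> {1..n}; j \<in> {1..n}\<rbrakk> \<Longrightarrow> mu (z i) (z j) = 0"
    and "\<And>i j. \<lbrakk>i \<in> {1..n}; j \<in> {1..m}\<rbrakk> \<Longrightarrow> mu (z i) (x j) = 0"
    and "\<And>i j. \<lbrakk>i \<in> {1..m}; j \<in> {1..m}\<rbrakk> \<Longrightarrow> mu (x i) (x j) = 0"
  shows "mu = trivial_mult"
proof (rule trivial_multI[OF assms(1)])
  fix i j assume ij: "i \<in> {1..n} <+> {1..m}" "j \<in> {1..n} <+> {1..m}"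
  have "mu (x j) (z i) = 0" if "i \<in> {1..n}" "j \<in> {1..m}" for i j
    using assms(3)[OF that] comm_bilinear_commute[OF assms(1)] by metis
  with ij assms show "mu (case_sum z x i) (case_sum z x j) = 0"
    by (elim PlusE) (simp_all only: sum.case)
qed

lemma invol_order_2: "elt_order g = 2 \<Longrightarrow> invol g = g"
  by (simp add: invol_eq)

lemma ord_eq: "elt_order (x i) = elt_order (x j) \<Longrightarrow> ord (Inr i) = ord (Inr j)"
  by (simp add: ord_x)

text \<open>
  If the order is \<open>2\<close>, then \<open>x 1\<close> is a second unit for itself under the circle operation. If it
  is \<open>4\<close>, the map \<open>g \<mapsto> circ g g\<close> is additive, since \<open>2 mu = 0\<close>, and it vanishes on all
  generators: on those of order four because \<open>2 x + 2 x = 0\<close>, on those of order two because their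
  squares are zero. Then the circle group has exponent two, while \<open>x 1\<close> has order four.
\<close>

lemma square_order_gt_4:
  assumes good: "good_ring mu" and n: "n = 0" and m: "m \<ge> 1"
    and x1: "mu (x 1) (x 1) = invol (x 1)"
    and sq: "\<And>i. i \<in> {1..m} \<Longrightarrow>
      elt_order (x i) = elt_order (x 1) \<and> mu (x i) (x i) = invol (x i) \<or>
      elt_order (x i) < elt_order (x 1) \<and> mu (x i) (x i) = 0"
  shows "elt_order (x 1) > 4"
proof -
  have inv: "invariant_form mu" and bil: "comm_bilinear mu" and circ: "circ_group_isomorphic mu"
    using good good_ring_invariant_form by (auto simp: good_ring_def comm_ring_structure_iff)
  have "elt_order (x 1) \<noteq> 2"
  proof
    assume 2: "elt_order (x 1) = 2"
    then have "circ mu (x 1) (x 1) = x 1"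
      using x1 zsmul_eq_0_iff[of 2 "x 1"] by (simp add: invol_order_2 circ_def zsmul_two)
    then have "x 1 = 0" by (rule circ_group_unit[OF circ bil])
    then show False using 2 zsmul_eq_0_iff[of 1 "x 1"] by simp
  qed
  moreover have "elt_order (x 1) \<noteq> 4"
  proof
    assume 4: "elt_order (x 1) = 4"
    have add: "additive (\<lambda>g. circ mu g g)"
    proof
      fix g h
      have "circ mu (g + h) (g + h) = circ mu g g + circ mu h h + (mu g h + mu g h)"
        by (simp add: circ_def comm_bilinear_simps[OF bil] comm_bilinear_commute[OF bil, of h g] add_ac)
      then show "circ mu (g + h) (g + h) = circ mu g g + circ mu h h"
        using invariant_form_double[OF inv] by simp
    qed
    have "(\<lambda>g. circ mu g g) = (\<lambda>g. 0)"
    proof (rule additive_eqI[OF add])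
      fix i assume "i \<in> {1..n} <+> {1..m}"
      then obtain k where k: "i = Inr k" "k \<in> {1..m}" using n by auto
      have "circ mu (x k) (x k) = 0"
      proof (cases "elt_order (x k) = 4")
        case True
        then have "circ mu (x k) (x k) = 4 \<odot> x k"
          using sq[OF k(2)] 4 zsmul_distrib_left[of 2 2 "x k"] by (simp add: circ_def invol_eq zsmul_two)
        also have "\<dots> = 0" using True by (simp add: zsmul_eq_0_iff)
        finally show ?thesis .
      next
        case False
        then have "elt_order (x k) = 2" "mu (x k) (x k) = 0"
          using sq[OF k(2)] 4 ord_x_small_cases[OF k(2)] by auto
        then show ?thesis using zsmul_eq_0_iff[of 2 "x k"] by (simp add: circ_def zsmul_two)
      qed
      then show "circ mu (case_sum z x i) (case_sum z x i) = 0" by (simp add: k)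
    qed (simp add: additive_def)
    then have "x 1 + x 1 = 0" using circ_exponent_two[OF circ bil] by metis
    then show False using zsmul_eq_0_iff[of 2 "x 1"] 4 by (simp add: zsmul_two)
  qed
  ultimately show ?thesis using ord_x_small_cases[of 1] m by auto
qed

lemma free_action_order_ge_4:
  assumes good: "good_ring mu" and m: "m \<ge> 1" and zx: "mu (z i) (x 1) = invol (x 1)"
  shows "elt_order (x 1) \<ge> 4"
proof -
  have bil: "comm_bilinear mu" and circ: "circ_group_isomorphic mu"
    using good by (auto simp: good_ring_def comm_ring_structure_iff)
  have "elt_order (x 1) \<noteq> 2"
  proof
    assume 2: "elt_order (x 1) = 2"
    then have "circ mu (z i) (x 1) = z i"
      using zx zsmul_eq_0_iff[of 2 "x 1"] by (simp add: invol_order_2 circ_def zsmul_two add.assoc)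
    then have "x 1 = 0" by (rule circ_group_unit[OF circ bil])
    then show False using 2 zsmul_eq_0_iff[of 1 "x 1"] by simp
  qed
  then show ?thesis using ord_x_small_cases[of 1] m by auto
qed

lemma small_x_kills:
  assumes "invariant_form mu" "i \<in> {1..m}" "j \<in> {1..m}" "l \<in> {1..n} <+> {1..m}" "l \<noteq> Inr i"
    and "elt_order (x j) < elt_order (x i)"
  shows "mu (x j) (case_sum z x l) = 0"
  using invariant_form_small_gen[OF assms(1), of "Inr i" "Inr j" l] ord_x_less_dvd[OF assms(2,3,6)] assms
  by auto

lemma equal_x:
  assumes "invariant_form mu" "i \<in> {1..m}" "j \<in> {1..m}" "i \<noteq> j" "l \<in> {1..n} <+> {1..m}" "l \<noteq> Inr i"
    and "elt_order (x j) = elt_order (x i)"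
  shows "mu (x j) (case_sum z x l) =
    (if involves (Inr i) (mu (x i) (case_sum z x l)) then invol (x j) else 0)"
  using invariant_form_equal_orders[OF assms(1), of "Inr i" "Inr j" l] ord_eq[OF assms(7)] assms
  by auto

lemma involves_invol_x:
  assumes "i \<in> {1..m}" "j \<in> {1..m}"
  shows "involves (Inr i) (invol (x j)) \<longleftrightarrow> i = j"
  using involves_invol_gen[of "Inr i" "Inr j"] ord_x_ge_2[OF assms(1)] assms by (auto simp: ord_x)

lemma involves_zero [simp]: "i \<in> {1..n} <+> {1..m} \<Longrightarrow> \<not> involves i 0"
  using eq_0_iff_involves by blast

text \<open>
  The only product that the two free generators leave is \<open>z 1 z 2\<close>. Its value is fixed by all
  automorphisms of the \<open>2\<close>-part, so it is zero unless the largest factor is unique.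
\<close>

lemma good_rank_2:
  assumes good: "good_ring mu" and nontrivial: "mu \<noteq> trivial_mult" and n: "n = 2"
  shows "family_F n m z x mu"
proof -
  have inv: "invariant_form mu" and bil: "comm_bilinear mu"
    using good good_ring_invariant_form by (auto simp: good_ring_def comm_ring_structure_iff)
  note kill = free_gen_kills[OF inv]
  have z: "mu (z 1) (z 1) = 0" "mu (z 2) (z 2) = 0"
    using kill[of 2 "Inl 1" "Inl 1"] kill[of 1 "Inl 2" "Inl 2"] n by auto
  have xx: "mu (x i) (x j) = 0" if "i \<in> {1..m}" "j \<in> {1..m}" for i j
    using kill[of 1 "Inr i" "Inr j"] n that by auto
  have zx: "mu (z i) (x j) = 0" if "i \<in> {1..2}" "j \<in> {1..m}" for i j
    using kill[of "if i = 1 then 2 else 1" "Inl i" "Inr j"] n that by auto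
  have top: single_top
  proof (rule ccontr)
    assume "\<not> single_top"
    then have zz: "mu (z i) (z j) = 0" if "i \<in> {1..2}" "j \<in> {1..2}" for i j
      using not_single_top_value[OF inv, of i j] n that by auto
    have "mu = trivial_mult"
      by (rule trivial_mult_by_gens[OF bil]) (use zz zx xx n in auto)
    with nontrivial show False by simp
  qed
  then show ?thesis
    unfolding family_F_def using n bil z xx zx single_top_value[OF inv top, of "z 1" "z 2"]
    by (auto simp: single_top_def)
qed

text \<open>
  Only \<open>z 1 z 1\<close> and the products \<open>z 1 x\<close> remain, and \<open>x \<mapsto> z 1 x\<close> is an equivariant
  homomorphism into the involutions. It vanishes below the largest order, and on the factors of
  largest order it is zero or sends every \<open>x i\<close> to its own involution.
\<close>

lemma good_rank_1:
  assumes good: "good_ring mu" and nontrivial: "mu \<noteq> trivial_mult" and n: "n = 1"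
  shows "family_D n m z x mu \<or> family_E n m z x mu"
proof -
  have inv: "invariant_form mu" and bil: "comm_bilinear mu"
    using good good_ring_invariant_form by (auto simp: good_ring_def comm_ring_structure_iff)
  note comm = comm_bilinear_commute[OF bil]
  have xx: "mu (x i) (x j) = 0" if "i \<in> {1..m}" "j \<in> {1..m}" for i j
    using free_gen_kills[OF inv, of 1 "Inr i" "Inr j"] n that by auto
  show ?thesis
  proof (cases single_top)
    case True
    have m: "m \<ge> 1" using single_top_ge_1[OF True] .
    have zx: "mu (z 1) (x i) = 0" if "i \<in> {2..m}" for i
      unfolding comm[of "z 1" "x i"]
      using small_x_kills[OF inv, of 1 i "Inl 1"] single_top_less[OF True that] that m n by simp
    have val: "mu (z 1) (z 1) \<in> {0, invol (x 1)}" "mu (z 1) (x 1) \<in> {0, invol (x 1)}"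
      using single_top_value[OF inv True] by blast+
    have "elt_order (x 1) \<ge> 4" if "mu (z 1) (x 1) \<noteq> 0"
      using free_action_order_ge_4[OF good m, of 1] val(2) that by auto
    then have "family_E n m z x mu"
      unfolding family_E_def using bil n m xx zx val True by (auto simp: single_top_def)
    then show ?thesis ..
  next
    case False
    have zz: "mu (z 1) (z 1) = 0" using not_single_top_value[OF inv False] n by auto
    have "m \<noteq> 0"
    proof
      assume "m = 0"
      then have "mu = trivial_mult" by (intro trivial_mult_by_gens[OF bil]) (use zz n in auto)
      with nontrivial show False by simp
    qed
    then have m: "m \<ge> 2" "elt_order (x 2) = elt_order (x 1)"
      using False ord_x_antimono[of 1 2] by (auto simp: single_top_def)
    let ?T = "{i \<in> {1..m}. elt_order (x i) = elt_order (x 1)}"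
    \<comment> \<open>The generators are sorted by order, so those of largest order are exactly \<open>x 1, ..., x k\<close>.\<close>
    define k where "k = Max ?T"
    have T: "finite ?T" "1 \<in> ?T" "2 \<in> ?T" using m by auto
    have k: "k \<in> ?T" unfolding k_def using T by (intro Max_in) auto
    have top: "elt_order (x i) = elt_order (x 1)" if "i \<in> {1..k}" for i
      using ord_x_antimono[of 1 i] ord_x_antimono[of i k] k that by auto
    have below: "elt_order (x i) < elt_order (x 1)" if "i \<in> {k<..m}" for i
    proof -
      have "i \<notin> ?T"
      proof
        assume "i \<in> ?T"
        then have "i \<le> k" unfolding k_def by (rule Max_ge[OF T(1)])
        with that show False by simp
      qed
      then show ?thesis using ord_x_antimono[of 1 i] that by fastforce
    qed
    have k2: "2 \<le> k" unfolding k_def using T by (intro Max_ge) auto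
    have zx_below: "mu (z 1) (x i) = 0" if "i \<in> {k<..m}" for i
      unfolding comm[of "z 1" "x i"]
      using small_x_kills[OF inv, of 1 i "Inl 1"] below[OF that] that m n k2 by simp
    \<comment> \<open>Whether \<open>z 1 x i\<close> contains \<open>invol (x i)\<close> determines all other products, so one occurrence propagates to all of them.\<close>
    have step: "mu (z 1) (x j) = (if involves (Inr i) (mu (z 1) (x i)) then invol (x j) else 0)"
      if "i \<in> {1..k}" "j \<in> {1..k}" "i \<noteq> j" for i j
      unfolding comm[of "z 1" "x i"] comm[of "z 1" "x j"]
      using equal_x[OF inv, of i j "Inl 1"] that k top[of i] top[of j] n by simp
    have "\<exists>i\<in>{1..k}. involves (Inr i) (mu (z 1) (x i))"
    proof (rule ccontr)
      assume none: "\<not> ?thesis"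
      have "mu (z 1) (x j) = 0" if j: "j \<in> {1..m}" for j
      proof (cases "j \<le> k")
        case True
        then show ?thesis using step[of "if j = 1 then 2 else 1" j] none j k2 by auto
      next
        case False
        then show ?thesis using zx_below j by simp
      qed
      then have "mu = trivial_mult"
        by (intro trivial_mult_by_gens[OF bil]) (use zz n xx in auto)
      with nontrivial show False by simp
    qed
    then obtain i where i: "i \<in> {1..k}" "involves (Inr i) (mu (z 1) (x i))" by blast
    have zx_top: "mu (z 1) (x j) = invol (x j)" if j: "j \<in> {1..k}" for j
    proof (cases "j = i")
      case False
      then show ?thesis using step[OF i(1) j] i(2) by simp
    next
      case True
      obtain l where l: "l \<in> {1..k}" "l \<noteq> i" using k2 that[of "if i = 1 then 2 else 1"] by auto
      have "mu (z 1) (x l) = invol (x l)" using step[OF i(1) l(1)] i(2) l by simp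
      then have "involves (Inr l) (mu (z 1) (x l))" using involves_invol_x[of l l] l k by simp
      then show ?thesis using step[OF l(1) i(1) l(2)] True by simp
    qed
    have "elt_order (x 1) \<ge> 4" using free_action_order_ge_4[OF good, of 1] m zx_top[of 1] k2 by simp
    moreover have "elt_order (x (k + 1)) < elt_order (x k)" if "k < m"
      using below[of "k + 1"] that k by simp
    moreover have "1 \<le> k" "k \<le> m" "1 \<le> m" using k by auto
    ultimately have "family_D_with k n m z x mu"
      unfolding family_D_with_def using bil n top zz zx_top zx_below xx by blast
    then show ?thesis unfolding family_D_def by blast
  qed
qed

text \<open>
  A generator of smaller order has non-zero products with at most one generator, and then that one
  is the unique generator of largest order. If the largest factor is unique, this leaves \<open>x 1 x 1\<close>
  and \<open>x 1 x 2\<close>. Otherwise only the generators of largest order count. For three or more of them,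
  \<open>x j x l\<close> is a multiple of both \<open>invol (x j)\<close> and \<open>invol (x l)\<close>, hence zero, and the squares
  follow; for exactly two of them, one coefficient decides all three products.
\<close>

lemma good_rank_0:
  assumes good: "good_ring mu" and nontrivial: "mu \<noteq> trivial_mult" and n: "n = 0"
  shows "family_A n m z x mu \<or> family_B n m z x mu \<or> family_C n m z x mu"
proof -
  have inv: "invariant_form mu" and bil: "comm_bilinear mu"
    using good good_ring_invariant_form by (auto simp: good_ring_def comm_ring_structure_iff)
  note comm = comm_bilinear_commute[OF bil]
  have triv: False if "\<And>i j. i \<in> {1..m} \<Longrightarrow> j \<in> {1..m} \<Longrightarrow> mu (x i) (x j) = 0"
  proof -
    have "mu = trivial_mult"
      by (rule trivial_mult_by_gens[OF bil]) (use n that in auto)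
    with nontrivial show False by simp
  qed
  have m: "m \<ge> 1" using triv by (cases "m = 0") auto
  have small: "mu (x j) (x l) = 0"
    if "i \<in> {1..m}" "j \<in> {1..m}" "l \<in> {1..m}" "l \<noteq> i" "elt_order (x j) < elt_order (x i)" for i j l
    using small_x_kills[OF inv, of i j "Inr l"] that by simp
  have equal: "mu (x j) (x l) = (if involves (Inr i) (mu (x i) (x l)) then invol (x j) else 0)"
    if "i \<in> {1..m}" "j \<in> {1..m}" "l \<in> {1..m}" "i \<noteq> j" "l \<noteq> i" "elt_order (x j) = elt_order (x i)" for i j l
    using equal_x[OF inv, of i j "Inr l"] that by simp
  show ?thesis
  proof (cases single_top)
    case top: True
    have val: "mu g h \<in> {0, invol (x 1)}" for g h
      using single_top_value[OF inv top] .
    have less: "elt_order (x i) < elt_order (x 1)" if "i \<in> {2..m}" for i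
      using single_top_less[OF top that] .
    have low: "mu (x i) (x j) = 0" if "i \<in> {2..m}" "j \<in> {2..m}" for i j
      using small[of 1 i j] less[OF that(1)] that m by auto
    have gt_4: "elt_order (x 1) > 4" if "mu (x 1) (x 1) \<noteq> 0"
    proof (rule square_order_gt_4[OF good n m])
      show sq: "mu (x 1) (x 1) = invol (x 1)" using val[of "x 1" "x 1"] that by auto
      fix i assume "i \<in> {1..m}"
      then show "elt_order (x i) = elt_order (x 1) \<and> mu (x i) (x i) = invol (x i) \<or>
          elt_order (x i) < elt_order (x 1) \<and> mu (x i) (x i) = 0"
        using less[of i] low[of i i] sq by (cases "i = 1") auto
    qed
    show ?thesis
    proof (cases "m = 1")
      case True
      have "mu (x 1) (x 1) \<noteq> 0" using triv True by auto
      with gt_4 have "family_A n m z x mu" unfolding family_A_def using bil n True val[of "x 1" "x 1"] by simp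
      then show ?thesis ..
    next
      case False
      with m have m2: "m \<ge> 2" by simp
      have x1xi: "mu (x 1) (x i) = 0" if i: "i \<in> {3..m}" for i
      proof (cases "elt_order (x i) = elt_order (x 2)")
        case False
        then have "elt_order (x i) < elt_order (x 2)" using ord_x_antimono[of 2 i] i by auto
        then show ?thesis using small[of 2 i 1] i m2 comm[of "x 1"] by auto
      next
        case True
        have "\<not> involves (Inr 2) (mu (x 2) (x 1))"
          using val[of "x 2" "x 1"] involves_invol_x[of 2 1] involves_zero[of "Inr 2"] m2 by auto
        then show ?thesis using equal[of 2 i 1] True i m2 comm[of "x 1"] by auto
      qed
      have "elt_order (x 3) < elt_order (x 2)" if "m > 2" "mu (x 1) (x 2) \<noteq> 0"
      proof (rule ccontr)
        assume "\<not> ?thesis"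
        then have "elt_order (x 2) = elt_order (x 3)" using ord_x_antimono[of 2 3] that by auto
        moreover have "\<not> involves (Inr 3) (mu (x 3) (x 1))"
          using x1xi[of 3] comm[of "x 1"] involves_zero[of "Inr 3"] that by auto
        ultimately have "mu (x 2) (x 1) = 0" using equal[of 3 2 1] that by auto
        with that comm show False by metis
      qed
      then have "family_B n m z x mu" unfolding family_B_def
        using bil n m2 less[of 2] gt_4 val low x1xi by auto
      then show ?thesis by blast
    qed
  next
    case False
    then have m2: "m \<ge> 2" and o2: "elt_order (x 2) = elt_order (x 1)"
      using m ord_x_antimono[of 1 2] by (auto simp: single_top_def)
    have below: "mu (x j) (x l) = 0" 
      if "j \<in> {1..m}" "l \<in> {1..m}" "elt_order (x j) < elt_order (x 1)" for j l
      using small[of "if l = 1 then 2 else 1" j l] that m2 o2 by auto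
    have "m > 2 \<longrightarrow> elt_order (x 3) < elt_order (x 2)"
    proof (rule ccontr)
      assume *: "\<not> ?thesis"
      then have m3: "m \<ge> 3" and o3: "elt_order (x 3) = elt_order (x 1)"
        using ord_x_antimono[of 2 3] o2 by auto
      \<comment> \<open>A third generator \<open>x i\<close> of largest order makes \<open>x j x l\<close> a multiple of \<open>invol (x j)\<close>, and by symmetry of \<open>invol (x l)\<close>.\<close>
      have off: "mu (x j) (x l) = 0"
        if "j \<in> {1..m}" "l \<in> {1..m}" "j \<noteq> l" "elt_order (x j) = elt_order (x 1)"
          "elt_order (x l) = elt_order (x 1)" for j l
      proof -
        obtain i where i: "i \<in> {1,2,3}" "i \<noteq> j" "i \<noteq> l"
        proof -
          have "\<exists>i\<in>{1,2,3}. i \<noteq> j \<and> i \<noteq> l" by force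
          then show ?thesis using that by blast
        qed
        then have "i \<in> {1..m}" "elt_order (x i) = elt_order (x 1)" using m3 o2 o3 by auto
        then have "mu (x j) (x l) \<in> {0, invol (x j)}" "mu (x l) (x j) \<in> {0, invol (x l)}"
          using equal[of i j l] equal[of i l j] that i by auto
        then have "mu (x j) (x l) = 0 \<or> invol (x j) = invol (x l)" using comm[of "x j" "x l"] by auto
        then show ?thesis using involves_invol_x[of j j] involves_invol_x[of j l] that by auto
      qed
      show False
      proof (rule triv)
        fix j l assume jl: "j \<in> {1..m}" "l \<in> {1..m}"
        show "mu (x j) (x l) = 0"
        proof (cases "elt_order (x j) = elt_order (x 1) \<and> elt_order (x l) = elt_order (x 1)")
          case False
          then have "elt_order (x j) < elt_order (x 1) \<or> elt_order (x l) < elt_order (x 1)"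
            using ord_x_antimono[of 1 j] ord_x_antimono[of 1 l] jl by auto
          then show ?thesis using below[of j l] below[of l j] jl comm[of "x j" "x l"] by auto
        next
          case True
          show ?thesis
          proof (cases "j = l")
            case False
            then show ?thesis using off jl True by blast
          next
            case eq: True
            define i where "i = (if l = 1 then 2 else (1::nat))"
            have i: "i \<in> {1..m}" "i \<noteq> l" "elt_order (x i) = elt_order (x 1)"
              using m2 o2 by (auto simp: i_def)
            have "mu (x i) (x l) = 0" using off[of i l] i jl True by auto
            then show ?thesis using equal[of i l l] i jl True eq involves_zero[of "Inr i"] by auto
          qed
        qed
      qed
    qed
    then have lt: "elt_order (x i) < elt_order (x 1)" if "i \<in> {3..m}" for i
      using ord_x_antimono[of 3 i] that o2 by fastforce
    have mem: "1 \<in> {1..m}" "2 \<in> {1..m}" using m2 by auto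
    have has12: "involves (Inr 1) (invol (x 1))" using involves_invol_x mem by blast
    have sq2: "mu (x 2) (x 2) = (if involves (Inr 1) (mu (x 1) (x 2)) then invol (x 2) else 0)"
      using equal[of 1 2 2] mem o2 by simp
    have sq1: "mu (x 1) (x 1) = (if involves (Inr 2) (mu (x 1) (x 2)) then invol (x 1) else 0)"
      using equal[of 2 1 1] mem o2 comm[of "x 1" "x 2"] by simp
    have sq2': "mu (x 2) (x 2) = (if involves (Inr 1) (mu (x 1) (x 1)) then invol (x 2) else 0)"
      using invariant_form_equal_orders_square[OF inv, of "Inr 1" "Inr 2"] mem ord_eq[OF o2] by simp
    have hz: "\<not> involves (Inr 1) 0" "\<not> involves (Inr 2) 0" "involves (Inr 2) (invol (x 2))" "invol (x 2) \<noteq> 0"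
      using involves_zero[of "Inr 1"] involves_zero[of "Inr 2"] involves_invol_x[of 2 2] mem by auto
    \<comment> \<open>The relations between the two generators of largest order leave a single coefficient.\<close>
    have iff: "involves (Inr 1) (mu (x 1) (x 2)) \<longleftrightarrow> involves (Inr 2) (mu (x 1) (x 2))"
      using sq1 sq2 sq2' hz has12 by (auto split: if_splits)
    let ?f = "\<lambda>i. if involves i (mu (x 1) (x 2)) then invol (case_sum z x i) else 0"
    have "mu (x 1) (x 2) = sum ?f ({1..n} <+> {1..m})"
      by (rule double_eq_0_expansion[OF invariant_form_double[OF inv]])
    also have "\<dots> = sum ?f {Inr 1, Inr 2}"
    proof (rule sum.mono_neutral_right)
      show "\<forall>i\<in>({1..n} <+> {1..m}) - {Inr 1, Inr 2}. ?f i = 0"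
      proof
        fix i assume "i \<in> ({1..n} <+> {1..m}) - {Inr 1, Inr 2}"
        then obtain k where k: "i = Inr k" "k \<in> {3..m}" using n by (cases i) force+
        obtain a where "ord (Inr 1) = ord (Inr k) * a" "a \<noteq> 0" "even a"
          using ord_x_factor[of k 1] k lt[of k] by auto
        then show "?f i = 0"
          using invariant_form_avoids_small[OF inv, of "Inr k" "Inr 1" a "x 1" "x 2"] k by auto
      qed
    qed (use mem in auto)
    finally have off12: "mu (x 1) (x 2) =
        (if involves (Inr 1) (mu (x 1) (x 2)) then invol (x 1) + invol (x 2) else 0)"
      using iff by (simp split: if_splits)
    have nz: "involves (Inr 1) (mu (x 1) (x 2))"
    proof (rule ccontr)
      assume not: "\<not> ?thesis"
      have zero: "mu (x 1) (x 2) = 0" "mu (x 1) (x 1) = 0" "mu (x 2) (x 2) = 0"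
        using off12 sq1 sq2 iff not by auto
      show False
      proof (rule triv)
        fix j l assume jl: "j \<in> {1..m}" "l \<in> {1..m}"
        show "mu (x j) (x l) = 0"
        proof (cases "j \<ge> 3 \<or> l \<ge> 3")
          case True
          then show ?thesis
            using below[of j l] below[of l j] lt[of j] lt[of l] jl comm[of "x j" "x l"] by auto
        next
          case False
          then have "j \<in> {1,2}" "l \<in> {1,2}" using jl by auto
          then show ?thesis using zero comm[of "x 1" "x 2"] by auto
        qed
      qed
    qed
    have vals: "mu (x 1) (x 1) = invol (x 1)" "mu (x 2) (x 2) = invol (x 2)"
      "mu (x 1) (x 2) = invol (x 1) + invol (x 2)"
      using sq1 sq2 off12 nz iff by auto
    have "elt_order (x 1) > 4"
    proof (rule square_order_gt_4[OF good n m vals(1)])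
      fix i assume i: "i \<in> {1..m}"
      then consider "i = 1" | "i = 2" | "i \<in> {3..m}" by force
      then show "elt_order (x i) = elt_order (x 1) \<and> mu (x i) (x i) = invol (x i) \<or>
          elt_order (x i) < elt_order (x 1) \<and> mu (x i) (x i) = 0"
        using vals o2 lt[of i] below[of i i] i by cases auto
    qed
    moreover have "mu (x 1) (x i) = 0 \<and> mu (x 2) (x j) = 0 \<and> mu (x i) (x j) = 0"
      if "i \<in> {3..m}" "j \<in> {3..m}" for i j
      using below[of i 1] below[of j 2] below[of i j] lt[of i] lt[of j] that mem
        comm[of "x 1" "x i"] comm[of "x 2" "x j"] by auto
    ultimately have "family_C n m z x mu" unfolding family_C_def
      using bil n m2 o2 vals lt[of 3] by auto
    then show ?thesis by blast
  qed
qed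

lemma good_ring_in_family:
  assumes good: "good_ring mu"
  shows "\<exists>X. in_family X n m z x mu"
proof -
  have nontrivial: "mu \<noteq> trivial_mult" using good by (simp add: good_ring_def)
  have inv: "invariant_form mu" and bil: "comm_bilinear mu"
    using good good_ring_invariant_form by (auto simp: good_ring_def comm_ring_structure_iff)
  have "n < 3"
  proof (rule ccontr)
    assume n: "\<not> ?thesis"
    have "mu = trivial_mult"
    proof (rule trivial_multI[OF bil])
      fix j l assume jl: "j \<in> {1..n} <+> {1..m}" "l \<in> {1..n} <+> {1..m}"
      have "\<exists>i\<in>{1,2,3}. j \<noteq> Inl i \<and> l \<noteq> Inl i" by (cases j; cases l) force+
      then show "mu (case_sum z x j) (case_sum z x l) = 0"
        using free_gen_kills[OF inv _ jl] n by force
    qed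
    with nontrivial show False by simp
  qed
  then consider "n = 0" | "n = 1" | "n = 2" by linarith
  then show ?thesis
  proof cases
    case 1
    then show ?thesis using good_rank_0[OF good nontrivial] by (metis in_family.simps(1-3))
  next
    case 2
    then show ?thesis using good_rank_1[OF good nontrivial] by (metis in_family.simps(4,5))
  next
    case 3
    then show ?thesis using good_rank_2[OF good nontrivial] by (metis in_family.simps(6))
  qed
qed

end

section \<open>Quadratic refinements and the circle group\<close>

text \<open>
  Let \<open>q\<close> satisfy \<open>q (g + h) = q g + q h + mu g h\<close>. Then \<open>g \<mapsto> g + q g\<close> turns addition into
  the circle operation, provided that \<open>q\<close> and \<open>mu\<close> take their values in a subgroup \<open>T\<close> of exponent
  two on which both vanish. The subgroup is a parameter because a sum of such forms is again
  of this kind only with a common \<open>T\<close>.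
\<close>

definition elementary_subgroup :: "'a::ab_group_add set \<Rightarrow> bool" where
  "elementary_subgroup T \<longleftrightarrow> 0 \<in> T \<and> (\<forall>s\<in>T. \<forall>t\<in>T. s + t \<in> T) \<and> (\<forall>t\<in>T. t + t = 0)"

definition refinable :: "'a::ab_group_add set \<Rightarrow> ('a \<Rightarrow> 'a \<Rightarrow> 'a) \<Rightarrow> bool" where
  "refinable T mu \<longleftrightarrow> comm_bilinear mu \<and> (\<forall>g h. mu g h \<in> T) \<and> (\<forall>t\<in>T. \<forall>h. mu t h = 0) \<and>
     (\<exists>q. (\<forall>g. q g \<in> T) \<and> (\<forall>t\<in>T. q t = 0) \<and> (\<forall>g h. q (g + h) = q g + q h + mu g h))"

lemma refinable_zero: "elementary_subgroup T \<Longrightarrow> refinable T (\<lambda>g h. 0)"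
  unfolding refinable_def elementary_subgroup_def comm_bilinear_def additive_def
  by (intro conjI exI[of _ "\<lambda>g. 0"]) auto

lemma comm_bilinear_sum_two:
  "comm_bilinear mu \<Longrightarrow> comm_bilinear nu \<Longrightarrow> comm_bilinear (\<lambda>g h. mu g h + nu g h)"
  unfolding comm_bilinear_def additive_def by (metis (no_types, lifting) add.assoc add.left_commute)

lemma refinable_add:
  assumes T: "elementary_subgroup T" and mu: "refinable T mu" and nu: "refinable T nu"
  shows "refinable T (\<lambda>g h. mu g h + nu g h)"
proof -
  obtain p where p: "\<forall>g. p g \<in> T" "\<forall>t\<in>T. p t = 0" "\<forall>g h. p (g + h) = p g + p h + mu g h"
    using mu by (auto simp: refinable_def)
  obtain q where q: "\<forall>g. q g \<in> T" "\<forall>t\<in>T. q t = 0" "\<forall>g h. q (g + h) = q g + q h + nu g h"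
    using nu by (auto simp: refinable_def)
  have "(\<forall>g. p g + q g \<in> T) \<and> (\<forall>t\<in>T. p t + q t = 0) \<and>
      (\<forall>g h. p (g + h) + q (g + h) = (p g + q g) + (p h + q h) + (mu g h + nu g h))"
    using p q T by (auto simp: elementary_subgroup_def add_ac)
  then have "\<exists>r. (\<forall>g. r g \<in> T) \<and> (\<forall>t\<in>T. r t = 0) \<and> (\<forall>g h. r (g + h) = r g + r h + (mu g h + nu g h))"
    by (rule exI[of _ "\<lambda>g. p g + q g"])
  moreover have "comm_bilinear (\<lambda>g h. mu g h + nu g h)"
    using mu nu by (simp add: refinable_def comm_bilinear_sum_two)
  moreover have "(\<forall>g h. mu g h + nu g h \<in> T) \<and> (\<forall>t\<in>T. \<forall>h. mu t h + nu t h = 0)"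
    using mu nu T by (simp add: refinable_def elementary_subgroup_def)
  ultimately show ?thesis unfolding refinable_def by blast
qed

text \<open>
  All triple products vanish because products lie in \<open>T\<close>, so associativity is automatic. The map
  \<open>g \<mapsto> g + q g\<close> is its own inverse, since \<open>q (g + q g) = q g\<close> and \<open>2 (q g) = 0\<close>.
\<close>

lemma refinable_circ_isomorphic:
  fixes mu :: "'a::ab_group_add \<Rightarrow> 'a \<Rightarrow> 'a"
  assumes T: "elementary_subgroup T" and mu: "refinable T mu"
  shows "comm_ring_structure mu" "circ_group_isomorphic mu"
proof -
  have bil: "comm_bilinear mu" and val: "mu g h \<in> T" for g h using mu by (auto simp: refinable_def)
  note comm = comm_bilinear_commute[OF bil]
  have ann: "mu t h = 0" "mu h t = 0" if "t \<in> T" for t h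
    using mu that comm[of h t] by (auto simp: refinable_def)
  have annm: "mu (mu a b) c = 0" "mu a (mu b c) = 0" for a b c using ann val by auto
  show "comm_ring_structure mu" using bil annm by (simp add: comm_ring_structure_iff)
  obtain q where q: "\<And>g. q g \<in> T" "\<And>t. t \<in> T \<Longrightarrow> q t = 0" "\<And>g h. q (g + h) = q g + q h + mu g h"
    using mu unfolding refinable_def by blast
  have dbl: "t + t = 0" if "t \<in> T" for t using T that by (simp add: elementary_subgroup_def)
  define \<phi> where "\<phi> g = g + q g" for g
  have "\<phi> (\<phi> g) = g" for g
    using q(1)[of g] q(2) q(3)[of g "q g"] ann dbl by (simp add: \<phi>_def add.assoc)
  then have "bij \<phi>" by (intro o_bij[of \<phi>]) auto
  moreover have "\<phi> (g + h) = circ mu (\<phi> g) (\<phi> h)" for g h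
    using q(1) ann by (simp add: \<phi>_def circ_def q(3) comm_bilinear_simps[OF bil] add_ac)
  moreover have "group (circ mu) 0 (\<lambda>g. - g + mu g g)"
    by unfold_locales (simp_all add: circ_def comm_bilinear_simps[OF bil] annm add_ac)
  ultimately show "circ_group_isomorphic mu" unfolding circ_group_isomorphic_def by blast
qed

lemma good_ringI:
  assumes "elementary_subgroup T" "refinable T mu" "invariant_form mu" "mu \<noteq> trivial_mult"
  shows "good_ring mu"
  using assms refinable_circ_isomorphic[OF assms(1,2)]
  by (simp add: good_ring_def automorphisms_lift_iff invariant_form_def)

lemma invariant_form_add:
  assumes "invariant_form mu" "invariant_form nu"
  shows "invariant_form (\<lambda>g h. mu g h + nu g h)"
  using assms comm_bilinear_sum_two unfolding invariant_form_def
  by (auto simp: group_isom_def additive_def)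

lemma group_isom_inv:
  fixes \<alpha> :: "'a::ab_group_add \<Rightarrow> 'b::ab_group_add"
  assumes "group_isom \<alpha>"
  shows "group_isom (inv \<alpha>)"
proof -
  have bij: "bij \<alpha>" and add: "additive \<alpha>" using assms by (auto simp: group_isom_def)
  have "inv \<alpha> (g + h) = inv \<alpha> g + inv \<alpha> h" for g h
  proof -
    have "\<alpha> (inv \<alpha> g + inv \<alpha> h) = g + h"
      using bij by (simp add: additive.add[OF add] bij_is_surj surj_f_inv_f)
    then show ?thesis using bij by (metis bij_inv_eq_iff)
  qed
  then show ?thesis using bij by (simp add: group_isom_def additive_def bij_imp_bij_inv)
qed

context generating_system
begin

text \<open>
  The bilinear forms whose only non-zero product of generators is \<open>gen i * gen i = t\<close>,
  respectively \<open>gen i * gen j = t\<close>, where \<open>t + t = 0\<close>. Families A, B, C, E and F consist of sums of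
  such forms.
\<close>

definition square_form :: "'i \<Rightarrow> 'a \<Rightarrow> 'a \<Rightarrow> 'a \<Rightarrow> 'a" where
  "square_form i t g h = (if odd (coord g i) \<and> odd (coord h i) then t else 0)"

definition cross_form :: "'i \<Rightarrow> 'i \<Rightarrow> 'a \<Rightarrow> 'a \<Rightarrow> 'a \<Rightarrow> 'a" where
  "cross_form i j t g h =
     (if (odd (coord g i) \<and> odd (coord h j)) \<noteq> (odd (coord g j) \<and> odd (coord h i)) then t else 0)"

lemma even_cong: "i \<in> I \<Longrightarrow> ord i dvd a - b \<Longrightarrow> even a \<longleftrightarrow> even b"
  using even_ord[of i] dvd_trans[of 2 "ord i" "a - b"] by simp

lemma even_coord_add: "i \<in> I \<Longrightarrow> even (coord (g + h) i) \<longleftrightarrow> even (coord g i) = even (coord h i)"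
  using even_cong[OF _ coord_add] by simp

lemma even_coord_zsmul: "i \<in> I \<Longrightarrow> even (coord (k \<odot> g) i) \<longleftrightarrow> even k \<or> even (coord g i)"
  using even_cong[OF _ coord_zsmul] by simp

lemma even_coord_gen: "i \<in> I \<Longrightarrow> j \<in> I \<Longrightarrow> even (coord (gen j) i) \<longleftrightarrow> i \<noteq> j"
  using even_cong[OF _ coord_gen, of i j] by simp

lemma even_coord_zero: "i \<in> I \<Longrightarrow> even (coord 0 i)"
  using even_coord_zsmul[of i 0 0] by simp

lemma square_form_gen:
  "\<lbrakk>i \<in> I; j \<in> I; l \<in> I\<rbrakk> \<Longrightarrow> square_form i t (gen j) (gen l) = (if j = i \<and> l = i then t else 0)"
  by (auto simp: square_form_def even_coord_gen)

lemma cross_form_gen: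
  "\<lbrakk>i \<in> I; i' \<in> I; j \<in> I; l \<in> I; i \<noteq> i'\<rbrakk> \<Longrightarrow>
    cross_form i i' t (gen j) (gen l) = (if j = i \<and> l = i' \<or> j = i' \<and> l = i then t else 0)"
  by (auto simp: cross_form_def even_coord_gen)

lemma comm_bilinear_square_form: "i \<in> I \<Longrightarrow> t + t = 0 \<Longrightarrow> comm_bilinear (square_form i t)"
  by (auto simp: comm_bilinear_def additive_def square_form_def even_coord_add)

lemma comm_bilinear_cross_form:
  "i \<in> I \<Longrightarrow> j \<in> I \<Longrightarrow> t + t = 0 \<Longrightarrow> comm_bilinear (cross_form i j t)"
  by (auto simp: comm_bilinear_def additive_def cross_form_def even_coord_add)

text \<open>
  The refinement is \<open>q g = (a choose 2) t\<close> with \<open>a = coord g i\<close>. Here \<open>a choose 2\<close>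
  is odd exactly for \<open>a\<close> congruent to \<open>2\<close> or \<open>3\<close> modulo \<open>4\<close>, which is why the coordinate has to be
  defined modulo \<open>4\<close> and has to vanish modulo \<open>4\<close> on \<open>T\<close>. For \<open>T\<close> containing \<open>invol (gen i)\<close> with
  \<open>ord i = 2 ^ e\<close> this means \<open>e \<ge> 3\<close>.
\<close>

lemma refinable_square_form:
  assumes T: "elementary_subgroup T" "t \<in> T" and i: "i \<in> I"
    and four: "t \<noteq> 0 \<Longrightarrow> 4 dvd ord i" "\<And>s. t \<noteq> 0 \<Longrightarrow> s \<in> T \<Longrightarrow> 4 dvd coord s i"
  shows "refinable T (square_form i t)"
proof (cases "t = 0")
  case True
  then have "square_form i t = (\<lambda>g h. 0)" by (simp add: square_form_def fun_eq_iff)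
  then show ?thesis using refinable_zero[OF T(1)] by simp
next
  case False
  define q where "q g = (if coord g i mod 4 \<in> {2, 3} then t else 0)" for g
  have t: "t + t = 0" using T by (simp add: elementary_subgroup_def)
  have "q (g + h) = q g + q h + square_form i t g h" for g h
  proof -
    have "4 dvd coord (g + h) i - (coord g i + coord h i)"
      using four(1)[OF False] coord_add[OF i] by (rule dvd_trans)
    then have "coord (g + h) i mod 4 = (coord g i + coord h i) mod 4" by (simp add: mod_eq_dvd_iff)
    then have c: "coord (g + h) i mod 4 = (coord g i mod 4 + coord h i mod 4) mod 4" by (simp add: mod_add_eq)
    have o: "odd k \<longleftrightarrow> k mod 4 \<in> {1, 3}" for k :: int
      unfolding insert_iff empty_iff by presburger
    \<comment> \<open>Addition modulo \<open>4\<close> reduces the identity for \<open>q\<close> to sixteen cases.\<close>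
    have r: "k mod 4 \<in> {0, 1, 2, 3}" for k :: int
      unfolding insert_iff empty_iff by presburger
    show ?thesis
      using r[of "coord g i"] r[of "coord h i"] t unfolding q_def square_form_def c o
      by auto
  qed
  moreover have "q s = 0" if "s \<in> T" for s
    using four(2)[OF False that] by (simp add: q_def dvd_eq_mod_eq_0)
  moreover have "square_form i t s h = 0" if "s \<in> T" for s h
    using four(2)[OF False that] by (auto simp: square_form_def dest: dvd_trans[of 2 4, simplified])
  moreover have "0 \<in> T" using T by (simp add: elementary_subgroup_def)
  ultimately show ?thesis unfolding refinable_def
    using comm_bilinear_square_form[OF i t] T(2)
    by (intro conjI exI[of _ q]) (auto simp: q_def square_form_def)
qed

text \<open>
  The refinement is the product of the two coordinates; here parities suffice.
\<close>

lemma refinable_cross_form: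
  assumes T: "elementary_subgroup T" "t \<in> T" and ij: "i \<in> I" "j \<in> I"
    and even: "\<And>s. t \<noteq> 0 \<Longrightarrow> s \<in> T \<Longrightarrow> even (coord s i) \<and> even (coord s j)"
  shows "refinable T (cross_form i j t)"
proof (cases "t = 0")
  case True
  then have "cross_form i j t = (\<lambda>g h. 0)" by (simp add: cross_form_def fun_eq_iff)
  then show ?thesis using refinable_zero[OF T(1)] by simp
next
  case False
  define q where "q g = (if odd (coord g i) \<and> odd (coord g j) then t else 0)" for g
  have t: "t + t = 0" "0 \<in> T" using T by (simp_all add: elementary_subgroup_def)
  have "q (g + h) = q g + q h + cross_form i j t g h" for g h
    using ij t by (auto simp: q_def cross_form_def even_coord_add)
  moreover have "q s = 0" "cross_form i j t s h = 0" if "s \<in> T" for s h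
    using even[OF False that] by (auto simp: q_def cross_form_def)
  ultimately show ?thesis unfolding refinable_def
    using comm_bilinear_cross_form[OF ij t(1)] T(2) t(2)
    by (intro conjI exI[of _ q]) (auto simp: q_def cross_form_def)
qed

text \<open>
  A description without coordinates of the subgroup on which the coordinates in \<open>J\<close> are even. It is
  available when one integer \<open>N\<close> annihilates all generators outside \<open>J\<close>, while \<open>N v = 0\<close> forces the
  coordinates of \<open>v\<close> in \<open>J\<close> to be even. Therefore this subgroup is invariant under automorphisms.
\<close>

lemma even_coordinates_iff:
  assumes J: "J \<subseteq> I" and out: "\<And>l. l \<in> I - J \<Longrightarrow> ord l dvd N"
    and inn: "\<And>l c. l \<in> J \<Longrightarrow> ord l dvd N * c \<Longrightarrow> even c"
  shows "(\<forall>l\<in>J. even (coord g l)) \<longleftrightarrow> (\<exists>u v. g = 2 \<odot> u + v \<and> N \<odot> v = 0)"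
proof
  assume ev: "\<forall>l\<in>J. even (coord g l)"
  let ?u = "\<Sum>l\<in>J. (coord g l div 2) \<odot> gen l" and ?v = "\<Sum>l\<in>I - J. coord g l \<odot> gen l"
  have "2 \<odot> ?u = (\<Sum>l\<in>J. coord g l \<odot> gen l)"
    using ev by (simp add: zmod.scale_sum_right cong: sum.cong)
  then have "g = 2 \<odot> ?u + ?v"
    using sum.subset_diff[OF J finite_I, of "\<lambda>l. coord g l \<odot> gen l"] coord_expansion[of g]
    by (simp add: add.commute)
  moreover have "N \<odot> ?v = 0"
    using out by (simp add: zmod.scale_sum_right zsmul_gen_eq_0_iff sum.neutral)
  ultimately show "\<exists>u v. g = 2 \<odot> u + v \<and> N \<odot> v = 0" by blast
next
  assume "\<exists>u v. g = 2 \<odot> u + v \<and> N \<odot> v = 0"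
  then obtain u v where uv: "g = 2 \<odot> u + v" "N \<odot> v = 0" by blast
  show "\<forall>l\<in>J. even (coord g l)"
  proof
    fix l assume l: "l \<in> J"
    then have "ord l dvd N * coord v l" using uv(2) zsmul_eq_0_iff_coord J by blast
    then have "even (coord v l)" using inn l by blast
    then show "even (coord g l)" using uv(1) l J by (auto simp: even_coord_add even_coord_zsmul)
  qed
qed

lemma even_coordinates_invariant:
  assumes J: "J \<subseteq> I" "\<And>l. l \<in> I - J \<Longrightarrow> ord l dvd N"
    "\<And>l c. l \<in> J \<Longrightarrow> ord l dvd N * c \<Longrightarrow> even c"
    and \<alpha>: "group_isom \<alpha>"
  shows "(\<forall>l\<in>J. even (coord (\<alpha> g) l)) \<longleftrightarrow> (\<forall>l\<in>J. even (coord g l))"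
proof -
  have *: "\<exists>u v. \<beta> g = 2 \<odot> u + v \<and> N \<odot> v = 0"
    if \<beta>: "group_isom \<beta>" and g: "\<exists>u v. g = 2 \<odot> u + v \<and> N \<odot> v = 0" for \<beta> :: "'a \<Rightarrow> 'a" and g
  proof -
    have add: "additive \<beta>" using \<beta> by (simp add: group_isom_def)
    obtain u v where uv: "g = 2 \<odot> u + v" "N \<odot> v = 0" using g by blast
    have "\<beta> g = 2 \<odot> \<beta> u + \<beta> v" using uv(1) by (simp add: additive.add[OF add] additive_zsmul[OF add])
    moreover have "N \<odot> \<beta> v = 0" using uv(2) by (metis additive_zsmul[OF add] additive.zero[OF add])
    ultimately show ?thesis by blast
  qed
  have "inv \<alpha> (\<alpha> g) = g" using \<alpha> by (simp add: group_isom_def bij_is_inj)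
  then have "(\<exists>u v. \<alpha> g = 2 \<odot> u + v \<and> N \<odot> v = 0) \<longleftrightarrow> (\<exists>u v. g = 2 \<odot> u + v \<and> N \<odot> v = 0)"
    using *[OF \<alpha>, of g] *[OF group_isom_inv[OF \<alpha>], of "\<alpha> g"] by auto
  moreover have "(\<forall>l\<in>J. even (coord g l)) \<longleftrightarrow> (\<exists>u v. g = 2 \<odot> u + v \<and> N \<odot> v = 0)" for g
    by (rule even_coordinates_iff) (use J in blast)+
  ultimately show ?thesis by blast
qed

lemma invariant_square_form:
  assumes i: "i \<in> I" and t: "t + t = 0"
    and fixed: "\<And>\<alpha>. group_isom \<alpha> \<Longrightarrow> \<alpha> t = t"
    and N: "\<And>l. t \<noteq> 0 \<Longrightarrow> l \<in> I \<Longrightarrow> l \<noteq> i \<Longrightarrow> ord l dvd N"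
      "\<And>c. t \<noteq> 0 \<Longrightarrow> ord i dvd N * c \<Longrightarrow> even c"
  shows "invariant_form (square_form i t)"
proof -
  have "\<alpha> (square_form i t g h) = square_form i t (\<alpha> g) (\<alpha> h)" if \<alpha>: "group_isom \<alpha>" for \<alpha> g h
  proof (cases "t = 0")
    case True
    then show ?thesis using fixed[OF \<alpha>] by (simp add: square_form_def)
  next
    case False
    have "even (coord (\<alpha> g) i) \<longleftrightarrow> even (coord g i)" for g
      using even_coordinates_invariant[of "{i}" N \<alpha> g] i N False \<alpha> by auto
    moreover have "\<alpha> 0 = 0" using \<alpha> by (auto simp: group_isom_def additive.zero)
    ultimately show ?thesis using fixed[OF \<alpha>] by (simp add: square_form_def)
  qed
  then show ?thesis using comm_bilinear_square_form[OF i t] by (simp add: invariant_form_def)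
qed

text \<open>
  For distinct \<open>i\<close> and \<open>j\<close>, on the quotient by the subgroup of even \<open>i\<close>- and \<open>j\<close>-coordinates, which is a plane over the field
  with two elements, \<open>cross_form\<close> is the non-degenerate alternating form. It is non-zero
  exactly on pairs of distinct non-zero vectors, so that subgroup determines it.
\<close>

lemma cross_form_iff:
  assumes "i \<in> I" "j \<in> I"
  shows "cross_form i j t g h =
    (if (\<forall>l\<in>{i,j}. even (coord g l)) \<or> (\<forall>l\<in>{i,j}. even (coord h l)) \<or> (\<forall>l\<in>{i,j}. even (coord (g + h) l))
     then 0 else t)"
  using assms by (auto simp: cross_form_def even_coord_add)

lemma invariant_cross_form:
  assumes ij: "i \<in> I" "j \<in> I" and t: "t + t = 0"
    and fixed: "\<And>\<alpha>. group_isom \<alpha> \<Longrightarrow> \<alpha> t = t"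
    and N: "\<And>l. t \<noteq> 0 \<Longrightarrow> l \<in> I \<Longrightarrow> l \<noteq> i \<Longrightarrow> l \<noteq> j \<Longrightarrow> ord l dvd N"
      "\<And>c. t \<noteq> 0 \<Longrightarrow> ord i dvd N * c \<Longrightarrow> even c" "\<And>c. t \<noteq> 0 \<Longrightarrow> ord j dvd N * c \<Longrightarrow> even c"
  shows "invariant_form (cross_form i j t)"
proof -
  have "\<alpha> (cross_form i j t g h) = cross_form i j t (\<alpha> g) (\<alpha> h)" if \<alpha>: "group_isom \<alpha>" for \<alpha> g h
  proof (cases "t = 0")
    case True
    then show ?thesis using fixed[OF \<alpha>] by (simp add: cross_form_def)
  next
    case False
    have add: "\<alpha> 0 = 0" "\<alpha> (g + h) = \<alpha> g + \<alpha> h" for g h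
      using \<alpha> by (auto simp: group_isom_def additive.zero additive.add)
    have ev: "(\<forall>l\<in>{i,j}. even (coord (\<alpha> g) l)) \<longleftrightarrow> (\<forall>l\<in>{i,j}. even (coord g l))" for g
      by (rule even_coordinates_invariant[of _ N]) (use ij N False \<alpha> in auto)
    show ?thesis unfolding cross_form_iff[OF ij] ev add(2)[symmetric] using fixed[OF \<alpha>] add(1) by simp
  qed
  then show ?thesis using comm_bilinear_cross_form[OF ij t] by (simp add: invariant_form_def)
qed

end

section \<open>The rings in the families are good\<close>

lemma half_dvd_imp_even:
  fixes a c :: int
  assumes "even a" "a \<noteq> 0" "a dvd (a div 2) * c"
  shows "even c"
  using assms by (auto elim!: evenE)

context decomposed_group
begin

lemma ord_x_dvd: "\<lbrakk>i \<in> {1..m}; j \<in> {1..m}; i \<le> j\<rbrakk> \<Longrightarrow> ord (Inr j) dvd ord (Inr i)"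
  using ord_x_factor[of j i] ord_x_antimono[of i j] by (metis atLeastAtMost_iff dvd_triv_left)

lemma ord_x_nonzero: "i \<in> {1..m} \<Longrightarrow> ord (Inr i) \<noteq> 0"
  using ord_x_ge_2[of i] by (simp add: ord_x)

lemma power_dvd_ord_x:
  assumes "i \<in> {1..m}" "elt_order (x i) \<ge> 2 ^ k"
  shows "2 ^ k dvd ord (Inr i)"
proof -
  obtain e where e: "elt_order (x i) = 2 ^ e" using ord_x_power assms by blast
  then have "k \<le> e" using assms(2) by simp
  then show ?thesis by (simp add: ord_x e le_imp_power_dvd)
qed

lemma ord_x_div_2_nonzero: "i \<in> {1..m} \<Longrightarrow> ord (Inr i) div 2 \<noteq> 0"
  using ord_x_ge_2[of i] by (simp add: ord_x)

lemma invol_x_double: "i \<in> {1..m} \<Longrightarrow> invol (x i) + invol (x i) = 0"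
  using invol_gen_double[of "Inr i"] by simp

lemma invol_x_nonzero: "i \<in> {1..m} \<Longrightarrow> invol (x i) \<noteq> 0"
  using involves_invol_x[of i i] involves_zero[of "Inr i"] by auto

lemma invol_x: "invol (x i) = (ord (Inr i) div 2) \<odot> x i"
  using invol_gen[of "Inr i"] by simp

text \<open>
  Let \<open>E\<close> be half the order of \<open>x 1\<close>. The image of \<open>E x 1\<close> is again a multiple by \<open>E\<close>, and \<open>E\<close>
  annihilates all the smaller cyclic factors. So the image is an involution that involves only the
  factor of \<open>x 1\<close>.
\<close>

lemma top_fixed:
  assumes top: single_top and \<alpha>: "group_isom \<alpha>"
  shows "\<alpha> (invol (x 1)) = invol (x 1)"
proof -
  have add: "additive \<alpha>" and inj: "inj \<alpha>" using \<alpha> by (auto simp: group_isom_def bij_is_inj)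
  have m: "1 \<in> {1..m}" using single_top_ge_1[OF top] by simp
  let ?w = "\<alpha> (invol (x 1))"
  have w: "?w = (ord (Inr 1) div 2) \<odot> \<alpha> (x 1)" by (simp add: invol_x additive_zsmul[OF add])
  have dbl: "?w + ?w = 0"
    using invol_x_double[OF m] additive.zero[OF add] by (metis additive.add[OF add])
  have "?w \<in> {0, invol (x 1)}"
  proof (rule in_top[OF dbl])
    fix i assume i: "i \<in> {2..m}"
    have "ord (Inr i) dvd ord (Inr 1) div 2"
      using ord_x_less_dvd[of 1 i] single_top_less[OF top i] i by auto
    moreover have "ord (Inr i) dvd coord ?w (Inr i) - (ord (Inr 1) div 2) * coord (\<alpha> (x 1)) (Inr i)"
      unfolding w using i by (intro coord_zsmul) auto
    ultimately show "\<not> involves (Inr i) ?w"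
      unfolding involves_def by (metis diff_add_cancel dvd_add dvd_mult2)
  qed
  moreover have "?w \<noteq> 0"
    using invol_x_nonzero[OF m] inj additive.zero[OF add] by (metis injD)
  ultimately show ?thesis by auto
qed

lemma top_invariant:
  assumes single_top "t \<in> {0, invol (x 1)}"
  shows "t + t = 0" "group_isom \<alpha> \<Longrightarrow> \<alpha> t = t"
  using assms top_fixed[OF assms(1)] single_top_ge_1[OF assms(1)] invol_x_double[of 1]
  by (auto simp: group_isom_def additive.zero)

lemma elementary_top: "m \<ge> 1 \<Longrightarrow> elementary_subgroup {0, invol (x 1)}"
  using invol_x_double[of 1] by (auto simp: elementary_subgroup_def)

lemma elementary_all: "elementary_subgroup {w::'a. w + w = 0}"
  by (auto simp: elementary_subgroup_def) (metis add.assoc add.left_commute add.right_neutral)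

lemma comm_bilinear_eq_on_gens:
  assumes mu: "comm_bilinear mu" and nu: "comm_bilinear nu"
    and zz: "\<And>i j. \<lbrakk>i \<in> {1..n}; j \<in> {1..n}; i \<le> j\<rbrakk> \<Longrightarrow> mu (z i) (z j) = nu (z i) (z j)"
    and zx: "\<And>i j. \<lbrakk>i \<in> {1..n}; j \<in> {1..m}\<rbrakk> \<Longrightarrow> mu (z i) (x j) = nu (z i) (x j)"
    and xx: "\<And>i j. \<lbrakk>i \<in> {1..m}; j \<in> {1..m}; i \<le> j\<rbrakk> \<Longrightarrow> mu (x i) (x j) = nu (x i) (x j)"
  shows "mu = nu"
proof (rule comm_bilinear_eqI[OF mu nu])
  have zz': "mu (z i) (z j) = nu (z i) (z j)" if "i \<in> {1..n}" "j \<in> {1..n}" for i j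
    using zz[of i j] zz[of j i] that comm_bilinear_commute[OF mu] comm_bilinear_commute[OF nu]
    by (metis nat_le_linear)
  have xx': "mu (x i) (x j) = nu (x i) (x j)" if "i \<in> {1..m}" "j \<in> {1..m}" for i j
    using xx[of i j] xx[of j i] that comm_bilinear_commute[OF mu] comm_bilinear_commute[OF nu]
    by (metis nat_le_linear)
  have xz: "mu (x j) (z i) = nu (x j) (z i)" if "i \<in> {1..n}" "j \<in> {1..m}" for i j
    using zx[OF that] comm_bilinear_commute[OF mu] comm_bilinear_commute[OF nu] by metis
  fix i j assume "i \<in> {1..n} <+> {1..m}" "j \<in> {1..n} <+> {1..m}"
  with zz' zx xx' xz show "mu (case_sum z x i) (case_sum z x j) = nu (case_sum z x i) (case_sum z x j)"
    by (elim PlusE) (simp_all only: sum.case)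
qed

lemma square_form_z:
  assumes "a \<in> {1..n}"
  shows "\<lbrakk>i \<in> {1..n}; j \<in> {1..n}\<rbrakk> \<Longrightarrow> square_form (Inl a) t (z i) (z j) = (if i = a \<and> j = a then t else 0)"
    "\<lbrakk>i \<in> {1..n}; j \<in> {1..m}\<rbrakk> \<Longrightarrow> square_form (Inl a) t (z i) (x j) = 0"
    "\<lbrakk>i \<in> {1..m}; j \<in> {1..m}\<rbrakk> \<Longrightarrow> square_form (Inl a) t (x i) (x j) = 0"
  using assms square_form_gen[of "Inl a" "Inl i" "Inl j" t] square_form_gen[of "Inl a" "Inl i" "Inr j" t]
    square_form_gen[of "Inl a" "Inr i" "Inr j" t] by auto

lemma square_form_x:
  "\<lbrakk>a \<in> {1..m}; i \<in> {1..m}; j \<in> {1..m}\<rbrakk> \<Longrightarrow>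
    square_form (Inr a) t (x i) (x j) = (if i = a \<and> j = a then t else 0)"
  using square_form_gen[of "Inr a" "Inr i" "Inr j" t] by auto

lemma cross_form_xx:
  "\<lbrakk>a \<in> {1..m}; b \<in> {1..m}; a \<noteq> b; i \<in> {1..m}; j \<in> {1..m}\<rbrakk> \<Longrightarrow>
    cross_form (Inr a) (Inr b) t (x i) (x j) = (if i = a \<and> j = b \<or> i = b \<and> j = a then t else 0)"
  using cross_form_gen[of "Inr a" "Inr b" "Inr i" "Inr j" t] by auto

lemma cross_form_zx:
  assumes "a \<in> {1..n}" "b \<in> {1..m}"
  shows "\<lbrakk>i \<in> {1..n}; j \<in> {1..n}\<rbrakk> \<Longrightarrow> cross_form (Inl a) (Inr b) t (z i) (z j) = 0"
    "\<lbrakk>i \<in> {1..n}; j \<in> {1..m}\<rbrakk> \<Longrightarrow>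
      cross_form (Inl a) (Inr b) t (z i) (x j) = (if i = a \<and> j = b then t else 0)"
    "\<lbrakk>i \<in> {1..m}; j \<in> {1..m}\<rbrakk> \<Longrightarrow> cross_form (Inl a) (Inr b) t (x i) (x j) = 0"
  using assms cross_form_gen[of "Inl a" "Inr b" "Inl i" "Inl j" t]
    cross_form_gen[of "Inl a" "Inr b" "Inl i" "Inr j" t] cross_form_gen[of "Inl a" "Inr b" "Inr i" "Inr j" t]
  by auto

lemma cross_form_zz:
  assumes "a \<in> {1..n}" "b \<in> {1..n}" "a \<noteq> b"
  shows "\<lbrakk>i \<in> {1..n}; j \<in> {1..n}\<rbrakk> \<Longrightarrow>
      cross_form (Inl a) (Inl b) t (z i) (z j) = (if i = a \<and> j = b \<or> i = b \<and> j = a then t else 0)"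
    "\<lbrakk>i \<in> {1..n}; j \<in> {1..m}\<rbrakk> \<Longrightarrow> cross_form (Inl a) (Inl b) t (z i) (x j) = 0"
    "\<lbrakk>i \<in> {1..m}; j \<in> {1..m}\<rbrakk> \<Longrightarrow> cross_form (Inl a) (Inl b) t (x i) (x j) = 0"
  using assms cross_form_gen[of "Inl a" "Inl b" "Inl i" "Inl j" t]
    cross_form_gen[of "Inl a" "Inl b" "Inl i" "Inr j" t] cross_form_gen[of "Inl a" "Inl b" "Inr i" "Inr j" t]
  by auto

subsection \<open>Family A\<close>

lemma family_A_iff:
  "family_A n m z x mu \<longleftrightarrow> n = 0 \<and> m = 1 \<and> elt_order (x 1) > 4 \<and>
     (\<exists>c\<in>{0, invol (x 1)}. mu = square_form (Inr 1) c)" (is "_ \<longleftrightarrow> ?R")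
proof
  assume A: "family_A n m z x mu"
  then have n: "n = 0" "m = 1" and bil: "comm_bilinear mu" and c: "mu (x 1) (x 1) \<in> {0, invol (x 1)}"
    by (auto simp: family_A_def)
  have "comm_bilinear (square_form (Inr 1) (mu (x 1) (x 1)))"
    using c invol_x_double[of 1] n by (intro comm_bilinear_square_form) auto
  then have "mu = square_form (Inr 1) (mu (x 1) (x 1))"
    using n square_form_x[of 1 1 1] by (intro comm_bilinear_eq_on_gens[OF bil]) auto
  with A show ?R using c by (auto simp: family_A_def)
next
  assume R: ?R
  then obtain c where c: "c \<in> {0, invol (x 1)}" "mu = square_form (Inr 1) c" by blast
  have nm: "n = 0" "m = 1" "elt_order (x 1) > 4" using R by blast+
  have "comm_bilinear (square_form (Inr 1) c)"
    using c(1) nm invol_x_double[of 1] by (intro comm_bilinear_square_form) auto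
  then show "family_A n m z x mu"
    unfolding family_A_def c(2) using nm c(1) square_form_x[of 1 1 1 c] by auto
qed

text \<open>
  The parity of the \<open>x 1\<close>-coordinate is invariant because half the order of \<open>x 1\<close> annihilates all
  other generators.
\<close>

lemma single_top_square:
  assumes top: single_top and n: "n = 0" and c: "c \<in> {0, invol (x 1)}" "c \<noteq> 0 \<Longrightarrow> elt_order (x 1) > 4"
  shows "refinable {0, invol (x 1)} (square_form (Inr 1) c)" "invariant_form (square_form (Inr 1) c)"
proof -
  have m: "1 \<in> {1..m}" using single_top_ge_1[OF top] by simp
  have eight: "8 dvd ord (Inr 1)" if "c \<noteq> 0"
    using power_dvd_ord_x[OF m, of 3] ord_x_small_cases[OF m] c(2)[OF that] by auto
  show "refinable {0, invol (x 1)} (square_form (Inr 1) c)"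
  proof (rule refinable_square_form)
    show "elementary_subgroup {0, invol (x 1)}" using elementary_top m by simp
    show "4 dvd ord (Inr 1)" if "c \<noteq> 0" using eight[OF that] by (auto elim!: dvdE)
    show "4 dvd coord s (Inr 1)" if "c \<noteq> 0" "s \<in> {0, invol (x 1)}" for s
    proof -
      have "ord (Inr 1) div 2 dvd coord s (Inr 1)"
        using that(2) invol_x_double[OF m] m by (intro double_eq_0_imp_coord) auto
      moreover have "4 dvd ord (Inr 1) div 2" using eight[OF that(1)] by (auto elim!: dvdE)
      ultimately show ?thesis by (metis dvd_trans)
    qed
  qed (use m c in auto)
  show "invariant_form (square_form (Inr 1) c)"
  proof (rule invariant_square_form[where N = "ord (Inr 1) div 2"])
    show "ord l dvd ord (Inr 1) div 2" if l: "l \<in> {1..n} <+> {1..m}" "l \<noteq> Inr 1" for l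
    proof -
      obtain i where i: "l = Inr i" "i \<in> {2..m}" using l n by (cases l) force+
      then show ?thesis using ord_x_less_dvd[of 1 i] single_top_less[OF top i(2)] by auto
    qed
    show "even a" if "ord (Inr 1) dvd ord (Inr 1) div 2 * a" for a
      using that half_dvd_imp_even ord_x_nonzero[OF m] even_ord[of "Inr 1"] m by auto
  qed (use m top_invariant[OF top c(1)] in auto)
qed

subsection \<open>Family B\<close>

definition form_B :: "'a \<Rightarrow> 'a \<Rightarrow> 'a \<Rightarrow> 'a \<Rightarrow> 'a" where
  "form_B c d g h = square_form (Inr 1) c g h + cross_form (Inr 1) (Inr 2) d g h"

lemma form_B_gens:
  assumes "m \<ge> 2" "i \<in> {1..m}" "j \<in> {1..m}"
  shows "form_B c d (x i) (x j) =
    (if i = 1 \<and> j = 1 then c else if i = 1 \<and> j = 2 \<or> i = 2 \<and> j = 1 then d else 0)"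
  using assms square_form_x[of 1 i j] cross_form_xx[of 1 2 i j] by (auto simp: form_B_def)

lemma comm_bilinear_form_B:
  assumes "m \<ge> 2" "c + c = 0" "d + d = 0"
  shows "comm_bilinear (form_B c d)"
  unfolding form_B_def
  by (intro comm_bilinear_sum_two comm_bilinear_square_form comm_bilinear_cross_form) (use assms in auto)

lemma family_B_iff:
  "family_B n m z x mu \<longleftrightarrow> n = 0 \<and> m \<ge> 2 \<and> elt_order (x 1) > elt_order (x 2) \<and>
     (\<exists>c\<in>{c \<in> {0, invol (x 1)}. c \<noteq> 0 \<longrightarrow> elt_order (x 1) > 4}.
      \<exists>d\<in>{d \<in> {0, invol (x 1)}. d \<noteq> 0 \<longrightarrow> m > 2 \<longrightarrow> elt_order (x 2) > elt_order (x 3)}.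
        mu = form_B c d)" (is "_ \<longleftrightarrow> ?R")
proof
  assume B: "family_B n m z x mu"
  let ?c = "mu (x 1) (x 1)" and ?d = "mu (x 1) (x 2)"
  have m: "m \<ge> 2" and n: "n = 0" and bil: "comm_bilinear mu" and cd: "?c \<in> {0, invol (x 1)}" "?d \<in> {0, invol (x 1)}"
    using B by (auto simp: family_B_def)
  have bil': "comm_bilinear (form_B ?c ?d)"
    using m cd invol_x_double[of 1] by (intro comm_bilinear_form_B) auto
  have "mu = form_B ?c ?d"
  proof (rule comm_bilinear_eq_on_gens[OF bil bil'])
    fix i j assume ij: "i \<in> {1..m}" "j \<in> {1..m}" "i \<le> j"
    have sq: "\<And>i. i \<in> {2..m} \<Longrightarrow> mu (x i) (x i) = 0"
      and low: "\<And>i. i \<in> {3..m} \<Longrightarrow> mu (x 1) (x i) = 0" "\<And>i. i \<in> {3..m} \<Longrightarrow> mu (x 2) (x i) = 0"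
        "\<And>i j. i \<in> {3..m} \<Longrightarrow> j \<in> {3..m} \<Longrightarrow> mu (x i) (x j) = 0"
      using B unfolding family_B_def by blast+
    consider "i = 1" "j = 1" | "i = 1" "j = 2" | "i = 1" "j \<in> {3..m}" | "i = 2" "j = 2"
      | "i = 2" "j \<in> {3..m}" | "i \<in> {3..m}" "j \<in> {3..m}" using ij by force
    then show "mu (x i) (x j) = form_B ?c ?d (x i) (x j)"
      unfolding form_B_gens[OF m ij(1,2)] using sq low m by cases auto
  qed (use n in auto)
  then show ?R using B unfolding family_B_def by blast
next
  assume R: ?R
  then obtain c d where cd: "c \<in> {0, invol (x 1)}" "c \<noteq> 0 \<longrightarrow> elt_order (x 1) > 4"
    "d \<in> {0, invol (x 1)}" "d \<noteq> 0 \<longrightarrow> m > 2 \<longrightarrow> elt_order (x 2) > elt_order (x 3)"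
    "mu = form_B c d" and m: "m \<ge> 2" by blast
  have n: "n = 0" "elt_order (x 1) > elt_order (x 2)" using R by blast+
  have "comm_bilinear (form_B c d)"
    using m cd(1,3) invol_x_double[of 1] by (intro comm_bilinear_form_B) auto
  moreover have v: "form_B c d (x 1) (x 1) = c" "form_B c d (x 1) (x 2) = d"
    using m by (auto simp: form_B_gens)
  moreover have "\<And>i. i \<in> {2..m} \<Longrightarrow> form_B c d (x i) (x i) = 0"
    "\<And>i. i \<in> {3..m} \<Longrightarrow> form_B c d (x 1) (x i) = 0"
    "\<And>i. i \<in> {3..m} \<Longrightarrow> form_B c d (x 2) (x i) = 0"
    "\<And>i j. i \<in> {3..m} \<Longrightarrow> j \<in> {3..m} \<Longrightarrow> form_B c d (x i) (x j) = 0"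
    using m by (auto simp: form_B_gens)
  ultimately show "family_B n m z x mu"
    unfolding family_B_def cd(5) v using n m cd(1-4) by blast
qed

text \<open>
  For the mixed product, half the order of \<open>x 2\<close> serves as annihilator; it kills the generators
  after \<open>x 2\<close> exactly because their orders are strictly smaller. The refinement uses the subgroup
  \<open>{0, invol (x 1)}\<close> instead of all involutions, since for \<open>x 2\<close> of order two the product of the involution \<open>x 2\<close> with \<open>x 1\<close> need
  not vanish.
\<close>

lemma form_B_good:
  assumes n: "n = 0" and m: "m \<ge> 2" and lt: "elt_order (x 1) > elt_order (x 2)"
    and c: "c \<in> {0, invol (x 1)}" "c \<noteq> 0 \<Longrightarrow> elt_order (x 1) > 4"
    and d: "d \<in> {0, invol (x 1)}" "\<lbrakk>d \<noteq> 0; m > 2\<rbrakk> \<Longrightarrow> elt_order (x 2) > elt_order (x 3)"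
  shows "refinable {0, invol (x 1)} (form_B c d)" "invariant_form (form_B c d)"
proof -
  have top: single_top using m lt by (simp add: single_top_def)
  have mem: "1 \<in> {1..m}" "2 \<in> {1..m}" using m by auto
  have T: "elementary_subgroup {0, invol (x 1)}" using elementary_top m by simp
  have four: "4 dvd ord (Inr 1)"
    using power_dvd_ord_x[OF mem(1), of 2] ord_x_small_cases[OF mem(1)] ord_x_ge_2[OF mem(2)] lt by auto
  have "refinable {0, invol (x 1)} (cross_form (Inr 1) (Inr 2) d)"
  proof (rule refinable_cross_form[OF T d(1)])
    show "even (coord s (Inr 1)) \<and> even (coord s (Inr 2))" if "s \<in> {0, invol (x 1)}" for s
    proof -
      have "even (coord (invol (x 1)) (Inr i))" if "i \<in> {1,2}" for i
        using even_coord_zsmul[of "Inr i" "ord (Inr 1) div 2" "x 1"] even_coord_gen[of "Inr i" "Inr 1"] that mem four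
        by (auto simp: invol_x elim!: dvdE)
      then show ?thesis using that even_coord_zero[of "Inr 1"] even_coord_zero[of "Inr 2"] mem by auto
    qed
  qed (use mem in auto)
  then show "refinable {0, invol (x 1)} (form_B c d)"
    unfolding form_B_def
    by (intro refinable_add[OF T] single_top_square(1)[OF top n]) (use c in auto)
  have "invariant_form (cross_form (Inr 1) (Inr 2) d)"
  proof (rule invariant_cross_form[where N = "ord (Inr 2) div 2"])
    show "ord l dvd ord (Inr 2) div 2"
      if "d \<noteq> 0" "l \<in> {1..n} <+> {1..m}" "l \<noteq> Inr 1" "l \<noteq> Inr 2" for l
    proof -
      note l = that
      obtain i where i: "l = Inr i" "i \<in> {3..m}" using l n by (cases l) force+
      then have "elt_order (x i) < elt_order (x 2)"
        using d(2)[OF l(1)] ord_x_antimono[of 3 i] by force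
      then show ?thesis using ord_x_less_dvd[of 2 i] i m by auto
    qed
    show *: "even a" if "ord (Inr 2) dvd ord (Inr 2) div 2 * a" for a
      using that half_dvd_imp_even ord_x_nonzero[OF mem(2)] even_ord[of "Inr 2"] mem by auto
    show "even a" if "ord (Inr 1) dvd ord (Inr 2) div 2 * a" for a
      using * that ord_x_dvd[OF mem] dvd_trans by force
  qed (use mem top_invariant[OF top d(1)] in auto)
  then show "invariant_form (form_B c d)"
    unfolding form_B_def
    by (intro invariant_form_add single_top_square(2)[OF top n]) (use c in auto)
qed

subsection \<open>Family E\<close>

definition form_E :: "'a \<Rightarrow> 'a \<Rightarrow> 'a \<Rightarrow> 'a \<Rightarrow> 'a" where
  "form_E c d g h = square_form (Inl 1) c g h + cross_form (Inl 1) (Inr 1) d g h"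

lemma form_E_gens:
  assumes "n = 1" "m \<ge> 1"
  shows "form_E c d (z 1) (z 1) = c"
    "i \<in> {1..m} \<Longrightarrow> form_E c d (z 1) (x i) = (if i = 1 then d else 0)"
    "\<lbrakk>i \<in> {1..m}; j \<in> {1..m}\<rbrakk> \<Longrightarrow> form_E c d (x i) (x j) = 0"
proof -
  have mem: "1 \<in> {1..n}" "1 \<in> {1..m}" using assms by auto
  show "form_E c d (z 1) (z 1) = c"
    unfolding form_E_def square_form_z(1)[OF mem(1,1,1)] cross_form_zx(1)[OF mem mem(1,1)] by simp
  show "i \<in> {1..m} \<Longrightarrow> form_E c d (z 1) (x i) = (if i = 1 then d else 0)"
    unfolding form_E_def by (subst square_form_z(2)[OF mem(1,1)], simp, subst cross_form_zx(2)[OF mem mem(1)]) simp_all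
  show "\<lbrakk>i \<in> {1..m}; j \<in> {1..m}\<rbrakk> \<Longrightarrow> form_E c d (x i) (x j) = 0"
    unfolding form_E_def by (subst square_form_z(3)[OF mem(1)], simp_all only:, subst cross_form_zx(3)[OF mem]) simp_all
qed

lemma comm_bilinear_form_E:
  assumes "n = 1" "m \<ge> 1" "c + c = 0" "d + d = 0"
  shows "comm_bilinear (form_E c d)"
  unfolding form_E_def
  by (intro comm_bilinear_sum_two comm_bilinear_square_form comm_bilinear_cross_form) (use assms in auto)

lemma family_E_iff:
  "family_E n m z x mu \<longleftrightarrow> n = 1 \<and> single_top \<and>
     (\<exists>c\<in>{0, invol (x 1)}. \<exists>d\<in>{d \<in> {0, invol (x 1)}. d \<noteq> 0 \<longrightarrow> elt_order (x 1) \<ge> 4}.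
        mu = form_E c d)" (is "_ \<longleftrightarrow> ?R")
proof
  assume E: "family_E n m z x mu"
  let ?c = "mu (z 1) (z 1)" and ?d = "mu (z 1) (x 1)"
  have m: "m \<ge> 1" and n: "n = 1" and bil: "comm_bilinear mu" and cd: "?c \<in> {0, invol (x 1)}" "?d \<in> {0, invol (x 1)}"
    and top: single_top
    using E by (auto simp: family_E_def single_top_def)
  have bil': "comm_bilinear (form_E ?c ?d)"
    using m n cd invol_x_double[of 1] by (intro comm_bilinear_form_E) auto
  have low: "\<And>i. i \<in> {2..m} \<Longrightarrow> mu (z 1) (x i) = 0"
    "\<And>i j. i \<in> {1..m} \<Longrightarrow> j \<in> {1..m} \<Longrightarrow> mu (x i) (x j) = 0"
    using E unfolding family_E_def by blast+
  have "mu = form_E ?c ?d"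
  proof (rule comm_bilinear_eq_on_gens[OF bil bil'])
    fix i j assume ij: "i \<in> {1..n}" "j \<in> {1..m}"
    then show "mu (z i) (x j) = form_E ?c ?d (z i) (x j)"
      using n form_E_gens(2)[OF n m ij(2)] low(1)[of j] by (cases "j = 1") auto
  qed (use n form_E_gens[OF n m] low in auto)
  then show ?R using E top unfolding family_E_def by blast
next
  assume R: ?R
  then obtain c d where cd: "c \<in> {0, invol (x 1)}"
    "d \<in> {0, invol (x 1)}" "d \<noteq> 0 \<longrightarrow> elt_order (x 1) \<ge> 4"
    "mu = form_E c d" and n: "n = 1" and top: single_top by blast
  have m: "m \<ge> 1" using single_top_ge_1[OF top] .
  have "comm_bilinear (form_E c d)"
    using m n cd(1,2) invol_x_double[of 1] by (intro comm_bilinear_form_E) auto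
  moreover have v: "form_E c d (z 1) (z 1) = c" "form_E c d (z 1) (x 1) = d"
    using m form_E_gens[OF n m] by auto
  moreover have "\<And>i. i \<in> {2..m} \<Longrightarrow> form_E c d (z 1) (x i) = 0"
    "\<And>i j. i \<in> {1..m} \<Longrightarrow> j \<in> {1..m} \<Longrightarrow> form_E c d (x i) (x j) = 0"
    using m form_E_gens[OF n m] by auto
  moreover have "m = 1 \<or> m > 1 \<and> elt_order (x 1) > elt_order (x 2)"
    using top by (auto simp: single_top_def)
  ultimately show "family_E n m z x mu"
    unfolding family_E_def cd(4) v using n m cd(1-3) by blast
qed

lemma double_coord_z:
  assumes "w + w = 0" "i \<in> {1..n}"
  shows "coord w (Inl i) = 0"
  using double_eq_0_imp_coord[of "Inl i" w] assms ord_z(2)[OF assms(2)] by simp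

text \<open>
  The parity of the free coordinate is invariant because the order of \<open>x 1\<close> annihilates the torsion
  part; for the pair of coordinates of \<open>z 1\<close> and \<open>x 1\<close>, half of that order is used.
\<close>

lemma form_E_good:
  assumes n: "n = 1" and top: single_top
    and c: "c \<in> {0, invol (x 1)}"
    and d: "d \<in> {0, invol (x 1)}" "d \<noteq> 0 \<Longrightarrow> elt_order (x 1) \<ge> 4"
  shows "refinable {w. w + w = 0} (form_E c d)" "invariant_form (form_E c d)"
proof -
  have mem: "1 \<in> {1..m}" "1 \<in> {1..n}" using single_top_ge_1[OF top] n by auto
  note z = ord_z(2)[OF mem(2)]
  have "refinable {w. w + w = 0} (square_form (Inl 1) c)"
    by (rule refinable_square_form[OF elementary_all])
       (use mem z double_coord_z[OF _ mem(2)] top_invariant[OF top c] in auto)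
  moreover have "refinable {w. w + w = 0} (cross_form (Inl 1) (Inr 1) d)"
  proof (rule refinable_cross_form[OF elementary_all])
    show "even (coord s (Inl 1)) \<and> even (coord s (Inr 1))" if "d \<noteq> 0" "s \<in> {w. w + w = 0}" for s
    proof -
      have "4 dvd ord (Inr 1)" using power_dvd_ord_x[OF mem(1), of 2] d(2)[OF that(1)] by simp
      then have "even (ord (Inr 1) div 2)" by (auto elim!: dvdE)
      moreover have "ord (Inr 1) div 2 dvd coord s (Inr 1)" using double_eq_0_imp_coord[of "Inr 1" s] that mem by auto
      ultimately show ?thesis using double_coord_z[OF _ mem(2)] that dvd_trans by auto
    qed
  qed (use mem top_invariant[OF top d(1)] in auto)
  ultimately show "refinable {w. w + w = 0} (form_E c d)"
    unfolding form_E_def by (rule refinable_add[OF elementary_all])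
  have "invariant_form (square_form (Inl 1) c)"
  proof (rule invariant_square_form[where N = "ord (Inr 1)"])
    show "ord l dvd ord (Inr 1)" if "l \<in> {1..n} <+> {1..m}" "l \<noteq> Inl 1" for l
    proof -
      note l = that
      obtain i where i: "l = Inr i" "i \<in> {1..m}" using l n by (cases l) auto
      then show ?thesis using ord_x_dvd[OF mem(1), of i] by auto
    qed
    show "even a" if "ord (Inl 1) dvd ord (Inr 1) * a" for a
      using that z ord_x_nonzero[OF mem(1)] by simp
  qed (use mem top_invariant[OF top c(1)] in auto)
  moreover have "invariant_form (cross_form (Inl 1) (Inr 1) d)"
  proof (rule invariant_cross_form[where N = "ord (Inr 1) div 2"])
    show "ord l dvd ord (Inr 1) div 2" if "l \<in> {1..n} <+> {1..m}" "l \<noteq> Inl 1" "l \<noteq> Inr 1" for l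
    proof -
      note l = that
      obtain i where i: "l = Inr i" "i \<in> {2..m}" using l n by (cases l) force+
      then show ?thesis using ord_x_less_dvd[of 1 i] single_top_less[OF top i(2)] by auto
    qed
    show "even a" if "ord (Inr 1) dvd ord (Inr 1) div 2 * a" for a
      using that half_dvd_imp_even ord_x_nonzero[OF mem(1)] even_ord[of "Inr 1"] mem by auto
    show "even a" if "ord (Inl 1) dvd ord (Inr 1) div 2 * a" for a
      using that z ord_x_div_2_nonzero[OF mem(1)] by simp
  qed (use mem top_invariant[OF top d(1)] in auto)
  ultimately show "invariant_form (form_E c d)" unfolding form_E_def by (rule invariant_form_add)
qed

subsection \<open>Family F\<close>

lemma family_F_iff:
  "family_F n m z x mu \<longleftrightarrow> n = 2 \<and> single_top \<and>
     (\<exists>d\<in>{0, invol (x 1)}. mu = cross_form (Inl 1) (Inl 2) d)" (is "_ \<longleftrightarrow> ?R")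
proof
  assume F: "family_F n m z x mu"
  let ?d = "mu (z 1) (z 2)"
  have m: "m \<ge> 1" and n: "n = 2" and bil: "comm_bilinear mu" and d: "?d \<in> {0, invol (x 1)}"
    and top: single_top
    using F by (auto simp: family_F_def single_top_def)
  have bil': "comm_bilinear (cross_form (Inl 1) (Inl 2) ?d)"
    using m n d invol_x_double[of 1] by (intro comm_bilinear_cross_form) auto
  have zs: "mu (z 1) (z 1) = 0" "mu (z 2) (z 2) = 0"
    and low: "\<And>i j. i \<in> {1..n} \<Longrightarrow> j \<in> {1..m} \<Longrightarrow> mu (z i) (x j) = 0"
    "\<And>i j. i \<in> {1..m} \<Longrightarrow> j \<in> {1..m} \<Longrightarrow> mu (x i) (x j) = 0"
    using F n unfolding family_F_def by blast+
  have mem: "1 \<in> {1..n}" "2 \<in> {1..n}" "1 \<noteq> (2::nat)" using n by auto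
  have "mu = cross_form (Inl 1) (Inl 2) ?d"
  proof (rule comm_bilinear_eq_on_gens[OF bil bil'])
    fix i j assume ij: "i \<in> {1..n}" "j \<in> {1..n}" "i \<le> j"
    then consider "i = 1" "j = 1" | "i = 1" "j = 2" | "i = 2" "j = 2" using n by force
    then show "mu (z i) (z j) = cross_form (Inl 1) (Inl 2) ?d (z i) (z j)"
      unfolding cross_form_zz(1)[OF mem ij(1,2)] using zs by cases auto
  qed (use low cross_form_zz(2,3)[OF mem] in auto)
  then show ?R using n top d by blast
next
  assume R: ?R
  then obtain d where d: "d \<in> {0, invol (x 1)}" "mu = cross_form (Inl 1) (Inl 2) d"
    and n: "n = 2" and top: single_top by blast
  have m: "m \<ge> 1" using single_top_ge_1[OF top] .
  have mem: "1 \<in> {1..n}" "2 \<in> {1..n}" "1 \<noteq> (2::nat)" using n by auto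
  let ?f = "cross_form (Inl 1) (Inl 2) d"
  have "comm_bilinear ?f"
    using m n d(1) invol_x_double[of 1] by (intro comm_bilinear_cross_form) auto
  moreover have v: "?f (z 1) (z 1) = 0" "?f (z 2) (z 2) = 0" "?f (z 1) (z 2) = d"
    using cross_form_zz(1)[OF mem] mem by auto
  moreover have "m > 1 \<longrightarrow> elt_order (x 1) > elt_order (x 2)"
    using top by (auto simp: single_top_def)
  moreover have "\<And>i j. i \<in> {1..2} \<Longrightarrow> j \<in> {1..m} \<Longrightarrow> ?f (z i) (x j) = 0"
    "\<And>i j. i \<in> {1..m} \<Longrightarrow> j \<in> {1..m} \<Longrightarrow> ?f (x i) (x j) = 0"
    using cross_form_zz(2,3)[OF mem] n by auto
  ultimately show "family_F n m z x mu"
    unfolding family_F_def d(2) v using n m d(1) by blast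
qed

text \<open>
  The order of \<open>x 1\<close> annihilates all generators other than \<open>z 1\<close> and \<open>z 2\<close>, so the parities of
  the two free coordinates are jointly invariant.
\<close>

lemma form_F_good:
  assumes n: "n = 2" and top: single_top and d: "d \<in> {0, invol (x 1)}"
  shows "refinable {w. w + w = 0} (cross_form (Inl 1) (Inl 2) d)" "invariant_form (cross_form (Inl 1) (Inl 2) d)"
proof -
  have mem: "1 \<in> {1..n}" "2 \<in> {1..n}" "1 \<in> {1..m}" using n single_top_ge_1[OF top] by auto
  show "refinable {w. w + w = 0} (cross_form (Inl 1) (Inl 2) d)"
    by (rule refinable_cross_form[OF elementary_all])
       (use mem double_coord_z top_invariant[OF top d] in auto)
  show "invariant_form (cross_form (Inl 1) (Inl 2) d)"
  proof (rule invariant_cross_form[where N = "ord (Inr 1)"])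
    show "ord l dvd ord (Inr 1)" if "l \<in> {1..n} <+> {1..m}" "l \<noteq> Inl 1" "l \<noteq> Inl 2" for l
    proof -
      note l = that
      obtain i where i: "l = Inr i" "i \<in> {1..m}" using l n by (cases l) force+
      then show ?thesis using ord_x_dvd[OF mem(3), of i] by auto
    qed
    show "even a" if "ord (Inl 1) dvd ord (Inr 1) * a" for a
      using that ord_z(2)[OF mem(1)] ord_x_nonzero[OF mem(3)] by simp
    show "even a" if "ord (Inl 2) dvd ord (Inr 1) * a" for a
      using that ord_z(2)[OF mem(2)] ord_x_nonzero[OF mem(3)] by simp
  qed (use mem top_invariant[OF top d] in auto)
qed

subsection \<open>Family C\<close>

definition form_C :: "'a \<Rightarrow> 'a \<Rightarrow> 'a" where
  "form_C g h = square_form (Inr 1) (invol (x 1)) g h +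
     (square_form (Inr 2) (invol (x 2)) g h + cross_form (Inr 1) (Inr 2) (invol (x 1) + invol (x 2)) g h)"

lemma comm_bilinear_form_C:
  assumes "m \<ge> 2"
  shows "comm_bilinear form_C"
  unfolding form_C_def
  by (intro comm_bilinear_sum_two comm_bilinear_square_form comm_bilinear_cross_form)
     (use assms invol_x_double[of 1] invol_x_double[of 2] in \<open>auto simp: add_ac\<close>)

lemma form_C_gens:
  assumes m: "m \<ge> 2" and ij: "i \<in> {1..m}" "j \<in> {1..m}"
  shows "form_C (x i) (x j) =
    (if i = 1 \<and> j = 1 then invol (x 1) else if i = 2 \<and> j = 2 then invol (x 2)
     else if i = 1 \<and> j = 2 \<or> i = 2 \<and> j = 1 then invol (x 1) + invol (x 2) else 0)"
proof -
  have mem: "1 \<in> {1..m}" "2 \<in> {1..m}" "1 \<noteq> (2::nat)" using m by auto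
  show ?thesis
    unfolding form_C_def square_form_x[OF mem(1) ij] square_form_x[OF mem(2) ij] cross_form_xx[OF mem ij]
    by auto
qed

lemma family_C_form:
  assumes C: "family_C n m z x mu"
  shows "mu = form_C"
proof -
  have m: "m \<ge> 2" and n: "n = 0" and bil: "comm_bilinear mu" using C by (auto simp: family_C_def)
  show ?thesis
  proof (rule comm_bilinear_eq_on_gens[OF bil comm_bilinear_form_C[OF m]])
    fix i j assume ij: "i \<in> {1..m}" "j \<in> {1..m}" "i \<le> j"
    have v: "mu (x 1) (x 1) = invol (x 1)" "mu (x 2) (x 2) = invol (x 2)"
      "mu (x 1) (x 2) = invol (x 1) + invol (x 2)"
      and low: "\<And>i. i \<in> {3..m} \<Longrightarrow> mu (x 1) (x i) = 0" "\<And>i. i \<in> {3..m} \<Longrightarrow> mu (x 2) (x i) = 0"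
        "\<And>i j. i \<in> {3..m} \<Longrightarrow> j \<in> {3..m} \<Longrightarrow> mu (x i) (x j) = 0"
      using C unfolding family_C_def by blast+
    consider "i = 1" "j = 1" | "i = 1" "j = 2" | "i = 1" "j \<in> {3..m}" | "i = 2" "j = 2"
      | "i = 2" "j \<in> {3..m}" | "i \<in> {3..m}" "j \<in> {3..m}" using ij by force
    then show "mu (x i) (x j) = form_C (x i) (x j)"
      unfolding form_C_gens[OF m ij(1,2)] using v low m by cases auto
  qed (use n in auto)
qed

text \<open>
  Let \<open>E\<close> be half the common order of \<open>x 1\<close> and \<open>x 2\<close>. Multiplication by \<open>E\<close> maps \<open>G\<close> onto a
  plane over the field with two elements, and the form is a product on this plane: \<open>u u = u\<close>, and
  \<open>u v = u + v\<close> for distinct non-zero \<open>u\<close> and \<open>v\<close>. This rule is preserved by every injective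
  additive map.
\<close>

lemma form_C_invariant:
  assumes n: "n = 0" and m: "m \<ge> 2" and eq: "elt_order (x 1) = elt_order (x 2)"
    and lt: "m > 2 \<Longrightarrow> elt_order (x 2) > elt_order (x 3)"
  shows "invariant_form form_C"
proof -
  have mem: "1 \<in> {1..m}" "2 \<in> {1..m}" using m by auto
  let ?E = "ord (Inr 1) div 2" and ?t1 = "invol (x 1)" and ?t2 = "invol (x 2)"
  have t: "?t1 \<noteq> 0" "?t2 \<noteq> 0" "?t1 + ?t1 = 0" "?t2 + ?t2 = 0"
    using invol_x_nonzero invol_x_double mem by auto
  have ne: "?t1 \<noteq> ?t2" using involves_invol_x[of 1 1] involves_invol_x[of 1 2] mem by auto
  have ne': "?t1 + ?t2 \<noteq> 0" using ne t by (metis add_eq_0_iff)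
  have E2: "?t2 = ?E \<odot> x 2" using eq by (simp add: invol_x ord_x)
  define p where "p g i = (if odd (coord g (Inr i)) then invol (x i) else 0)" for g i
  have "(\<lambda>g. ?E \<odot> g) = (\<lambda>g. p g 1 + p g 2)"
  proof (rule additive_eqI[OF additive_zsmul_right])
    have "additive (\<lambda>g. p g i)" if "i \<in> {1..m}" for i
      using that invol_x_double[OF that] even_coord_add[of "Inr i"] by (auto simp: additive_def p_def)
    then show "additive (\<lambda>g. p g 1 + p g 2)" using mem by (simp add: additive_def algebra_simps)
    fix i assume "i \<in> {1..n} <+> {1..m}"
    then obtain k where k: "i = Inr k" "k \<in> {1..m}" using n by auto
    have odd: "odd (coord (x k) (Inr j)) \<longleftrightarrow> j = k" if "j \<in> {1..m}" for j
      using even_coord_gen[of "Inr j" "Inr k"] that k by auto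
    consider "k = 1" | "k = 2" | "k \<in> {3..m}" using k by force
    then show "?E \<odot> case_sum z x i = p (case_sum z x i) 1 + p (case_sum z x i) 2"
    proof cases
      case 3
      then have "elt_order (x k) < elt_order (x 1)" using lt eq ord_x_antimono[of 3 k] by force
      then have "ord (Inr k) dvd ?E" using ord_x_less_dvd[OF mem(1) k(2)] by simp
      then have "?E \<odot> x k = 0" using zsmul_gen_eq_0_iff[of ?E "Inr k"] by simp
      then show ?thesis unfolding p_def k(1) sum.case odd[OF mem(1)] odd[OF mem(2)] using 3 by auto
    qed (unfold p_def k(1) sum.case odd[OF mem(1)] odd[OF mem(2)], use E2 invol_x in auto)
  qed
  then have s: "?E \<odot> g = p g 1 + p g 2" for g by (rule fun_cong)
  define mult where "mult u v = (if u = v then u else if u = 0 \<or> v = 0 then 0 else u + v)" for u v :: 'a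
  have form: "form_C g h = mult (?E \<odot> g) (?E \<odot> h)" for g h
    unfolding s form_C_def p_def mult_def square_form_def cross_form_def
    by (cases "odd (coord g (Inr 1))"; cases "odd (coord g (Inr 2))"; cases "odd (coord h (Inr 1))"; cases "odd (coord h (Inr 2))")
       (use t ne ne' in \<open>simp_all add: add_ac add.left_commute[of ?t2 ?t1] flip: add.assoc\<close>)
  have "\<alpha> (form_C g h) = form_C (\<alpha> g) (\<alpha> h)" if \<alpha>: "group_isom \<alpha>" for \<alpha> g h
  proof -
    have add: "additive \<alpha>" and inj: "inj \<alpha>" using \<alpha> by (auto simp: group_isom_def bij_is_inj)
    have "\<alpha> u = 0 \<longleftrightarrow> u = 0" for u using inj additive.zero[OF add] by (metis injD)
    then have "\<alpha> (mult u v) = mult (\<alpha> u) (\<alpha> v)" for u v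
      using inj by (auto simp: mult_def additive.add[OF add] additive.zero[OF add] inj_eq)
    then show ?thesis by (simp add: form additive_zsmul[OF add])
  qed
  then show ?thesis using comm_bilinear_form_C[OF m] by (simp add: invariant_form_def)
qed

lemma form_C_refinable:
  assumes m: "m \<ge> 2" and eq: "elt_order (x 1) = elt_order (x 2)" "elt_order (x 2) > 4"
  shows "refinable {w. w + w = 0} form_C"
proof -
  have mem: "1 \<in> {1..m}" "2 \<in> {1..m}" using m by auto
  have eight: "8 dvd ord (Inr i)" if "i \<in> {1,2}" for i
    using power_dvd_ord_x[of i 3] ord_x_small_cases[of i] eq mem that by auto
  have four: "4 dvd coord s (Inr i)" if "i \<in> {1,2}" "s + s = 0" for s i
  proof -
    have "ord (Inr i) div 2 dvd coord s (Inr i)" using that mem by (intro double_eq_0_imp_coord) auto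
    moreover have "4 dvd ord (Inr i) div 2" using eight[OF that(1)] by (auto elim!: dvdE)
    ultimately show ?thesis by (metis dvd_trans)
  qed
  have ev: "even (coord s (Inr i))" if "i \<in> {1,2}" "s + s = 0" for s i
    using four[OF that] by (auto elim!: dvdE)
  have four_ord: "4 dvd ord (Inr i)" if "i \<in> {1,2}" for i using eight[OF that] by (auto elim!: dvdE)
  have t: "invol (x 1) + invol (x 1) = 0" "invol (x 2) + invol (x 2) = 0"
    using invol_x_double mem by auto
  show ?thesis
    unfolding form_C_def
    by (intro refinable_add[OF elementary_all] refinable_square_form[OF elementary_all]
          refinable_cross_form[OF elementary_all])
       (use mem four ev four_ord t in \<open>auto simp: add_ac\<close>)
qed

subsection \<open>Family D\<close>

definition z_coord :: "'a \<Rightarrow> int" where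
  "z_coord g = coord g (Inl 1)"

text \<open>
  The family prescribes \<open>z 1 x = half x\<close> for the generators \<open>x\<close>, where \<open>half\<close> is half of the order
  of \<open>x 1\<close>, whatever the number \<open>k\<close> of factors of largest order is. This formula expresses the form
  through the free coordinate only: the difference in parentheses is a torsion element, so signs
  do not matter after multiplication by \<open>half\<close>.
\<close>

definition form_D :: "'a \<Rightarrow> 'a \<Rightarrow> 'a" where
  "form_D g h = (ord (Inr 1) div 2) \<odot> (z_coord h \<odot> g - z_coord g \<odot> h)"

context
  assumes n: "n = 1" and m: "m \<ge> 1"
begin

lemma mem_1: "1 \<in> {1..n}" "1 \<in> {1..m}"
  using n m by auto

lemma z_coord_add: "z_coord (g + h) = z_coord g + z_coord h"
  unfolding z_coord_def using coord_add[of "Inl 1" g h] ord_z(2)[OF mem_1(1)] mem_1 by simp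

lemma z_coord_additive: "additive (\<lambda>g. z_coord g)"
  using z_coord_add by (simp add: additive_def)

lemma z_coord_zsmul: "z_coord (k \<odot> g) = k * z_coord g"
  unfolding z_coord_def using coord_zsmul[of "Inl 1" k g] ord_z(2)[OF mem_1(1)] mem_1 by simp

lemma z_coord_gens: "z_coord (z 1) = 1" "i \<in> {1..m} \<Longrightarrow> z_coord (x i) = 0"
  unfolding z_coord_def using coord_gen[of "Inl 1" "Inl 1"] coord_gen[of "Inl 1" "Inr i"] ord_z(2)[OF mem_1(1)] mem_1 by auto

lemma torsion_iff: "ord (Inr 1) \<odot> u = 0 \<longleftrightarrow> z_coord u = 0"
proof -
  have "(\<forall>i\<in>{1..n} <+> {1..m}. ord i dvd ord (Inr 1) * coord u i) \<longleftrightarrow> z_coord u = 0"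
  proof
    assume "\<forall>i\<in>{1..n} <+> {1..m}. ord i dvd ord (Inr 1) * coord u i"
    then have "ord (Inl 1) dvd ord (Inr 1) * z_coord u" unfolding z_coord_def using mem_1 by blast
    then show "z_coord u = 0" using ord_z(2)[OF mem_1(1)] ord_x_nonzero[OF mem_1(2)] by simp
  next
    assume u: "z_coord u = 0"
    show "\<forall>i\<in>{1..n} <+> {1..m}. ord i dvd ord (Inr 1) * coord u i"
    proof
      fix i assume "i \<in> {1..n} <+> {1..m}"
      then consider "i = Inl 1" | k where "i = Inr k" "k \<in> {1..m}" using n by auto
      then show "ord i dvd ord (Inr 1) * coord u i"
        using u ord_x_dvd[OF mem_1(2)] unfolding z_coord_def by cases auto
    qed
  qed
  then show ?thesis by (simp add: zsmul_eq_0_iff_coord)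
qed

abbreviation half :: int where "half \<equiv> ord (Inr 1) div 2"

lemma half_double: "half + half = ord (Inr 1)"
  using even_ord[of "Inr 1"] mem_1 by (auto elim!: evenE)

lemma half_torsion: "z_coord u = 0 \<Longrightarrow> half \<odot> u + half \<odot> u = 0"
  using torsion_iff[of u] half_double by (metis zsmul_distrib_left)

lemma form_D_double: "form_D g h + form_D g h = 0"
  unfolding form_D_def
  by (rule half_torsion) (simp add: additive.diff[OF z_coord_additive] z_coord_zsmul)

lemma comm_bilinear_form_D: "comm_bilinear form_D"
proof -
  have "form_D g h = form_D h g" for g h
  proof -
    have "form_D g h = - form_D h g" by (simp add: form_D_def zmod.scale_right_diff_distrib)
    then show ?thesis using form_D_double[of h g] by (metis minus_unique)
  qed
  moreover have "additive (form_D g)" for g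
    by (simp add: additive_def form_D_def z_coord_add algebra_simps)
  ultimately show ?thesis by (simp add: comm_bilinear_def)
qed

lemma family_D_form:
  assumes D: "family_D_with k n m z x mu"
  shows "mu = form_D"
proof -
  have bil: "comm_bilinear mu" and k: "1 \<le> k" "k \<le> m" and zz: "mu (z 1) (z 1) = 0"
    and top: "\<And>i. i \<in> {1..k} \<Longrightarrow> mu (z 1) (x i) = invol (x i)"
    and low: "\<And>i. i \<in> {k<..m} \<Longrightarrow> mu (z 1) (x i) = 0"
    and xx: "\<And>i j. i \<in> {1..m} \<Longrightarrow> j \<in> {1..m} \<Longrightarrow> mu (x i) (x j) = 0"
    and o: "\<And>i. i \<in> {1..k} \<Longrightarrow> elt_order (x i) = elt_order (x 1)"
    and less: "k < m \<Longrightarrow> elt_order (x k) > elt_order (x (k + 1))"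
    using D unfolding family_D_with_def by blast+
  show ?thesis
  proof (rule comm_bilinear_eq_on_gens[OF bil comm_bilinear_form_D])
    fix i j assume "i \<in> {1..n}" "j \<in> {1..n}" "i \<le> j"
    then have "i = 1" "j = 1" using n by auto
    then show "mu (z i) (z j) = form_D (z i) (z j)" using zz by (simp add: form_D_def)
  next
    fix i j assume ij: "i \<in> {1..n}" "j \<in> {1..m}"
    then have i: "i = 1" using n by auto
    have "form_D (z 1) (x j) = - (half \<odot> x j)"
      unfolding form_D_def z_coord_gens(1) z_coord_gens(2)[OF ij(2)] by simp
    also have "\<dots> = half \<odot> x j"
      using half_torsion[OF z_coord_gens(2)[OF ij(2)]] by (rule minus_unique)
    also have "\<dots> = mu (z 1) (x j)"
    proof (cases "j \<le> k")
      case True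
      then have "elt_order (x j) = elt_order (x 1)" using o[of j] ij(2) by auto
      then have "half \<odot> x j = invol (x j)" by (simp add: invol_x ord_x)
      then show ?thesis using top[of j] True ij(2) by auto
    next
      case False
      then have "elt_order (x j) \<le> elt_order (x (k + 1))" "elt_order (x k) = elt_order (x 1)"
        using ord_x_antimono[of "k + 1" j] o[of k] k ij(2) by auto
      then have "elt_order (x j) < elt_order (x 1)" using less False ij(2) by auto
      then have "ord (Inr j) dvd half" using ord_x_less_dvd[OF mem_1(2) ij(2)] by simp
      then have "half \<odot> x j = 0" using zsmul_gen_eq_0_iff[of half "Inr j"] by simp
      then show ?thesis using low[of j] False ij(2) by auto
    qed
    finally show "mu (z i) (x j) = form_D (z i) (x j)" using i by simp
  next
    fix i j assume ij: "i \<in> {1..m}" "j \<in> {1..m}" "i \<le> j"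
    show "mu (x i) (x j) = form_D (x i) (x j)"
      unfolding form_D_def z_coord_gens(2)[OF ij(1)] z_coord_gens(2)[OF ij(2)] using xx ij by simp
  qed
qed

text \<open>
  An automorphism preserves the torsion subgroup, and so acts on the quotient, which is infinite
  cyclic, by a sign. It changes the free coordinates by this sign, and the values have order at
  most two.
\<close>

lemma form_D_invariant: "invariant_form form_D"
proof -
  have "\<alpha> (form_D g h) = form_D (\<alpha> g) (\<alpha> h)" if \<alpha>: "group_isom \<alpha>" for \<alpha> g h
  proof -
    have mult: "z_coord (\<beta> g) = z_coord g * z_coord (\<beta> (z 1))"
      if \<beta>: "additive \<beta>" for \<beta> :: "'a \<Rightarrow> 'a" and g
    proof -
      let ?u = "g - z_coord g \<odot> z 1"
      have "z_coord ?u = 0"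
        unfolding additive.diff[OF z_coord_additive] z_coord_zsmul z_coord_gens(1) by simp
      then have "ord (Inr 1) \<odot> \<beta> ?u = 0"
        using torsion_iff[of ?u] by (metis additive_zsmul[OF \<beta>] additive.zero[OF \<beta>])
      then have "z_coord (\<beta> ?u) = 0" using torsion_iff by blast
      then show ?thesis
        unfolding additive.diff[OF \<beta>] additive.diff[OF z_coord_additive] additive_zsmul[OF \<beta>] z_coord_zsmul
        by simp
    qed
    have add: "additive \<alpha>" and bij: "bij \<alpha>" using \<alpha> by (auto simp: group_isom_def)
    \<comment> \<open>Applying the automorphism to a preimage of \<open>z 1\<close> shows that this factor is a unit of the integers.\<close>
    define \<epsilon> where "\<epsilon> = z_coord (\<alpha> (z 1))"
    have "1 = z_coord (inv \<alpha> (z 1)) * \<epsilon>"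
      using mult[OF add, of "inv \<alpha> (z 1)"] bij
      by (simp add: \<epsilon>_def z_coord_gens(1)[simplified] bij_is_surj surj_f_inv_f)
    then have \<epsilon>: "\<epsilon> = 1 \<or> \<epsilon> = -1" by (metis zmult_eq_1_iff mult.commute)
    have "form_D (\<alpha> g) (\<alpha> h) = \<epsilon> \<odot> \<alpha> (form_D g h)"
      unfolding form_D_def additive_zsmul[OF add] additive.diff[OF add] mult[OF add, of g]
        mult[OF add, of h] \<epsilon>_def[symmetric]
      by (simp add: zmod.scale_right_diff_distrib mult_ac)
    moreover have "\<alpha> (form_D g h) + \<alpha> (form_D g h) = 0"
      using form_D_double[of g h] by (metis additive.add[OF add] additive.zero[OF add])
    ultimately show ?thesis using \<epsilon> by (auto dest: minus_unique)
  qed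
  then show ?thesis using comm_bilinear_form_D by (simp add: invariant_form_def)
qed

text \<open>
  The refinement multiplies the free coordinate of \<open>g\<close> with \<open>half\<close> times the torsion component
  \<open>g - z_coord g z 1\<close>, in analogy with the product of two coordinates.
\<close>

lemma form_D_refinable:
  assumes four: "elt_order (x 1) \<ge> 4"
  shows "refinable {w. w + w = 0} form_D"
proof -
  let ?p = "\<lambda>g. z_coord g" and ?r = "\<lambda>g. g - z_coord g \<odot> z 1"
  define q where "q g = (half * ?p g) \<odot> ?r g" for g
  have r: "?p (?r g) = 0" for g
    unfolding additive.diff[OF z_coord_additive] z_coord_zsmul z_coord_gens(1) by simp
  have dbl: "half \<odot> ?r g + half \<odot> ?r g = 0" for g by (rule half_torsion[OF r])
  have q': "q g = ?p g \<odot> (half \<odot> ?r g)" for g by (simp add: q_def mult.commute)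
  have qdbl: "q g + q g = 0" for g
    unfolding q' using dbl[of g] by (metis zsmul_distrib_right zmod.scale_zero_right)
  have q0: "q t = 0" if "t + t = 0" for t
    using double_coord_z[OF that mem_1(1), folded z_coord_def] by (simp add: q_def)
  have expand: "(a + b) \<odot> (u + v) = a \<odot> u + b \<odot> v + (b \<odot> u + a \<odot> v)" for a b and u v :: 'a
    by (simp add: zsmul_distrib_left zsmul_distrib_right add_ac)
  have radd: "?r (g + h) = ?r g + ?r h" for g h by (simp add: z_coord_add zsmul_distrib_left)
  have "q (g + h) = q g + q h + form_D g h" for g h
  proof -
    have "q (g + h) = (?p g + ?p h) \<odot> (half \<odot> ?r g + half \<odot> ?r h)"
      unfolding q' unfolding radd unfolding z_coord_add zsmul_distrib_right ..
    also have "\<dots> = q g + q h + (?p h \<odot> (half \<odot> ?r g) + ?p g \<odot> (half \<odot> ?r h))"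
      unfolding q' by (rule expand)
    \<comment> \<open>The sign may be changed because \<open>half\<close> times a torsion element has order at most two.\<close>
    also have "?p g \<odot> (half \<odot> ?r h) = ?p g \<odot> - (half \<odot> ?r h)"
      by (subst minus_unique[OF dbl[of h]]) (rule refl)
    also have "?p h \<odot> (half \<odot> ?r g) + ?p g \<odot> - (half \<odot> ?r h) = form_D g h"
      unfolding form_D_def by (simp add: zmod.scale_right_diff_distrib mult_ac)
    finally show ?thesis .
  qed
  moreover have "form_D t h = 0" if "t + t = 0" for t h
  proof -
    have "4 dvd ord (Inr 1)" using power_dvd_ord_x[OF mem_1(2), of 2] four by simp
    then have "even half" by (auto elim!: dvdE)
    then show ?thesis
      using double_coord_z[OF that mem_1(1), folded z_coord_def] double_zsmul[OF that] by (simp add: form_D_def)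
  qed
  ultimately show ?thesis
    unfolding refinable_def
    by (intro conjI exI[of _ q]) (auto simp: comm_bilinear_form_D form_D_double qdbl q0)
qed

end

subsection \<open>All families\<close>

lemma family_D_with_facts:
  assumes "family_D_with k n m z x mu"
  shows "n = 1" "m \<ge> 1" "elt_order (x 1) \<ge> 4"
  using assms unfolding family_D_with_def by blast+

lemma in_family_invariant:
  assumes "in_family X n m z x mu"
  shows "invariant_form mu \<and> (\<exists>T. elementary_subgroup T \<and> refinable T mu)"
proof (cases X)
  case Fam_A
  then have "family_A n m z x mu" using assms by simp
  then obtain c where c: "c \<in> {0, invol (x 1)}" "mu = square_form (Inr 1) c"
    and A: "n = 0" "m = 1" "elt_order (x 1) > 4"
    unfolding family_A_iff by blast
  have "single_top" "m \<ge> 1" using A unfolding single_top_def by simp_all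
  then show ?thesis using single_top_square[OF _ A(1) c(1) A(3)] elementary_top c(2) by blast
next
  case Fam_B
  then have "family_B n m z x mu" using assms by simp
  then obtain c d where B: "n = 0" "m \<ge> 2" "elt_order (x 1) > elt_order (x 2)"
    and c: "c \<in> {0, invol (x 1)}" "c \<noteq> 0 \<Longrightarrow> elt_order (x 1) > 4"
    and d: "d \<in> {0, invol (x 1)}" "\<lbrakk>d \<noteq> 0; m > 2\<rbrakk> \<Longrightarrow> elt_order (x 2) > elt_order (x 3)"
    and mu: "mu = form_B c d"
    unfolding family_B_iff by blast
  have "m \<ge> 1" using B by simp
  then show ?thesis using form_B_good[OF B c d] elementary_top mu by blast
next
  case Fam_C
  then have C: "family_C n m z x mu" using assms by simp
  then have "n = 0" "m \<ge> 2" "elt_order (x 1) = elt_order (x 2)" "elt_order (x 2) > 4"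
    "m > 2 \<Longrightarrow> elt_order (x 2) > elt_order (x 3)"
    by (auto simp: family_C_def)
  then show ?thesis
    using form_C_invariant form_C_refinable elementary_all family_C_form[OF C] by blast
next
  case Fam_D
  then obtain k where D: "family_D_with k n m z x mu" using assms by (auto simp: family_D_def)
  note f = family_D_with_facts[OF D]
  show ?thesis
    using form_D_invariant[OF f(1,2)] form_D_refinable[OF f] elementary_all family_D_form[OF f(1,2) D]
    by blast
next
  case Fam_E
  then have "family_E n m z x mu" using assms by simp
  then obtain c d where E: "n = 1" single_top "c \<in> {0, invol (x 1)}"
    and d: "d \<in> {0, invol (x 1)}" "d \<noteq> 0 \<Longrightarrow> elt_order (x 1) \<ge> 4" and mu: "mu = form_E c d"
    unfolding family_E_iff by blast
  then show ?thesis using form_E_good[OF E d] elementary_all by blast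
next
  case Fam_F
  then have "family_F n m z x mu" using assms by simp
  then obtain d where F: "n = 2" single_top "d \<in> {0, invol (x 1)}"
    and mu: "mu = cross_form (Inl 1) (Inl 2) d"
    unfolding family_F_iff by blast
  then show ?thesis using form_F_good[OF F] elementary_all by blast
qed

lemma good_ring_iff_in_family:
  "good_ring mu \<longleftrightarrow> mu \<noteq> trivial_mult \<and> (\<exists>X. in_family X n m z x mu)"
proof
  assume "good_ring mu"
  then show "mu \<noteq> trivial_mult \<and> (\<exists>X. in_family X n m z x mu)"
    using good_ring_in_family by (simp add: good_ring_def)
next
  assume "mu \<noteq> trivial_mult \<and> (\<exists>X. in_family X n m z x mu)"
  then show "good_ring mu" using in_family_invariant good_ringI by blast
qed

text \<open>
  An isomorphism between two multiplications on the same group is an automorphism of \<open>(G,+)\<close>, and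
  both multiplications are invariant under it.
\<close>

lemma family_ring_isom_eq:
  assumes "mu \<in> family_rings X n m z x" "nu \<in> family_rings X n m z x" "ring_isom mu nu \<phi>"
  shows "mu = nu"
proof -
  have "invariant_form trivial_mult"
    by (auto simp: invariant_form_def trivial_mult_def comm_bilinear_def group_isom_def additive_def
        additive.zero)
  then have inv: "invariant_form nu"
    using assms(2) in_family_invariant by (auto simp: family_rings_def)
  have \<phi>: "group_isom \<phi>" and hom: "\<And>g h. \<phi> (mu g h) = nu (\<phi> g) (\<phi> h)"
    using assms(3) by (auto simp: ring_isom_def)
  have "\<phi> (mu g h) = \<phi> (nu g h)" for g h using hom inv \<phi> by (simp add: invariant_form_def)
  then have "mu g h = nu g h" for g h using \<phi> by (metis group_isom_def bij_is_inj injD)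
  then show ?thesis by blast
qed

lemma card_product_2_4:
  fixes t :: 'a
  assumes "C \<in> {{0}, {0, t}}" "D \<in> {{0}, {0, t}}" "inj_on f (C \<times> D)" "u \<in> f ` (C \<times> D)" "u \<noteq> f (0, 0)"
  shows "card (f ` (C \<times> D)) \<in> {2, 4}"
proof -
  have "card (f ` (C \<times> D)) = card C * card D" using assms(3) by (simp add: card_image card_cartesian_product)
  moreover have "\<not> (C = {0} \<and> D = {0})" using assms(4,5) by auto
  ultimately show ?thesis using assms(1,2) by (cases "t = 0") (use assms(4,5) in auto)
qed

lemma trivial_forms:
  "square_form i 0 = trivial_mult" "cross_form i j 0 = trivial_mult"
  "form_B 0 0 = trivial_mult" "form_E 0 0 = trivial_mult"
proof -
  show *: "square_form i 0 = trivial_mult" "cross_form i j 0 = trivial_mult" for i j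
    unfolding fun_eq_iff trivial_mult_def square_form_def cross_form_def by simp_all
  show "form_B 0 0 = trivial_mult" "form_E 0 0 = trivial_mult"
    unfolding form_B_def form_E_def * by (simp_all add: fun_eq_iff trivial_mult_def)
qed

text \<open>
  In families B and E the two parameters \<open>c\<close> and \<open>d\<close> range independently over \<open>{0}\<close> or over
  \<open>{0, invol (x 1)}\<close>, depending on the orders of the first three generators, and a non-trivial
  ring excludes the case of a single pair. In the other families the multiplication has at most
  one non-zero choice.
\<close>

lemma family_card:
  assumes "occurs_in X n m z x"
  shows "X \<in> {Fam_B, Fam_E} \<Longrightarrow> card (family_rings X n m z x) \<in> {2, 4}"
    and "X \<notin> {Fam_B, Fam_E} \<Longrightarrow> card (family_rings X n m z x) = 2"
    and "X \<in> {Fam_A, Fam_B, Fam_E, Fam_F} \<Longrightarrow> in_family X n m z x trivial_mult"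
proof -
  obtain mu where mu: "mu \<noteq> trivial_mult" "in_family X n m z x mu"
    using assms by (auto simp: occurs_in_def)
  have two: "card (family_rings X n m z x) = 2" if "\<And>nu. in_family X n m z x nu \<Longrightarrow> nu \<in> {trivial_mult, mu}"
  proof -
    have "family_rings X n m z x = {trivial_mult, mu}"
      using that mu(2) unfolding family_rings_def by blast
    then show ?thesis using mu(1) by simp
  qed
  show triv: "in_family X n m z x trivial_mult" if "X \<in> {Fam_A, Fam_B, Fam_E, Fam_F}"
  proof -
    note X = that
    consider "X = Fam_A" | "X = Fam_B" | "X = Fam_E" | "X = Fam_F" using X by blast
    then show ?thesis
    proof cases
      case 1
      then have "family_A n m z x mu" using mu(2) by simp
      then have "family_A n m z x (square_form (Inr 1) 0)" unfolding family_A_iff by blast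
      then show ?thesis using 1 trivial_forms by simp
    next
      case 2
      then have "family_B n m z x mu" using mu(2) by simp
      then have "family_B n m z x (form_B 0 0)" unfolding family_B_iff by blast
      then show ?thesis using 2 trivial_forms by simp
    next
      case 3
      then have "family_E n m z x mu" using mu(2) by simp
      then have "family_E n m z x (form_E 0 0)" unfolding family_E_iff by blast
      then show ?thesis using 3 trivial_forms by simp
    next
      case 4
      then have "family_F n m z x mu" using mu(2) by simp
      then have "family_F n m z x (cross_form (Inl 1) (Inl 2) 0)" unfolding family_F_iff by blast
      then show ?thesis using 4 trivial_forms by simp
    qed
  qed
  show "card (family_rings X n m z x) = 2" if X: "X \<notin> {Fam_B, Fam_E}"
  proof (rule two)
    fix nu assume nu: "in_family X n m z x nu"
    show "nu \<in> {trivial_mult, mu}"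
    proof (cases X)
      case Fam_A
      then have "family_A n m z x mu" "family_A n m z x nu" using mu nu by auto
      then show ?thesis unfolding family_A_iff using mu(1) trivial_forms by auto
    next
      case Fam_C
      then have "family_C n m z x mu" "family_C n m z x nu" using mu nu by auto
      then show ?thesis using family_C_form by blast
    next
      case Fam_D
      then obtain k l where D: "family_D_with k n m z x mu" "family_D_with l n m z x nu"
        using mu nu by (auto simp: family_D_def)
      then show ?thesis
        using family_D_form[OF family_D_with_facts(1,2)[OF D(1)]] by blast
    next
      case Fam_F
      then have "family_F n m z x mu" "family_F n m z x nu" using mu nu by auto
      then show ?thesis unfolding family_F_iff using mu(1) trivial_forms by auto
    qed (use X in auto)
  qed
  show "card (family_rings X n m z x) \<in> {2, 4}" if "X \<in> {Fam_B, Fam_E}"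
  proof -
    have rings: "family_rings X n m z x = {nu. in_family X n m z x nu}"
      using triv that unfolding family_rings_def by blast
    have img: "{nu. \<exists>c\<in>C. \<exists>d\<in>D. nu = f c d} = case_prod f ` (C \<times> D)"
      for C D :: "'a set" and f :: "'a \<Rightarrow> 'a \<Rightarrow> 'a \<Rightarrow> 'a \<Rightarrow> 'a"
      by auto
    have sub: "{c \<in> {0, t}. c \<noteq> 0 \<longrightarrow> P} \<in> {{0}, {0, t}}" for t :: 'a and P by (cases P) auto
    show ?thesis
    proof (cases "X = Fam_B")
      case True
      let ?C = "{c \<in> {0, invol (x 1)}. c \<noteq> 0 \<longrightarrow> elt_order (x 1) > 4}"
      let ?D = "{d \<in> {0, invol (x 1)}. d \<noteq> 0 \<longrightarrow> m > 2 \<longrightarrow> elt_order (x 2) > elt_order (x 3)}"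
      have B: "family_B n m z x mu" using True mu by simp
      then have m: "m \<ge> 2" by (simp add: family_B_def)
      have "family_B n m z x nu \<longleftrightarrow> (\<exists>c\<in>?C. \<exists>d\<in>?D. nu = form_B c d)" for nu
        using B unfolding family_B_iff by blast
      then have *: "{nu. in_family X n m z x nu} = case_prod form_B ` (?C \<times> ?D)" (is "_ = ?img")
        unfolding True in_family.simps by (simp only: img)
      have mem: "1 \<in> {1..m}" "2 \<in> {1..m}" using m by auto
      have "inj_on (case_prod form_B) (?C \<times> ?D)"
      proof (rule inj_onI, clarify)
        fix c d c' d' assume eq: "form_B c d = form_B c' d'"
        show "c = c' \<and> d = d'"
          using fun_cong[OF fun_cong[OF eq, of "x 1"], of "x 1"] fun_cong[OF fun_cong[OF eq, of "x 1"], of "x 2"]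
          unfolding form_B_gens[OF m mem(1,1)] form_B_gens[OF m mem] by auto
      qed
      moreover have "mu \<in> ?img" unfolding *[symmetric] using mu(2) by simp
      moreover have "mu \<noteq> case_prod form_B (0, 0)" using mu trivial_forms by simp
      ultimately have "card ?img \<in> {2, 4}" by (rule card_product_2_4[OF sub sub])
      then show ?thesis using rings * by simp
    next
      case False
      then have X: "X = Fam_E" using that by blast
      let ?D = "{d \<in> {0, invol (x 1)}. d \<noteq> 0 \<longrightarrow> elt_order (x 1) \<ge> 4}"
      have E: "family_E n m z x mu" using X mu by simp
      then have m: "m \<ge> 1" and n: "n = 1" by (auto simp: family_E_def)
      have "family_E n m z x nu \<longleftrightarrow> (\<exists>c\<in>{0, invol (x 1)}. \<exists>d\<in>?D. nu = form_E c d)" for nu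
        using E unfolding family_E_iff by blast
      then have *: "{nu. in_family X n m z x nu} = case_prod form_E ` ({0, invol (x 1)} \<times> ?D)" (is "_ = ?img")
        unfolding X in_family.simps by (simp only: img)
      have mem: "1 \<in> {1..m}" using m by auto
      have "inj_on (case_prod form_E) ({0, invol (x 1)} \<times> ?D)"
      proof (rule inj_onI, clarify)
        fix c d c' d' assume eq: "form_E c d = form_E c' d'"
        show "c = c' \<and> d = d'"
          using fun_cong[OF fun_cong[OF eq, of "z 1"], of "z 1"] fun_cong[OF fun_cong[OF eq, of "z 1"], of "x 1"]
          unfolding form_E_gens(1)[OF n m] form_E_gens(2)[OF n m mem] by auto
      qed
      moreover have "mu \<in> ?img" unfolding *[symmetric] using mu(2) by simp
      moreover have "mu \<noteq> case_prod form_E (0, 0)" using mu trivial_forms by simp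
      ultimately have "card ?img \<in> {2, 4}" by (rule card_product_2_4[OF _ sub, rotated]) simp
      then show ?thesis using rings * by simp
    qed
  qed
qed

end

section \<open>Distinguishing the groups\<close>

text \<open>
  Four properties of the group alone that determine the family, up to the overlap of D and E. They
  recover, in this order, whether \<open>n = 0\<close>, whether \<open>n = 1\<close> rather than \<open>n = 2\<close>, whether \<open>m = 1\<close>
  (for \<open>n = 0\<close>), and whether the largest factor of the \<open>2\<close>-part is unique.
\<close>

definition bounded_exponent :: "'a::ab_group_add itself \<Rightarrow> bool" where
  "bounded_exponent _ \<longleftrightarrow> (\<exists>k\<noteq>0. \<forall>g::'a. k \<odot> g = 0)"

definition pairwise_dependent :: "'a::ab_group_add itself \<Rightarrow> bool" where
  "pairwise_dependent _ \<longleftrightarrow> (\<forall>g h::'a. \<exists>a b. (a \<noteq> 0 \<or> b \<noteq> 0) \<and> a \<odot> g + b \<odot> h = 0)"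

definition unique_involution :: "'a::ab_group_add itself \<Rightarrow> bool" where
  "unique_involution _ \<longleftrightarrow> (\<exists>!t::'a. t \<noteq> 0 \<and> t + t = 0)"

definition fixed_involution :: "'a::ab_group_add itself \<Rightarrow> bool" where
  "fixed_involution _ \<longleftrightarrow>
     (\<exists>t::'a. t \<noteq> 0 \<and> t + t = 0 \<and> (\<forall>\<alpha>. group_isom \<alpha> \<longrightarrow> \<alpha> t = t))"

lemma group_isom_comp: "group_isom \<phi> \<Longrightarrow> group_isom \<psi> \<Longrightarrow> group_isom (\<psi> \<circ> \<phi>)"
  by (simp add: group_isom_def additive_def bij_comp)

context
  fixes \<phi> :: "'a::ab_group_add \<Rightarrow> 'b::ab_group_add"
  assumes \<phi>: "group_isom \<phi>"
begin

private lemma hom: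
  "\<phi> (g + h) = \<phi> g + \<phi> h" "\<phi> (k \<odot> g) = k \<odot> \<phi> g" "\<phi> g = 0 \<longleftrightarrow> g = 0" "\<phi> 0 = 0"
proof -
  have add: "additive \<phi>" and inj: "inj \<phi>" using \<phi> by (auto simp: group_isom_def bij_is_inj)
  show "\<phi> (g + h) = \<phi> g + \<phi> h" by (rule additive.add[OF add])
  show "\<phi> (k \<odot> g) = k \<odot> \<phi> g" by (rule additive_zsmul[OF add])
  show *: "\<phi> 0 = 0" by (rule additive.zero[OF add])
  show "\<phi> g = 0 \<longleftrightarrow> g = 0" using inj * by (metis injD)
qed

private lemma onto: obtains g where "h = \<phi> g"
  using \<phi> by (metis group_isom_def bij_pointE)

lemma bounded_exponent_transfer: "bounded_exponent TYPE('a) \<Longrightarrow> bounded_exponent TYPE('b)"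
  unfolding bounded_exponent_def by (metis hom(2,4) onto)

lemma pairwise_dependent_transfer: "pairwise_dependent TYPE('a) \<Longrightarrow> pairwise_dependent TYPE('b)"
proof -
  assume dep: "pairwise_dependent TYPE('a)"
  have "\<exists>a b. (a \<noteq> 0 \<or> b \<noteq> 0) \<and> a \<odot> g + b \<odot> h = 0" for g h :: 'b
  proof -
    obtain g' where g: "g = \<phi> g'" by (rule onto)
    obtain h' where h: "h = \<phi> h'" by (rule onto)
    obtain a b where "a \<noteq> 0 \<or> b \<noteq> 0" "a \<odot> g' + b \<odot> h' = 0"
      using dep unfolding pairwise_dependent_def by blast
    then show ?thesis using hom g h by metis
  qed
  then show ?thesis by (simp add: pairwise_dependent_def)
qed

lemma unique_involution_transfer: "unique_involution TYPE('a) \<Longrightarrow> unique_involution TYPE('b)"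
proof -
  assume "unique_involution TYPE('a)"
  then obtain t where t: "t \<noteq> 0" "t + t = 0" "\<And>u::'a. u \<noteq> 0 \<Longrightarrow> u + u = 0 \<Longrightarrow> u = t"
    unfolding unique_involution_def by blast
  show ?thesis unfolding unique_involution_def
  proof (rule ex1I[of _ "\<phi> t"])
    show "\<phi> t \<noteq> 0 \<and> \<phi> t + \<phi> t = 0" using t hom by metis
    fix u :: 'b assume u: "u \<noteq> 0 \<and> u + u = 0"
    obtain v where v: "u = \<phi> v" by (rule onto)
    then have "v \<noteq> 0" "v + v = 0" using u hom by metis+
    then show "u = \<phi> t" using t(3) v by simp
  qed
qed

lemma fixed_involution_transfer: "fixed_involution TYPE('a) \<Longrightarrow> fixed_involution TYPE('b)"
proof -
  assume "fixed_involution TYPE('a)"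
  then obtain t where t: "t \<noteq> 0" "t + t = 0" "\<And>\<alpha>::'a \<Rightarrow> 'a. group_isom \<alpha> \<Longrightarrow> \<alpha> t = t"
    unfolding fixed_involution_def by blast
  have "\<beta> (\<phi> t) = \<phi> t" if "group_isom \<beta>" for \<beta> :: "'b \<Rightarrow> 'b"
  proof -
    have "group_isom (inv \<phi> \<circ> (\<beta> \<circ> \<phi>))"
      by (intro group_isom_comp group_isom_inv \<phi> that)
    then have "inv \<phi> (\<beta> (\<phi> t)) = t" using t(3) by force
    then show ?thesis using \<phi> by (metis group_isom_def bij_inv_eq_iff)
  qed
  then show ?thesis unfolding fixed_involution_def using t hom by metis
qed

end

definition group_kind :: "'a::ab_group_add itself \<Rightarrow> nat" where
  "group_kind T =
    (if bounded_exponent T then if unique_involution T then 0 else if fixed_involution T then 1 else 2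
     else if pairwise_dependent T then 3 else 4)"

lemma group_isom_fixed_involution:
  fixes \<phi> :: "'a::ab_group_add \<Rightarrow> 'b::ab_group_add"
  assumes "group_isom \<phi>"
  shows "fixed_involution TYPE('a) \<longleftrightarrow> fixed_involution TYPE('b)"
  using fixed_involution_transfer[OF assms] fixed_involution_transfer[OF group_isom_inv[OF assms]] ..

lemma group_isom_kind:
  fixes \<phi> :: "'a::ab_group_add \<Rightarrow> 'b::ab_group_add"
  assumes "group_isom \<phi>"
  shows "group_kind TYPE('a) = group_kind TYPE('b)"
  using bounded_exponent_transfer[OF assms] bounded_exponent_transfer[OF group_isom_inv[OF assms]]
    pairwise_dependent_transfer[OF assms] pairwise_dependent_transfer[OF group_isom_inv[OF assms]]
    unique_involution_transfer[OF assms] unique_involution_transfer[OF group_isom_inv[OF assms]]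
    group_isom_fixed_involution[OF assms]
  unfolding group_kind_def by auto

fun family_kind :: "family \<Rightarrow> nat" where
  "family_kind Fam_A = 0"
| "family_kind Fam_B = 1"
| "family_kind Fam_C = 2"
| "family_kind Fam_D = 3"
| "family_kind Fam_E = 3"
| "family_kind Fam_F = 4"

lemma family_kind_eq: "family_kind X = family_kind Y \<Longrightarrow> X = Y \<or> {X, Y} = {Fam_D, Fam_E}"
  by (cases X; cases Y) auto

context decomposed_group
begin

text \<open>
  If the largest order occurs twice, a transvection moves any involution \<open>t\<close>: take a factor that
  occurs in \<open>t\<close> and a different factor of at least the same order.
\<close>

lemma fixed_involution_iff:
  assumes m: "m \<ge> 1"
  shows "fixed_involution TYPE('a) \<longleftrightarrow> single_top"
proof
  assume single_top
  then show "fixed_involution TYPE('a)"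
    unfolding fixed_involution_def
    using top_fixed invol_x_nonzero[of 1] invol_x_double[of 1] m by (intro exI[of _ "invol (x 1)"]) auto
next
  assume "fixed_involution TYPE('a)"
  then obtain t :: 'a where t: "t \<noteq> 0" "t + t = 0" "\<And>\<alpha>. group_isom \<alpha> \<Longrightarrow> \<alpha> t = t"
    unfolding fixed_involution_def by blast
  show single_top
  proof (rule ccontr)
    assume nst: "\<not> single_top"
    obtain i where i: "i \<in> {1..n} <+> {1..m}" "involves i t" using t(1) eq_0_iff_involves by blast
    show False
    proof (cases i)
      case (Inl k)
      then show False using involves_ord_0[OF t(2) i(1)] i ord_z(2) by auto
    next
      case (Inr k)
      then have k: "k \<in> {1..m}" using i by simp
      obtain j a where j: "j \<in> {1..m}" "j \<noteq> k" "ord (Inr j) = ord (Inr k) * a" "a \<noteq> 0"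
        using not_single_top_partner[OF nst k] .
      have "transvection i (Inr j) a t = t"
        by (intro t(3) group_isom_transvection) (use i j Inr in auto)
      then have "(coord t i * a) \<odot> case_sum z x (Inr j) = 0" unfolding transvection_def by simp
      then have "\<not> involves i t" using not_involves_if_transvection_fixes[OF i(1), of "Inr j" a t] j Inr by auto
      with i show False by simp
    qed
  qed
qed

lemma unique_involution_iff:
  assumes n: "n = 0" and m: "m \<ge> 1"
  shows "unique_involution TYPE('a) \<longleftrightarrow> m = 1"
proof
  assume "unique_involution TYPE('a)"
  then obtain t where t: "\<And>u::'a. u \<noteq> 0 \<Longrightarrow> u + u = 0 \<Longrightarrow> u = t"
    unfolding unique_involution_def by blast
  show "m = 1"
  proof (rule ccontr)
    assume "m \<noteq> 1"
    then have mem: "1 \<in> {1..m}" "2 \<in> {1..m}" using m by auto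
    then have "invol (x 1) = invol (x 2)"
      using t[of "invol (x 1)"] t[of "invol (x 2)"] invol_x_nonzero invol_x_double by auto
    then show False using involves_invol_x[of 1 1] involves_invol_x[of 1 2] mem by auto
  qed
next
  assume m1: "m = 1"
  show "unique_involution TYPE('a)"
    unfolding unique_involution_def
  proof (rule ex1I[of _ "invol (x 1)"])
    show "invol (x 1) \<noteq> 0 \<and> invol (x 1) + invol (x 1) = 0"
      using invol_x_nonzero[of 1] invol_x_double[of 1] m by auto
    show "t = invol (x 1)" if "t \<noteq> 0 \<and> t + t = 0" for t
      using in_top[of t] that m1 by auto
  qed
qed

lemma bounded_exponent_iff:
  assumes m: "m \<ge> 1"
  shows "bounded_exponent TYPE('a) \<longleftrightarrow> n = 0"
proof
  assume "bounded_exponent TYPE('a)"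
  then obtain k where k: "k \<noteq> 0" "\<And>g::'a. k \<odot> g = 0" unfolding bounded_exponent_def by blast
  show "n = 0"
  proof (rule ccontr)
    assume "n \<noteq> 0"
    then have "elt_order (z 1) = 0" using ord_z(1)[of 1] by simp
    then show False using k zsmul_eq_0_iff[of k "z 1"] by simp
  qed
next
  assume n: "n = 0"
  have "ord (Inr 1) \<odot> g = 0" for g :: 'a
  proof -
    have "ord i dvd ord (Inr 1) * coord g i" if i: "i \<in> {1..n} <+> {1..m}" for i
    proof -
      obtain k where "i = Inr k" "k \<in> {1..m}" using i n by auto
      then show ?thesis using ord_x_dvd[of 1 k] m by auto
    qed
    then show ?thesis by (simp only: zsmul_eq_0_iff_coord) blast
  qed
  moreover have "ord (Inr 1) \<noteq> 0" using ord_x_nonzero[of 1] m by simp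
  ultimately show "bounded_exponent TYPE('a)" unfolding bounded_exponent_def by blast
qed

text \<open>
  For \<open>n = 1\<close>, eliminating the free coordinate from \<open>g\<close> and \<open>h\<close> leaves a torsion element, which
  the order of \<open>x 1\<close> annihilates.
\<close>

lemma pairwise_dependent_iff:
  assumes m: "m \<ge> 1" and n: "n \<in> {1, 2}"
  shows "pairwise_dependent TYPE('a) \<longleftrightarrow> n = 1"
proof
  assume dep: "pairwise_dependent TYPE('a)"
  show "n = 1"
  proof (rule ccontr)
    assume "n \<noteq> 1"
    with n have mem: "1 \<in> {1..n}" "2 \<in> {1..n}" by auto
    obtain a b where ab: "a \<noteq> 0 \<or> b \<noteq> 0" "a \<odot> z 1 + b \<odot> z 2 = 0"
      using dep unfolding pairwise_dependent_def by blast
    have "coord (a \<odot> z 1 + b \<odot> z 2) (Inl i) = coord (a \<odot> z 1) (Inl i) + coord (b \<odot> z 2) (Inl i)"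
      and "coord (a \<odot> z 1) (Inl i) = (if i = 1 then a else 0)"
      and "coord (b \<odot> z 2) (Inl i) = (if i = 2 then b else 0)"
      and "coord 0 (Inl i) = 0" if "i \<in> {1..n}" for i
      using coord_add[of "Inl i" "a \<odot> z 1" "b \<odot> z 2"] coord_gen_zsmul[of "Inl i" "Inl 1" a]
        coord_gen_zsmul[of "Inl i" "Inl 2" b] bspec[OF iffD1[OF eq_0_iff_coord refl], of "Inl i"] ord_z(2)[OF that] mem that by auto
    from this[OF mem(1)] this[OF mem(2)] ab show False by auto
  qed
next
  assume n: "n = 1"
  show "pairwise_dependent TYPE('a)"
    unfolding pairwise_dependent_def
  proof (intro allI)
    fix g h :: 'a
    let ?N = "ord (Inr 1)" and ?a = "z_coord g" and ?b = "z_coord h"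
    have N: "?N \<noteq> 0" using ord_x_nonzero[of 1] m by simp
    show "\<exists>a b. (a \<noteq> 0 \<or> b \<noteq> 0) \<and> a \<odot> g + b \<odot> h = 0"
    proof (cases "?a = 0 \<and> ?b = 0")
      case True
      then have "?N \<odot> g + 0 \<odot> h = 0" using torsion_iff[OF n m, of g] by simp
      then show ?thesis using N by blast
    next
      case False
      have "z_coord (?b \<odot> g - ?a \<odot> h) = 0"
        using additive.diff[OF z_coord_additive[OF n m]] z_coord_zsmul[OF n m] by simp
      then have "?N \<odot> (?b \<odot> g - ?a \<odot> h) = 0" using torsion_iff[OF n m] by blast
      then have "(?N * ?b) \<odot> g + (- (?N * ?a)) \<odot> h = 0" by (simp add: zmod.scale_right_diff_distrib)
      moreover have "?N * ?b \<noteq> 0 \<or> - (?N * ?a) \<noteq> 0" using N False by auto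
      ultimately show ?thesis by blast
    qed
  qed
qed

lemma occurs_in_facts:
  assumes "occurs_in X n m z x"
  shows "m \<ge> 1"
    "X = Fam_A \<Longrightarrow> n = 0 \<and> m = 1" "X = Fam_B \<Longrightarrow> n = 0 \<and> m \<noteq> 1 \<and> single_top"
    "X = Fam_C \<Longrightarrow> n = 0 \<and> m \<noteq> 1 \<and> \<not> single_top" "X = Fam_D \<Longrightarrow> n = 1"
    "X = Fam_E \<Longrightarrow> n = 1 \<and> single_top" "X = Fam_F \<Longrightarrow> n = 2"
proof -
  obtain mu where mu: "in_family X n m z x mu" using assms by (auto simp: occurs_in_def)
  show "m \<ge> 1"
    using mu by (cases X)
      (auto simp: family_A_def family_B_def family_C_def family_D_def family_E_def family_F_def
        dest: family_D_with_facts(2))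
  show "X = Fam_A \<Longrightarrow> n = 0 \<and> m = 1" using mu by (auto simp: family_A_def)
  show "X = Fam_B \<Longrightarrow> n = 0 \<and> m \<noteq> 1 \<and> single_top" using mu by (auto simp: family_B_def single_top_def)
  show "X = Fam_C \<Longrightarrow> n = 0 \<and> m \<noteq> 1 \<and> \<not> single_top" using mu by (auto simp: family_C_def single_top_def)
  show "X = Fam_D \<Longrightarrow> n = 1" using mu by (auto simp: family_D_def dest: family_D_with_facts(1))
  show "X = Fam_E \<Longrightarrow> n = 1 \<and> single_top" using mu by (simp add: family_E_iff)
  show "X = Fam_F \<Longrightarrow> n = 2" using mu by (simp add: family_F_def)
qed

lemma occurs_in_kind:
  assumes "occurs_in X n m z x"
  shows "group_kind TYPE('a) = family_kind X"
proof -
  note f = occurs_in_facts[OF assms]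
  note bounded = bounded_exponent_iff[OF f(1)] and fixed = fixed_involution_iff[OF f(1)]
    and unique = unique_involution_iff[OF _ f(1)] and dep = pairwise_dependent_iff[OF f(1)]
  show ?thesis
    using f bounded fixed unique dep unfolding group_kind_def by (cases X) auto
qed

lemma family_D_with_not_single_top:
  assumes D: "family_D_with k n m z x mu" and k: "k \<noteq> 1"
  shows "\<not> single_top"
proof -
  have "1 \<le> k" "k \<le> m" "\<And>i. i \<in> {1..k} \<Longrightarrow> elt_order (x i) = elt_order (x 1)"
    using D unfolding family_D_with_def by blast+
  note o = this
  have "elt_order (x 2) = elt_order (x 1)" by (rule o(3)) (use k o(1) in auto)
  moreover have "2 \<le> m" using k o(1,2) by linarith
  ultimately show ?thesis by (simp add: single_top_def)
qed

lemma family_D_with_1_family_E: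
  assumes "family_D_with 1 n m z x mu"
  shows "family_E n m z x mu"
  unfolding family_E_def
proof (intro conjI)
  note f = assms[unfolded family_D_with_def]
  show "comm_bilinear mu" "n = 1" "1 \<le> m" using f by blast+
  show "m = 1 \<or> 1 < m \<and> elt_order (x 2) < elt_order (x 1)" using f by (auto simp: numeral_2_eq_2)
  show "mu (z 1) (x 1) \<noteq> 0 \<longrightarrow> 4 \<le> elt_order (x 1)" using f by blast
  show "mu (z 1) (z 1) \<in> {0, invol (x 1)}" "mu (z 1) (x 1) \<in> {0, invol (x 1)}" using f by auto
  have "{2..m} = {1<..m}" by auto
  then show "\<forall>i\<in>{2..m}. mu (z 1) (x i) = 0" using f by simp
  show "\<forall>i\<in>{1..m}. \<forall>j\<in>{1..m}. mu (x i) (x j) = 0" using f by blast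
qed

end

section \<open>Enlarging by a group of odd order\<close>

text \<open>
  Lagrange's theorem for a finite abelian group, by translating the sum of all elements.
\<close>

lemma card_zsmul_eq_0:
  fixes d :: "'d::{ab_group_add,finite}"
  shows "int (card (UNIV :: 'd set)) \<odot> d = 0"
proof -
  have "(\<Sum>g\<in>UNIV. g + d) = (\<Sum>g\<in>UNIV. g)"
    by (rule sum.reindex_bij_witness[of _ "\<lambda>g. g - d" "\<lambda>g. g + d"]) auto
  then have "(\<Sum>g\<in>(UNIV::'d set). d) = 0" by (simp add: sum.distrib)
  then show ?thesis using zmod.sum_constant_scale[of d "UNIV :: 'd set"] by simp
qed

lemma circ_enlarge:
  "circ (enlarge mu) p q = (circ mu (fst p) (fst q), snd p + snd q)"
  by (simp add: circ_def enlarge_def plus_prod_def)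

context decomposed_group
begin

text \<open>
  The free part of \<open>G\<close> may be mixed with \<open>D\<close>, so \<open>G\<close> need not be preserved. But \<open>D\<close> is the
  odd torsion, hence preserved, and \<open>\<alpha>\<close> induces an automorphism of \<open>G\<close> as the quotient by \<open>D\<close>.
  Elements of order at most two have no room for a component in \<open>D\<close>.
\<close>

lemma enlarge_automorphism:
  fixes \<alpha> :: "'a \<times> 'd::{ab_group_add,finite} \<Rightarrow> 'a \<times> 'd"
  assumes odd: "odd (card (UNIV :: 'd set))" and \<alpha>: "group_isom \<alpha>"
  obtains \<beta> where "group_isom \<beta>" "\<And>p. fst (\<alpha> p) = \<beta> (fst p)"
    "\<And>t. t + t = 0 \<Longrightarrow> \<alpha> (t, 0) = (\<beta> t, 0)"
proof -
  let ?N = "int (card (UNIV :: 'd set))"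
  have oddN: "odd ?N" using odd by simp
  have fstk: "fst (k \<odot> p) = k \<odot> fst p" and sndk: "snd (k \<odot> p) = k \<odot> snd p" for k and p :: "'a \<times> 'd"
    using additive_zsmul[of fst k p] additive_zsmul[of snd k p] by (simp_all add: additive_def)
  have kill: "fst (\<gamma> (0, d)) = 0" if \<gamma>: "group_isom \<gamma>" for \<gamma> :: "'a \<times> 'd \<Rightarrow> 'a \<times> 'd" and d
  proof -
    have add: "additive \<gamma>" using \<gamma> by (simp add: group_isom_def)
    have "?N \<odot> (0::'a, d) = 0"
      using card_zsmul_eq_0[of d] by (simp add: prod_eq_iff fstk sndk)
    then have "?N \<odot> \<gamma> (0, d) = 0" by (metis additive_zsmul[OF add] additive.zero[OF add])
    then have "?N \<odot> fst (\<gamma> (0, d)) = 0" using fstk by (metis fst_zero)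
    then show ?thesis using odd_zsmul_eq_0[OF oddN] by blast
  qed
  have add: "additive \<alpha>" and bij: "bij \<alpha>" using \<alpha> by (auto simp: group_isom_def)
  define \<beta> where "\<beta> g = fst (\<alpha> (g, 0))" for g
  have fst: "fst (\<alpha> p) = \<beta> (fst p)" for p
  proof -
    have "\<alpha> p = \<alpha> (fst p, 0) + \<alpha> (0, snd p)"
      unfolding additive.add[OF add, symmetric] by simp
    then show ?thesis using kill[OF \<alpha>] by (simp add: \<beta>_def)
  qed
  have "additive \<beta>"
  proof
    fix g h
    have "\<alpha> (g + h, 0) = \<alpha> (g, 0) + \<alpha> (h, 0)" unfolding additive.add[OF add, symmetric] by simp
    then show "\<beta> (g + h) = \<beta> g + \<beta> h" by (simp add: \<beta>_def)
  qed
  moreover have "inj \<beta>"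
  proof (rule injI)
    fix g h assume "\<beta> g = \<beta> h"
    then have "\<beta> (g - h) = 0" by (simp add: additive.diff[OF \<open>additive \<beta>\<close>])
    then have "\<alpha> (g - h, 0) = (0, snd (\<alpha> (g - h, 0)))" by (simp add: prod_eq_iff \<beta>_def)
    then have "inv \<alpha> (0, snd (\<alpha> (g - h, 0))) = (g - h, 0)" using bij by (metis bij_inv_eq_iff)
    then show "g = h" using kill[OF group_isom_inv[OF \<alpha>]] by (metis fst_conv right_minus_eq)
  qed
  moreover have "surj \<beta>"
  proof (rule surjI)
    show "\<beta> (fst (inv \<alpha> (g, 0))) = g" for g
      using fst[of "inv \<alpha> (g, 0)"] bij by (simp add: bij_is_surj surj_f_inv_f)
  qed
  ultimately have "group_isom \<beta>" by (simp add: group_isom_def bij_def)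
  moreover have "\<alpha> (t, 0) = (\<beta> t, 0)" if t: "t + t = 0" for t
  proof -
    have "\<alpha> (t, 0) + \<alpha> (t, 0) = 0"
      unfolding additive.add[OF add, symmetric] using t additive.zero[OF add] by (simp add: zero_prod_def)
    then have "snd (\<alpha> (t, 0)) + snd (\<alpha> (t, 0)) = 0" by (metis snd_add snd_zero)
    then have "snd (\<alpha> (t, 0)) = 0"
      using double_zsmul[of "snd (\<alpha> (t, 0))" ?N] oddN card_zsmul_eq_0[of "snd (\<alpha> (t, 0))"] by simp
    then show ?thesis by (simp add: prod_eq_iff \<beta>_def)
  qed
  ultimately show ?thesis using that fst by blast
qed

text \<open>
  The circle group of the enlarged ring is the direct product of the circle group of \<open>G\<close> with \<open>D\<close>.
  For automorphisms, all products lie in \<open>G\<close> and have order at most two, so the induced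
  automorphism of \<open>G\<close> suffices.
\<close>

lemma good_ring_enlarge:
  assumes good: "good_ring mu" and odd: "odd (card (UNIV :: 'd::{ab_group_add,finite} set))"
  shows "good_ring (enlarge mu :: 'a \<times> 'd \<Rightarrow> 'a \<times> 'd \<Rightarrow> 'a \<times> 'd)"
proof -
  let ?nu = "enlarge mu :: 'a \<times> 'd \<Rightarrow> 'a \<times> 'd \<Rightarrow> 'a \<times> 'd"
  have inv: "invariant_form mu" and bil: "comm_bilinear mu" and circ: "circ_group_isomorphic mu"
    and assoc: "\<And>a b c. mu (mu a b) c = mu a (mu b c)" and nt: "mu \<noteq> trivial_mult"
    using good good_ring_invariant_form by (auto simp: good_ring_def comm_ring_structure_iff)
  have "comm_ring_structure ?nu"
    unfolding comm_ring_structure_iff comm_bilinear_def additive_def enlarge_def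
    using comm_bilinear_commute[OF bil] assoc by (auto simp: comm_bilinear_simps[OF bil])
  moreover have "?nu \<noteq> trivial_mult"
  proof
    assume triv: "?nu = trivial_mult"
    have "mu g h = 0" for g h
      using fun_cong[OF fun_cong[OF triv, of "(g, 0)"], of "(h, 0)"]
      by (simp add: enlarge_def trivial_mult_def zero_prod_def)
    then show False using nt by (simp add: trivial_mult_def fun_eq_iff)
  qed
  moreover have "circ_group_isomorphic ?nu"
  proof -
    obtain e iv where "group (circ mu) e iv"
      using circ by (auto simp: circ_group_isomorphic_def)
    then interpret G: group "circ mu" e iv .
    obtain \<phi> :: "'a \<Rightarrow> 'a" where \<phi>: "bij \<phi>" "\<forall>g h. \<phi> (g + h) = circ mu (\<phi> g) (\<phi> h)"
      using circ unfolding circ_group_isomorphic_def by blast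
    have "group (circ ?nu) (e, 0) (\<lambda>p. (iv (fst p), - snd p))"
      by unfold_locales (simp_all add: circ_enlarge G.assoc add.assoc)
    moreover have "bij (map_prod \<phi> (id :: 'd \<Rightarrow> 'd))"
      using bij_betw_map_prod[OF \<phi>(1) bij_id] by simp
    moreover have "map_prod \<phi> id (p + q) = circ ?nu (map_prod \<phi> id p) (map_prod \<phi> id q)" for p q :: "'a \<times> 'd"
      by (simp add: circ_enlarge \<phi>(2) prod_eq_iff)
    ultimately show ?thesis unfolding circ_group_isomorphic_def by blast
  qed
  moreover have "automorphisms_lift ?nu"
    unfolding automorphisms_lift_iff
  proof (intro allI impI)
    fix \<alpha> :: "'a \<times> 'd \<Rightarrow> 'a \<times> 'd" and p q :: "'a \<times> 'd" assume \<alpha>: "group_isom \<alpha>"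
    obtain \<beta> where \<beta>: "group_isom \<beta>" "\<And>p. fst (\<alpha> p) = \<beta> (fst p)"
      "\<And>t. t + t = 0 \<Longrightarrow> \<alpha> (t, 0) = (\<beta> t, 0)"
      using enlarge_automorphism[OF odd \<alpha>] by blast
    have "\<beta> (mu (fst p) (fst q)) = mu (\<beta> (fst p)) (\<beta> (fst q))"
      using inv \<beta>(1) by (simp add: invariant_form_def)
    then show "\<alpha> (?nu p q) = ?nu (\<alpha> p) (\<alpha> q)"
      using \<beta>(2) \<beta>(3)[OF invariant_form_double[OF inv]] by (simp add: enlarge_def)
  qed
  ultimately show ?thesis by (simp add: good_ring_def)
qed

end

section \<open>The classification theorem\<close>

theorem theorem4p17:
  fixes n m :: nat and z x :: "nat \<Rightarrow> 'a::ab_group_add"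
  assumes "decomposition n m z x"
  shows
    "(\<forall>mu. good_ring mu \<longleftrightarrow> mu \<noteq> trivial_mult \<and> (\<exists>X. in_family X n m z x mu)) \<and>

     (\<forall>X Y n' m' (z' :: nat \<Rightarrow> 'b::ab_group_add) x'.
        decomposition n' m' z' x' \<and> X \<noteq> Y \<and> {X, Y} \<noteq> {Fam_D, Fam_E} \<and>
        occurs_in X n m z x \<and> occurs_in Y n' m' z' x' \<longrightarrow>
        (\<nexists>\<phi> :: 'a \<Rightarrow> 'b. group_isom \<phi>)) \<and>
     (\<forall>k mu n' m' (z' :: nat \<Rightarrow> 'b) x'.
        decomposition n' m' z' x' \<and> family_D_with k n m z x mu \<and> k \<noteq> 1 \<and>
        occurs_in Fam_E n' m' z' x' \<longrightarrow>
        (\<nexists>\<phi> :: 'a \<Rightarrow> 'b. group_isom \<phi>)) \<and>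
     (\<forall>mu. family_D_with 1 n m z x mu \<longrightarrow> family_E n m z x mu) \<and>

     (\<forall>X. occurs_in X n m z x \<longrightarrow>
        (X \<in> {Fam_B, Fam_E} \<longrightarrow> card (family_rings X n m z x) \<in> {2, 4}) \<and>
        (X \<notin> {Fam_B, Fam_E} \<longrightarrow> card (family_rings X n m z x) = 2) \<and>
        (X \<in> {Fam_A, Fam_B, Fam_E, Fam_F} \<longrightarrow> in_family X n m z x trivial_mult) \<and>
        (\<forall>mu \<in> family_rings X n m z x. \<forall>nu \<in> family_rings X n m z x.
           (\<exists>\<phi>. ring_isom mu nu \<phi>) \<longrightarrow> mu = nu)) \<and>

     (\<forall>mu. mu \<noteq> trivial_mult \<and> (\<exists>X. in_family X n m z x mu) \<and>
        odd (card (UNIV :: 'd::{ab_group_add,finite} set)) \<longrightarrow>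
        good_ring (enlarge mu :: 'a \<times> 'd \<Rightarrow> 'a \<times> 'd \<Rightarrow> 'a \<times> 'd))"
proof -
  interpret G: decomposed_group n m z x using assms by unfold_locales
  have not_isom: "\<nexists>\<phi> :: 'a \<Rightarrow> 'b. group_isom \<phi>"
    if "decomposition n' m' z' x' \<and> X \<noteq> Y \<and> {X, Y} \<noteq> {Fam_D, Fam_E} \<and>
      occurs_in X n m z x \<and> occurs_in Y n' m' z' x'"
    for X Y n' m' and z' :: "nat \<Rightarrow> 'b" and x'
  proof -
    interpret G': decomposed_group n' m' z' x' using that by unfold_locales blast
    have "family_kind X \<noteq> family_kind Y" using that family_kind_eq by blast
    then have "group_kind TYPE('a) \<noteq> group_kind TYPE('b)"
      using that G.occurs_in_kind G'.occurs_in_kind by metis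
    then show ?thesis using group_isom_kind by blast
  qed
  have not_isom_DE: "\<nexists>\<phi> :: 'a \<Rightarrow> 'b. group_isom \<phi>"
    if "decomposition n' m' z' x' \<and> family_D_with k n m z x mu \<and> k \<noteq> 1 \<and>
      occurs_in Fam_E n' m' z' x'"
    for k mu n' m' and z' :: "nat \<Rightarrow> 'b" and x'
  proof -
    interpret G': decomposed_group n' m' z' x' using that by unfold_locales blast
    have "fixed_involution TYPE('b)"
      using G'.occurs_in_facts[of Fam_E] G'.fixed_involution_iff that by blast
    moreover have "\<not> fixed_involution TYPE('a)"
      using G.family_D_with_not_single_top G.family_D_with_facts(2) G.fixed_involution_iff that by blast
    ultimately show ?thesis using group_isom_fixed_involution by blast
  qed
  show ?thesis
  proof (intro conjI)
    show "\<forall>mu. good_ring mu \<longleftrightarrow> mu \<noteq> trivial_mult \<and> (\<exists>X. in_family X n m z x mu)"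
      using G.good_ring_iff_in_family by blast
    show "\<forall>X. occurs_in X n m z x \<longrightarrow>
        (X \<in> {Fam_B, Fam_E} \<longrightarrow> card (family_rings X n m z x) \<in> {2, 4}) \<and>
        (X \<notin> {Fam_B, Fam_E} \<longrightarrow> card (family_rings X n m z x) = 2) \<and>
        (X \<in> {Fam_A, Fam_B, Fam_E, Fam_F} \<longrightarrow> in_family X n m z x trivial_mult) \<and>
        (\<forall>mu \<in> family_rings X n m z x. \<forall>nu \<in> family_rings X n m z x.
           (\<exists>\<phi>. ring_isom mu nu \<phi>) \<longrightarrow> mu = nu)"
      using G.family_card G.family_ring_isom_eq by blast
    show "\<forall>mu. family_D_with 1 n m z x mu \<longrightarrow> family_E n m z x mu"
      using G.family_D_with_1_family_E by blast
    show "\<forall>mu. mu \<noteq> trivial_mult \<and> (\<exists>X. in_family X n m z x mu) \<and>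
        odd (card (UNIV :: 'd set)) \<longrightarrow>
        good_ring (enlarge mu :: 'a \<times> 'd \<Rightarrow> 'a \<times> 'd \<Rightarrow> 'a \<times> 'd)"
      using G.good_ring_iff_in_family G.good_ring_enlarge by blast
  qed (use not_isom not_isom_DE in blast)+
qed

end
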